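(* The Veronese embedding $\varphi_{\mathcal{O}_{\mathbb{P}^3}(3)}:\mathbb{P}^3\hookrightarrow\mathbb{P}^{19}$ satisfies property $N_6$.
   Context: The base field $K$ is algebraically closed of characteristic zero. $\varphi_{\mathcal{O}_{\mathbb{P}^n}(d)}:\mathbb{P}^n\hookrightarrow\mathbb{P}^N$, $N+1=\binom{n+d}{n}$, is the embedding given by the complete linear system $|\mathcal{O}_{\mathbb{P}^n}(d)|$ (here $n=d=3$). Let $S=\bigoplus_{k\ge 0}S^k\big(H^0(\mathbb{P}^n,\mathcal{O}_{\mathbb{P}^n}(d))\big)$ be the homogeneous coordinate ring of $\mathbb{P}^N$ and let $R=\bigoplus_{k\ge0}H^0(\mathbb{P}^n,\mathcal{O}_{\mathbb{P}^n}(kd))$, a graded $S$-module. Let $$0\to\bigoplus_j S(-j)^{\widetilde b_{rj}}\to\cdots\to\bigoplus_j S(-j)^{\widetilde b_{0j}}\to R\to 0$$ be a minimal graded free resolution of $R$, with graded Betti numbers $\widetilde b_{ij}$. For an integer $p\ge0$, the embedding satisfies property $N_p$ if $\widetilde b_{00}=1$, $\widetilde b_{0j}=0$ for $j\ne0$, and $\widetilde b_{ij}=0$ for all $j\neq i+1$ whenever $1\le i\le p$. *)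

theory Defs
  imports
    "HOL-Library.Poly_Mapping"
    "HOL-Computational_Algebra.Computational_Algebra"
begin

text \<open>
  Polynomials are finitely supported functions from monomials to coefficients, and monomials are
  finitely supported exponent functions; the product is the convolution product of
  \<^theory>\<open>HOL-Library.Poly_Mapping\<close>. The set of variables is not the whole type \<open>'v\<close> but an
  explicit subset \<open>V\<close>.
\<close>

type_synonym ('v, 'k) mvpoly = "('v \<Rightarrow>\<^sub>0 nat) \<Rightarrow>\<^sub>0 'k"

definition total_degree :: "('v \<Rightarrow>\<^sub>0 nat) \<Rightarrow> nat" where
  "total_degree m = (\<Sum>v\<in>Poly_Mapping.keys m. Poly_Mapping.lookup m v)"

definition monomials :: "'v set \<Rightarrow> int \<Rightarrow> ('v \<Rightarrow>\<^sub>0 nat) set" where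
  "monomials V k = {m. Poly_Mapping.keys m \<subseteq> V \<and> int (total_degree m) = k}"

definition polys :: "'v set \<Rightarrow> ('v, 'k::zero) mvpoly set" where
  "polys V = {p. \<forall>m\<in>Poly_Mapping.keys p. Poly_Mapping.keys m \<subseteq> V}"

text \<open>Homogeneous polynomials of degree \<open>k\<close>, including \<open>0\<close>; only \<open>0\<close> if \<open>k < 0\<close>.\<close>

definition forms :: "'v set \<Rightarrow> int \<Rightarrow> ('v, 'k::zero) mvpoly set" where
  "forms V k = {p. Poly_Mapping.keys p \<subseteq> monomials V k}"

definition irrelevant_ideal :: "'v set \<Rightarrow> ('v, 'k::zero) mvpoly set" where
  "irrelevant_ideal V = {p \<in> polys V. Poly_Mapping.lookup p 0 = 0}"

text \<open>The value at \<open>p\<close> of the \<open>'k\<close>-algebra homomorphism that sends each variable \<open>v\<close> to \<open>f v\<close>.\<close>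

definition subst_poly ::
    "('v \<Rightarrow> ('w, 'k::comm_ring_1) mvpoly) \<Rightarrow> ('v, 'k) mvpoly \<Rightarrow> ('w, 'k) mvpoly" where
  "subst_poly f p = (\<Sum>m\<in>Poly_Mapping.keys p.
     Poly_Mapping.single 0 (Poly_Mapping.lookup p m) *
     (\<Prod>v\<in>Poly_Mapping.keys m. f v ^ Poly_Mapping.lookup m v))"

text \<open>
  A graded module over \<open>polys V\<close> is given by its homogeneous components \<open>M k\<close>, subgroups of an
  ambient abelian group, and by the action \<open>act\<close> of \<open>polys V\<close>; its carrier is the sum of the
  components.
\<close>

definition total_module :: "(int \<Rightarrow> 'm::comm_monoid_add set) \<Rightarrow> 'm set" where
  "total_module M = {\<Sum>k\<in>I. x k | I x. finite I \<and> (\<forall>k\<in>I. x k \<in> M k)}"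

text \<open>
  Data of a complex \<open>0 \<rightarrow> F\<^sub>r \<rightarrow> \<dots> \<rightarrow> F\<^sub>0 \<rightarrow> M\<close> with \<open>r = res_length\<close>. The module
  \<open>F\<^sub>i\<close> is free on the basis elements \<open>e < rk i\<close>, the basis element \<open>e\<close> having degree \<open>shift i e\<close>;
  thus \<open>F\<^sub>i\<close> is the direct sum of the \<open>S(- shift i e)\<close>. For \<open>i \<ge> 1\<close>, \<open>mat i a e\<close> is the coefficient
  at \<open>a < rk (i - 1)\<close> of the image in \<open>F\<^sub>i\<^sub>-\<^sub>1\<close> of the basis element \<open>e < rk i\<close>; \<open>aug e\<close> is the image
  in \<open>M\<close> of the basis element \<open>e < rk 0\<close>.
\<close>

record (overloaded) ('v, 'k, 'm) graded_free_complex =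
  res_length :: nat
  rk :: "nat \<Rightarrow> nat"
  shift :: "nat \<Rightarrow> nat \<Rightarrow> int"
  mat :: "nat \<Rightarrow> nat \<Rightarrow> nat \<Rightarrow> (('v \<Rightarrow>\<^sub>0 nat) \<Rightarrow>\<^sub>0 'k)"
  aug :: "nat \<Rightarrow> 'm"

definition free_mod :: "'v set \<Rightarrow> nat \<Rightarrow> (nat \<Rightarrow> ('v, 'k::zero) mvpoly) set" where
  "free_mod V n = {u. (\<forall>e<n. u e \<in> polys V) \<and> (\<forall>e\<ge>n. u e = 0)}"

definition differential ::
    "('v, 'k::comm_ring_1, 'm) graded_free_complex \<Rightarrow> nat \<Rightarrow>
     (nat \<Rightarrow> ('v, 'k) mvpoly) \<Rightarrow> nat \<Rightarrow> ('v, 'k) mvpoly" where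
  "differential F i u = (\<lambda>a. if a < rk F (i - 1) then \<Sum>e<rk F i. mat F i a e * u e else 0)"

definition augmentation ::
    "(('v, 'k::zero) mvpoly \<Rightarrow> 'm \<Rightarrow> 'm) \<Rightarrow> ('v, 'k, 'm::comm_monoid_add) graded_free_complex \<Rightarrow>
     (nat \<Rightarrow> ('v, 'k) mvpoly) \<Rightarrow> 'm" where
  "augmentation act F u = (\<Sum>e<rk F 0. act (u e) (aug F e))"

definition graded_free_resolution ::
    "'v set \<Rightarrow> (('v, 'k::comm_ring_1) mvpoly \<Rightarrow> 'm \<Rightarrow> 'm) \<Rightarrow> (int \<Rightarrow> 'm::ab_group_add set) \<Rightarrow>
     ('v, 'k, 'm) graded_free_complex \<Rightarrow> bool" where
  "graded_free_resolution V act M F \<longleftrightarrow>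
     (\<forall>i>res_length F. rk F i = 0) \<and>
     (\<forall>e<rk F 0. aug F e \<in> M (shift F 0 e)) \<and>
     (\<forall>i\<ge>1. \<forall>a<rk F (i - 1). \<forall>e<rk F i.
        mat F i a e \<in> forms V (shift F i e - shift F (i - 1) a)) \<and>
     augmentation act F ` free_mod V (rk F 0) = total_module M \<and>
     {u \<in> free_mod V (rk F 0). augmentation act F u = 0}
       = differential F 1 ` free_mod V (rk F 1) \<and>
     (\<forall>i\<ge>1. {u \<in> free_mod V (rk F i). differential F i u = (\<lambda>_. 0)}
       = differential F (i + 1) ` free_mod V (rk F (i + 1)))"

text \<open>Minimality: the image of \<open>F\<^sub>i\<close> lies in the irrelevant ideal times \<open>F\<^sub>i\<^sub>-\<^sub>1\<close>, for \<open>i \<ge> 1\<close>.\<close>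

definition minimal_graded_free_resolution ::
    "'v set \<Rightarrow> (('v, 'k::comm_ring_1) mvpoly \<Rightarrow> 'm \<Rightarrow> 'm) \<Rightarrow> (int \<Rightarrow> 'm::ab_group_add set) \<Rightarrow>
     ('v, 'k, 'm) graded_free_complex \<Rightarrow> bool" where
  "minimal_graded_free_resolution V act M F \<longleftrightarrow>
     graded_free_resolution V act M F \<and>
     (\<forall>i\<ge>1. \<forall>u\<in>free_mod V (rk F i). \<forall>a<rk F (i - 1). differential F i u a \<in> irrelevant_ideal V)"

definition betti :: "('v, 'k, 'm) graded_free_complex \<Rightarrow> nat \<Rightarrow> int \<Rightarrow> nat" where
  "betti F i j = card {e. e < rk F i \<and> shift F i e = j}"

text \<open>
  Projective \<open>n\<close>-space has homogeneous coordinates indexed by \<open>{..n}\<close>, and the sections of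
  \<open>\<O>(k)\<close> are the forms of degree \<open>k\<close>. The variables of the homogeneous coordinate ring
  \<open>S\<close> of the target are indexed by the monomial basis of the sections of \<open>\<O>(d)\<close>, so that \<open>S\<close> is the
  symmetric algebra on these sections.
\<close>

definition sections :: "nat \<Rightarrow> int \<Rightarrow> (nat, 'k::zero) mvpoly set" where
  "sections n k = forms {..n} k"

definition veronese_vars :: "nat \<Rightarrow> nat \<Rightarrow> (nat \<Rightarrow>\<^sub>0 nat) set" where
  "veronese_vars n d = monomials {..n} (int d)"

text \<open>The component of degree \<open>k\<close> of \<open>R\<close>; it is \<open>0\<close> for \<open>k < 0\<close> as soon as \<open>d > 0\<close>.\<close>

definition veronese_module :: "nat \<Rightarrow> nat \<Rightarrow> int \<Rightarrow> (nat, 'k::zero) mvpoly set" where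
  "veronese_module n d k = sections n (k * int d)"

text \<open>\<open>S\<close> acts on \<open>R\<close> by multiplication of sections: the variable indexed by \<open>m\<close> acts as \<open>m\<close>.\<close>

definition veronese_action ::
    "(nat \<Rightarrow>\<^sub>0 nat, 'k::comm_ring_1) mvpoly \<Rightarrow> (nat, 'k) mvpoly \<Rightarrow> (nat, 'k) mvpoly" where
  "veronese_action p f = subst_poly (\<lambda>m. Poly_Mapping.single m 1) p * f"

abbreviation veronese_resolution ::
    "nat \<Rightarrow> nat \<Rightarrow> (nat \<Rightarrow>\<^sub>0 nat, 'k::comm_ring_1, (nat, 'k) mvpoly) graded_free_complex \<Rightarrow> bool"
  where "veronese_resolution n d \<equiv>
     minimal_graded_free_resolution (veronese_vars n d) veronese_action (veronese_module n d)"

text \<open>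
  Property \<open>N\<^sub>p\<close> of the embedding of projective \<open>n\<close>-space over \<open>'k\<close> by the complete linear system
  of \<open>\<O>(d)\<close>, for \<open>d > 0\<close>. Minimal graded free resolutions exist and have the same graded Betti
  numbers. To presuppose neither fact, the definition asks both for the existence of one and
  for the vanishing in every one.
\<close>

definition veronese_property_N :: "'k::comm_ring_1 itself \<Rightarrow> nat \<Rightarrow> nat \<Rightarrow> nat \<Rightarrow> bool" where
  "veronese_property_N _ n d p \<longleftrightarrow>
     (\<exists>F :: (nat \<Rightarrow>\<^sub>0 nat, 'k, (nat, 'k) mvpoly) graded_free_complex. veronese_resolution n d F) \<and>
     (\<forall>F :: (nat \<Rightarrow>\<^sub>0 nat, 'k, (nat, 'k) mvpoly) graded_free_complex. veronese_resolution n d F \<longrightarrow>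
        betti F 0 0 = 1 \<and>
        (\<forall>j. j \<noteq> 0 \<longrightarrow> betti F 0 j = 0) \<and>
        (\<forall>i j. 1 \<le> i \<and> i \<le> p \<and> j \<noteq> int i + 1 \<longrightarrow> betti F i j = 0))"

end

theory Submission
  imports Defs "HOL-Library.Function_Algebras"
begin

text \<open>
  By dimension shifting, a minimal resolution has no generator of degree \<open>j\<close> in step \<open>i\<close> as soon as the
  Koszul complex of \<open>R\<close> is exact at \<open>\<Lambda>\<^sup>i \<otimes> R\<^bsub>j - i\<^esub>\<close>; the same exactness makes the syzygy modules finitely
  generated and eventually zero, so that a finite minimal resolution exists. The cubes of the four
  coordinates form a regular sequence on \<open>R\<close>, and the quotient is Artinian with dimensions 1, 16, 10.
  Over the remaining 16 variables the only difficult point is the surjectivity of the Koszul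
  differential onto \<open>\<Lambda>\<^sup>p \<otimes> R\<^sub>2\<close> for \<open>p \<le> 6\<close>. Its transpose is the first differential, on
  \<open>\<Lambda>\<^sup>q\<close> with \<open>q = 16 - p \<ge> 10\<close>, for the Artinian reduction of the dualising module of forms of degree
  \<open>3k + 2\<close>. Lifted back to all 20 variables, its injectivity is Green's vanishing theorem, because
  there are only 10 quadrics.
\<close>

text \<open>Two demands conflict at the difficult point. Duality needs a finite-dimensional
  quotient: K[x_0, ..., x_3]/(x_i^3) has its socle in degree 8, so that degrees 6 and 3 of the
  reduction of R pair with degrees 2 and 5 of the reduction of the dualising module. Green's
  argument needs points at which sections can be evaluated, and an Artinian quotient has none. Hence
  Koszul exactness over a module and over its quotient by a regular element are compared in both
  directions: downwards for the dualising module, after Green's argument, and upwards for R, after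
  the duality. All these modules are spans of monomials inside one monoid algebra. A quotient is
  then a truncation, and the same construction serves R, the dualising module and the polynomial
  ring S itself. Exactness at \<Lambda>^i \<otimes> R_k controls the generators of degree i + k in
  step i. For i \<ge> 1 every k except 1 is therefore needed up to step 6, whereas existence of a
  finite resolution uses only large k and large i.\<close>

abbreviation lookup :: "('a \<Rightarrow>\<^sub>0 'b::zero) \<Rightarrow> 'a \<Rightarrow> 'b" where "lookup \<equiv> Poly_Mapping.lookup"
abbreviation single :: "'a \<Rightarrow> 'b::zero \<Rightarrow> 'a \<Rightarrow>\<^sub>0 'b" where "single \<equiv> Poly_Mapping.single"
abbreviation keys :: "('a \<Rightarrow>\<^sub>0 'b::zero) \<Rightarrow> 'a set" where "keys \<equiv> Poly_Mapping.keys"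

section \<open>Koszul complexes\<close>

text \<open>
  A chain of degree \<open>i\<close> is given by its coefficients \<open>z A\<close> at the exterior monomials indexed by the
  \<open>i\<close>-element subsets \<open>A\<close> of \<open>X\<close>; the operators \<open>T v\<close> are the multiplications by the variables.
\<close>

definition signed :: "'v::linorder \<Rightarrow> 'v set \<Rightarrow> 'm::ab_group_add \<Rightarrow> 'm" where
  "signed v A m = (if even (card {a \<in> A. a < v}) then m else - m)"

text \<open>The usual differential sends e_B to the signed sum of v e_(B - v) over the v in B. Read
  off at the coefficient of e_A, it becomes a sum over the v outside A.\<close>

definition koszul_diff :: "('v::linorder \<Rightarrow> 'm \<Rightarrow> 'm) \<Rightarrow> 'v set \<Rightarrow> ('v set \<Rightarrow> 'm::ab_group_add) \<Rightarrow> 'v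
  set \<Rightarrow> 'm" where
  "koszul_diff T X z A = (if A \<subseteq> X then \<Sum>v\<in>X - A. signed v A (T v (z (insert v A))) else 0)"

definition koszul_chain :: "'v set \<Rightarrow> 'm set \<Rightarrow> nat \<Rightarrow> ('v set \<Rightarrow> 'm::zero) \<Rightarrow> bool" where
  "koszul_chain X M i z \<longleftrightarrow> (\<forall>A. z A \<in> M \<and> (z A \<noteq> 0 \<longrightarrow> A \<subseteq> X \<and> card A = i))"

text \<open>For a graded module this is the vanishing of Tor_i(M, K) in degree i + k. Exterior
  generators have degree 1, so a preimage gains one exterior degree and loses one module
  degree.\<close>

definition koszul_exact :: "('v::linorder \<Rightarrow> 'm \<Rightarrow> 'm) \<Rightarrow> 'v set \<Rightarrow> (int \<Rightarrow> 'm::ab_group_add set) \<Rightarrow> nat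
  \<Rightarrow> int \<Rightarrow> bool" where
  "koszul_exact T X M i k \<longleftrightarrow>
     (\<forall>z. koszul_chain X (M k) i z \<and> koszul_diff T X z = (\<lambda>_. 0) \<longrightarrow>
        (\<exists>w. koszul_chain X (M (k - 1)) (Suc i) w \<and> koszul_diff T X w = z))"

section \<open>Signs and the formal properties of Koszul differentials\<close>

definition subgroup_add :: "'m::ab_group_add set \<Rightarrow> bool" where
  "subgroup_add M \<longleftrightarrow> 0 \<in> M \<and> (\<forall>a\<in>M. \<forall>b\<in>M. a + b \<in> M) \<and> (\<forall>a\<in>M. - a \<in> M)"

lemma subgroup_add_zero: "subgroup_add M \<Longrightarrow> 0 \<in> M"
  and subgroup_add_add: "subgroup_add M \<Longrightarrow> a \<in> M \<Longrightarrow> b \<in> M \<Longrightarrow> a + b \<in> M"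
  and subgroup_add_minus: "subgroup_add M \<Longrightarrow> a \<in> M \<Longrightarrow> - a \<in> M"
  unfolding subgroup_add_def by auto

lemma subgroup_add_diff: "subgroup_add M \<Longrightarrow> a \<in> M \<Longrightarrow> b \<in> M \<Longrightarrow> a - b \<in> M"
  using subgroup_add_add subgroup_add_minus by fastforce

lemma subgroup_add_sum: "subgroup_add M \<Longrightarrow> (\<And>i. i \<in> I \<Longrightarrow> f i \<in> M) \<Longrightarrow> sum f I \<in> M"
  by (induction I rule: infinite_finite_induct) (auto simp: subgroup_add_zero subgroup_add_add)

lemma subgroup_add_signed: "subgroup_add M \<Longrightarrow> a \<in> M \<Longrightarrow> signed v A a \<in> M"
  by (simp add: signed_def subgroup_add_minus)

lemma signed_zero [simp]: "signed v A 0 = 0"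
  and signed_minus: "signed v A (- m) = - signed v A m"
  and signed_eq_0 [simp]: "signed v A m = 0 \<longleftrightarrow> m = 0"
  and signed_signed [simp]: "signed v A (signed v A m) = m"
  by (simp_all add: signed_def)

lemma signed_add: "signed v A (m + n) = signed v A m + signed v A n"
  and signed_diff: "signed v A (m - n) = signed v A m - signed v A n"
  by (simp_all add: signed_def)

lemma signed_sum: "signed v A (sum f I) = (\<Sum>i\<in>I. signed v A (f i))"
  by (simp add: signed_def sum_negf)

lemma additive_signed_commute: "additive f \<Longrightarrow> f (signed v A m) = signed v A (f m)"
  by (simp add: signed_def additive.minus)

text \<open>Exactly one of v and w precedes the other, so exactly one of the two insertions changes
  a count by one.\<close>

lemma signed_swap:
  assumes "finite A" "v \<noteq> w" "v \<notin> A" "w \<notin> A"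
  shows "signed v A (signed w (insert v A) m) = - signed w A (signed v (insert w A) m)"
proof -
  have *: "card {a \<in> insert v A. a < w} = card {a \<in> A. a < w} + (if v < w then 1 else 0)"
    if "v \<notin> A" for v w
  proof -
    have "{a \<in> insert v A. a < w} = (if v < w then insert v {a \<in> A. a < w} else {a \<in> A. a < w})"
      by auto
    with that show ?thesis using assms(1) by simp
  qed
  have "v < w \<or> w < v" "\<not> (v < w \<and> w < v)"
    using assms(2) by auto
  then show ?thesis
    unfolding signed_def using *[OF assms(3), of w] *[OF assms(4), of v] by auto
qed

text \<open>Both sides are sums over ordered pairs of distinct variables, and exchanging the members
  of a pair changes the sign. Two families of operators are allowed because Green's argument
  combines multiplication by the variables with scaling by the coordinates of a point.\<close>

lemma koszul_diff_koszul_diff: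
  assumes "finite X" "\<And>v. additive (T v)" "\<And>v. additive (T' v)"
    "\<And>v w m. T v (T' w m) = T' w (T v m)"
  shows "koszul_diff T X (koszul_diff T' X z) A = - koszul_diff T' X (koszul_diff T X z) A"
proof (cases "A \<subseteq> X")
  case True
  then have fA: "finite A" using assms(1) finite_subset by auto
  have ex: "koszul_diff T1 X (koszul_diff T2 X z) A =
      (\<Sum>v\<in>X - A. \<Sum>w\<in>X - A. if w = v then 0 else
         signed v A (signed w (insert v A) (T1 v (T2 w (z (insert w (insert v A)))))))"
    if a: "\<And>v. additive (T1 v)" for T1 T2
  proof -
    have "signed v A (T1 v (koszul_diff T2 X z (insert v A))) = (\<Sum>w\<in>X - A. if w = v then 0 else
         signed v A (signed w (insert v A) (T1 v (T2 w (z (insert w (insert v A)))))))"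
      if v: "v \<in> X - A" for v
    proof -
      have "signed v A (T1 v (koszul_diff T2 X z (insert v A))) =
        (\<Sum>w\<in>X - insert v A. signed v A (signed w (insert v A) (T1 v (T2 w (z (insert w (insert v A)))))))"
        using v True by (simp add: koszul_diff_def additive.sum[OF a] signed_sum
          additive_signed_commute[OF a])
      also have "\<dots> = (\<Sum>w\<in>X - A. if w = v then 0 else
         signed v A (signed w (insert v A) (T1 v (T2 w (z (insert w (insert v A)))))))"
        using v assms(1) by (intro sum.mono_neutral_cong_left) auto
      finally show ?thesis .
    qed
    then show ?thesis using True by (simp add: koszul_diff_def)
  qed
  have "koszul_diff T X (koszul_diff T' X z) A = (\<Sum>w\<in>X - A. \<Sum>v\<in>X - A. if w = v then 0 else
         signed v A (signed w (insert v A) (T v (T' w (z (insert w (insert v A)))))))"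
    unfolding ex[OF assms(2)] by (rule sum.swap)
  also have "\<dots> = (\<Sum>w\<in>X - A. \<Sum>v\<in>X - A. - (if v = w then 0 else
         signed w A (signed v (insert w A) (T' w (T v (z (insert v (insert w A))))))))"
  proof (intro sum.cong refl)
    fix v w assume "w \<in> X - A" "v \<in> X - A"
    then show "(if w = v then 0 else signed v A (signed w (insert v A) (T v (T' w (z (insert w
      (insert v A))))))) =
        - (if v = w then 0 else signed w A (signed v (insert w A) (T' w (T v (z (insert v (insert
          w A)))))))"
      by (cases "v = w") (simp_all add: assms(4) insert_commute[of w v] signed_swap[OF fA, of v w])
  qed
  also have "\<dots> = - koszul_diff T' X (koszul_diff T X z) A"
    unfolding ex[OF assms(3)] by (simp add: sum_negf)
  finally show ?thesis .
qed (simp add: koszul_diff_def)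

text \<open>Anticommutation with T' = T says only that the double differential is its own negative;
  the absence of 2-torsion does the rest.\<close>

lemma koszul_diff_koszul_diff_zero:
  fixes z :: "'v::linorder set \<Rightarrow> 'm::ab_group_add"
  assumes "finite X" "\<And>v. additive (T v)" "\<And>v w m. T v (T w m) = T w (T v m)"
    "\<And>a :: 'm. a + a = 0 \<Longrightarrow> a = 0"
  shows "koszul_diff T X (koszul_diff T X z) A = 0"
  using koszul_diff_koszul_diff[of X T T z A] assms by (metis eq_neg_iff_add_eq_0)

lemma koszul_diff_add:
  assumes "\<And>v. additive (T v)"
  shows "koszul_diff T X (\<lambda>A. z A + w A) A = koszul_diff T X z A + koszul_diff T X w A"
  by (simp add: koszul_diff_def additive.add[OF assms] signed_add sum.distrib)

lemma koszul_diff_diff: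
  assumes "\<And>v. additive (T v)"
  shows "koszul_diff T X (\<lambda>A. z A - w A) A = koszul_diff T X z A - koszul_diff T X w A"
  by (simp add: koszul_diff_def additive.diff[OF assms] signed_diff sum_subtractf)

lemma koszul_diff_minus:
  assumes "\<And>v. additive (T v)"
  shows "koszul_diff T X (\<lambda>A. - z A) A = - koszul_diff T X z A"
  by (simp add: koszul_diff_def additive.minus[OF assms] signed_minus sum_negf)

lemma koszul_diff_zero:
  assumes "\<And>v. additive (T v)"
  shows "koszul_diff T X (\<lambda>A. 0) A = 0"
  by (simp add: koszul_diff_def additive.zero[OF assms])

text \<open>The intertwining is required only at the coefficients of z, since a projection to a
  quotient satisfies it only on the module and not on the whole ambient group.\<close>

lemma koszul_diff_hom:
  assumes "additive f" "\<And>v B. v \<in> X \<Longrightarrow> f (T v (z B)) = T' v (f (z B))"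
  shows "f (koszul_diff T X z A) = koszul_diff T' X (\<lambda>A. f (z A)) A"
  using assms(2) by (auto simp: koszul_diff_def additive.sum[OF assms(1)] additive.zero[OF assms(1)]
      additive_signed_commute[OF assms(1)] intro!: sum.cong)

lemma koszul_diff_cong: "(\<And>B. B \<subseteq> X \<Longrightarrow> z B = w B) \<Longrightarrow> koszul_diff T X z A = koszul_diff T X w A"
  by (auto simp: koszul_diff_def intro!: sum.cong)

lemma koszul_diff_chain:
  assumes "finite X" "koszul_chain X M (Suc i) z" "subgroup_add M'" "\<And>v m. v \<in> X \<Longrightarrow> m \<in> M \<Longrightarrow> T v m \<in> M'"
    "\<And>v. additive (T v)"
  shows "koszul_chain X M' i (koszul_diff T X z)"
  unfolding koszul_chain_def
proof (intro allI conjI impI)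
  fix A
  show "koszul_diff T X z A \<in> M'"
    using assms by (auto simp: koszul_diff_def koszul_chain_def intro!: subgroup_add_zero
      subgroup_add_sum subgroup_add_signed)
  assume nz: "koszul_diff T X z A \<noteq> 0"
  show A: "A \<subseteq> X" using nz by (auto simp: koszul_diff_def split: if_splits)
  obtain v where v: "v \<in> X - A" "z (insert v A) \<noteq> 0"
  proof -
    obtain v where "v \<in> X - A" "signed v A (T v (z (insert v A))) \<noteq> 0"
      using nz A sum.not_neutral_contains_not_neutral[of "\<lambda>v. signed v A (T v (z (insert v A)))" "X - A"]
      by (auto simp: koszul_diff_def)
    then show thesis using that[of v] additive.zero[OF assms(5), of v] by fastforce
  qed
  then have "card (insert v A) = Suc i" using assms(2) by (auto simp: koszul_chain_def)
  with v(1) show "card A = i" using A assms(1) by (simp add: finite_subset)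
qed

lemma koszul_diff_chain_0:
  assumes "finite X" "koszul_chain X M 0 z" "\<And>v. additive (T v)"
  shows "koszul_diff T X z = (\<lambda>_. 0)"
proof
  fix A
  have "z (insert v A) = 0" if "A \<subseteq> X" "v \<in> X" for v
    using assms that unfolding koszul_chain_def
    by (metis card_eq_0_iff finite_insert finite_subset insert_not_empty)
  then show "koszul_diff T X z A = 0"
    by (auto simp: koszul_diff_def additive.zero[OF assms(3)] intro!: sum.neutral)
qed

text \<open>With \<open>koszul_diff_insert_2\<close> this presents the complex on
  \<open>insert y X\<close> as the mapping cone of T y on the complex on X. The two components of a
  chain z are \<open>z A\<close> and \<open>signed y A (z (insert y A))\<close>, for A inside
  X.\<close>

lemma koszul_diff_insert_1:
  assumes "finite X" "y \<notin> X" "A \<subseteq> X" "additive (T y)"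
  shows "koszul_diff T (insert y X) z A = koszul_diff T X z A + T y (signed y A (z (insert y A)))"
proof -
  have "insert y X - A = insert y (X - A)" using assms by auto
  with assms show ?thesis
    by (simp add: koszul_diff_def subset_insertI2 additive_signed_commute)
qed

lemma koszul_diff_insert_2:
  assumes "finite X" "y \<notin> X" "A \<subseteq> X" "\<And>v. additive (T v)"
  shows "signed y A (koszul_diff T (insert y X) z (insert y A)) = - koszul_diff T X (\<lambda>B. signed y
    B (z (insert y B))) A"
proof -
  have "insert y X - insert y A = X - A" "finite A" using assms by (auto intro: finite_subset)
  moreover have "signed y A (signed v (insert y A) (T v (z (insert v (insert y A))))) =
      - signed v A (T v (signed y (insert v A) (z (insert y (insert v A)))))" if "v \<in> X - A" for v
    using that assms \<open>finite A\<close> by (subst signed_swap) (auto simp: additive_signed_commute insert_commute)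
  ultimately show ?thesis
    using assms by (simp add: koszul_diff_def signed_sum sum_negf subset_insertI2)
qed

text \<open>
  \<open>M'\<close> is \<open>M / y M\<close>, realised as a complement of \<open>y M\<close> in \<open>M\<close> onto which \<open>\<pi>\<close> projects.
\<close>

locale regular_quotient =
  fixes T T' :: "'v::linorder \<Rightarrow> 'm::ab_group_add \<Rightarrow> 'm"
    and M M' :: "int \<Rightarrow> 'm set" and \<pi> :: "'m \<Rightarrow> 'm" and X :: "'v set" and y :: 'v
  assumes finite_X: "finite X" and y_notin: "y \<notin> X"
    and additive_T: "additive (T v)" and additive_T': "additive (T' v)" and additive_pi: "additive \<pi>"
    and commute: "T v (T w m) = T w (T v m)"
    and subgroup_add_M: "subgroup_add (M k)"
    and T_closed: "v \<in> insert y X \<Longrightarrow> m \<in> M k \<Longrightarrow> T v m \<in> M (k + 1)"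
    and M'_subset: "M' k \<subseteq> M k" and pi_closed: "m \<in> M k \<Longrightarrow> \<pi> m \<in> M' k"
    and pi_id: "m \<in> M' k \<Longrightarrow> \<pi> m = m"
    and pi_kernel: "m \<in> M k \<Longrightarrow> \<pi> m = 0 \<Longrightarrow> \<exists>n\<in>M (k - 1). m = T y n"
    and pi_T_y: "m \<in> M k \<Longrightarrow> \<pi> (T y m) = 0"
    and pi_T: "v \<in> X \<Longrightarrow> m \<in> M k \<Longrightarrow> \<pi> (T v m) = T' v (\<pi> m)"
    and regular: "m \<in> M k \<Longrightarrow> T y m = 0 \<Longrightarrow> m = 0"
    and no_2_torsion: "a + a = 0 \<Longrightarrow> a = (0::'m)"
begin

lemma pi_koszul_diff:
  assumes "\<And>B. z B \<in> M k"
  shows "\<pi> (koszul_diff T X z A) = koszul_diff T' X (\<lambda>A. \<pi> (z A)) A"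
  by (rule koszul_diff_hom[OF additive_pi]) (use assms pi_T in blast)

lemma pi_nonzero: "\<pi> m \<noteq> 0 \<Longrightarrow> m \<noteq> 0"
  using additive.zero[OF additive_pi] by auto

lemma zero_M': "0 \<in> M' k"
  using pi_closed[OF subgroup_add_zero[OF subgroup_add_M]] by (simp add: additive.zero[OF additive_pi])

lemma T_y_koszul_diff: "T y (koszul_diff T X z A) = koszul_diff T X (\<lambda>A. T y (z A)) A"
  by (rule koszul_diff_hom[OF additive_T]) (rule commute)

lemma koszul_diff_koszul_diff_0: "koszul_diff T X (koszul_diff T X z) A = 0"
  by (rule koszul_diff_koszul_diff_zero[OF finite_X additive_T commute no_2_torsion])

text \<open>A chase in the mapping cone of T y. Modulo y the component of z without y is a cycle,
  hence the boundary of some c. The error z - dc is divisible by y, with quotient e, and regularity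
  of y identifies the other component of z with -de. So the pair (c, e) bounds z.\<close>

lemma koszul_exact_lift:
  assumes ex: "koszul_exact T' X M' i k"
  shows "koszul_exact T (insert y X) M i k"
  unfolding koszul_exact_def
proof (intro allI impI; elim conjE)
  fix z :: "'v set \<Rightarrow> 'm" assume z: "koszul_chain (insert y X) (M k) i z" and cyc: "koszul_diff T
    (insert y X) z = (\<lambda>_. 0)"
  define b where "b = (\<lambda>B. signed y B (z (insert y B)))"
  have zM: "z A \<in> M k" for A using z by (simp add: koszul_chain_def)
  have bM: "b A \<in> M k" for A by (simp add: b_def zM subgroup_add_signed subgroup_add_M)
  have e1: "koszul_diff T X z A = - T y (b A)" if "A \<subseteq> X" for A
    using koszul_diff_insert_1[where T = T and z = z, OF finite_X y_notin that additive_T] cyc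
    unfolding b_def by (simp only: eq_neg_iff_add_eq_0 cyc)
  define pz where "pz = (\<lambda>A. if A \<subseteq> X then \<pi> (z A) else 0)"
  have "koszul_diff T' X pz A = 0" for A
  proof (cases "A \<subseteq> X")
    case True
    have "koszul_diff T' X pz A = koszul_diff T' X (\<lambda>A. \<pi> (z A)) A"
      by (rule koszul_diff_cong) (simp add: pz_def)
    also have "\<dots> = 0"
      using True by (simp add: pi_koszul_diff[symmetric, OF zM] e1 additive.minus[OF additive_pi]
        pi_T_y[OF bM])
    finally show ?thesis .
  qed (simp add: koszul_diff_def)
  moreover have "koszul_chain X (M' k) i pz"
    using z pi_closed[OF zM] zero_M' pi_nonzero unfolding koszul_chain_def pz_def by auto
  ultimately obtain c where c: "koszul_chain X (M' (k - 1)) (Suc i) c" and dc: "koszul_diff T' X c = pz"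
    using ex unfolding koszul_exact_def by (metis ext)
  have cM: "c A \<in> M (k - 1)" for A using c M'_subset by (auto simp: koszul_chain_def)
  have pc: "(\<lambda>A. \<pi> (c A)) = c" using c pi_id by (fastforce simp: koszul_chain_def)
  have kc: "koszul_chain X (M k) i (koszul_diff T X c)"
  proof (rule koszul_diff_chain[OF finite_X _ subgroup_add_M _ additive_T])
    show "koszul_chain X (M (k - 1)) (Suc i) c" using c cM by (simp add: koszul_chain_def)
    show "T v m \<in> M k" if "v \<in> X" "m \<in> M (k - 1)" for v m
      using T_closed[of v m "k - 1"] that by simp
  qed
  \<comment> \<open>Regularity makes the quotient by y vanish wherever the difference does, so the
    chosen values form a chain of exterior degree i.\<close>
  have "\<exists>n\<in>M (k - 1). z A - koszul_diff T X c A = T y n \<and> (card A \<noteq> i \<longrightarrow> n = 0)" if A: "A \<subseteq> X" for A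
  proof -
    have d: "z A - koszul_diff T X c A \<in> M k"
      using kc zM by (auto simp: koszul_chain_def intro: subgroup_add_diff[OF subgroup_add_M])
    have "\<pi> (z A - koszul_diff T X c A) = 0"
      using A by (simp add: additive.diff[OF additive_pi] pi_koszul_diff[OF cM] pc dc pz_def)
    then have "\<exists>n\<in>M (k - 1). z A - koszul_diff T X c A = T y n" using pi_kernel d by blast
    moreover have "z A - koszul_diff T X c A = 0" if "card A \<noteq> i"
    proof -
      have "z A = 0" using z that unfolding koszul_chain_def by blast
      moreover have "koszul_diff T X c A = 0" using kc that unfolding koszul_chain_def by blast
      ultimately show ?thesis by simp
    qed
    ultimately show ?thesis using regular by metis
  qed
  then obtain e' where e': "\<And>A. A \<subseteq> X \<Longrightarrow> e' A \<in> M (k - 1) \<and> z A - koszul_diff T X c A = T y (e' A)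
      \<and> (card A \<noteq> i \<longrightarrow> e' A = 0)"
    by metis
  define e where "e A = (if A \<subseteq> X then e' A else 0)" for A
  have e: "e A \<in> M (k - 1)" "e A \<noteq> 0 \<Longrightarrow> A \<subseteq> X \<and> card A = i" for A
    using e'[of A] by (auto simp: e_def subgroup_add_zero[OF subgroup_add_M] split: if_splits)
  have e_eq: "z A = koszul_diff T X c A + T y (e A)" if "A \<subseteq> X" for A
    using e'[OF that] that by (simp add: e_def algebra_simps)
  have keM: "koszul_diff T X e A \<in> M k" for A
    unfolding koszul_diff_def using T_closed[of _ _ "k - 1"] e(1)
    by (auto intro!: subgroup_add_zero subgroup_add_sum subgroup_add_signed subgroup_add_M)
  have be: "b A = - koszul_diff T X e A" if A: "A \<subseteq> X" for A
  proof -
    have "koszul_diff T X z A = koszul_diff T X (\<lambda>A. koszul_diff T X c A + T y (e A)) A"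
      by (rule koszul_diff_cong) (rule e_eq)
    also have "\<dots> = T y (koszul_diff T X e A)"
      by (simp add: koszul_diff_add[OF additive_T] koszul_diff_koszul_diff_0 T_y_koszul_diff)
    finally have "- T y (b A) = T y (koszul_diff T X e A)" using e1[OF A] by simp
    then have "T y (b A + koszul_diff T X e A) = 0"
      by (metis additive.add[OF additive_T] add.right_inverse)
    then have "b A + koszul_diff T X e A = 0" using regular bM keM subgroup_add_add subgroup_add_M
      by blast
    then show ?thesis by (simp add: eq_neg_iff_add_eq_0)
  qed
  \<comment> \<open>The chain with components c and e in the mapping cone; the sign cancels the one
    in the definition of the second component.\<close>
  define w where "w B = (if y \<in> B then signed y (B - {y}) (e (B - {y})) else c B)" for B
  have w1: "w A = c A" if "A \<subseteq> X" for A using that y_notin by (auto simp: w_def)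
  have w2: "signed y A (w (insert y A)) = e A" if "A \<subseteq> X" for A
  proof -
    have "insert y A - {y} = A" using that y_notin by auto
    then show ?thesis by (simp add: w_def)
  qed
  have "koszul_chain (insert y X) (M (k - 1)) (Suc i) w"
    unfolding koszul_chain_def
  proof (intro allI conjI impI)
    fix B
    show "w B \<in> M (k - 1)" by (simp add: w_def cM e subgroup_add_signed subgroup_add_M)
    assume nz: "w B \<noteq> 0"
    show "B \<subseteq> insert y X" "card B = Suc i"
    proof -
      have "B \<subseteq> insert y X \<and> card B = Suc i"
      proof (cases "y \<in> B")
        case True
        with nz have *: "B - {y} \<subseteq> X" "card (B - {y}) = i" using e(2)[of "B - {y}"] by (auto simp: w_def)
        then have "finite B" using finite_X finite_subset by fastforce
        then show ?thesis using * True card_Suc_Diff1[of B y] by auto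
      next
        case False
        then show ?thesis using nz c by (auto simp: w_def koszul_chain_def)
      qed
      then show "B \<subseteq> insert y X" "card B = Suc i" by auto
    qed
  qed
  moreover have "koszul_diff T (insert y X) w = z"
  proof
    fix B
    consider "\<not> B \<subseteq> insert y X" | "B \<subseteq> X" | A where "B = insert y A" "A \<subseteq> X"
      by (cases "y \<in> B") (auto dest: mk_disjoint_insert)
    then show "koszul_diff T (insert y X) w B = z B"
    proof cases
      case 1
      then show ?thesis using z by (auto simp: koszul_diff_def koszul_chain_def)
    next
      case 2
      have "koszul_diff T X w B = koszul_diff T X c B" by (rule koszul_diff_cong) (rule w1)
      then show ?thesis
        using 2 by (simp add: koszul_diff_insert_1[where T = T, OF finite_X y_notin 2 additive_T] w2 e_eq)
    next
      case 3
      have "signed y A (koszul_diff T (insert y X) w (insert y A)) = - koszul_diff T X (\<lambda>B. signed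
        y B (w (insert y B))) A"
        by (rule koszul_diff_insert_2[OF finite_X y_notin 3(2) additive_T])
      also have "koszul_diff T X (\<lambda>B. signed y B (w (insert y B))) A = koszul_diff T X e A"
        by (rule koszul_diff_cong) (rule w2)
      also have "- koszul_diff T X e A = signed y A (z (insert y A))" using be[OF 3(2)] by (simp
        add: b_def)
      finally show ?thesis unfolding 3(1) by (metis signed_signed)
    qed
  qed
  ultimately show "\<exists>w. koszul_chain (insert y X) (M (k - 1)) (Suc i) w \<and> koszul_diff T (insert y X) w = z"
    by blast
qed

text \<open>A cycle a of the quotient, read as a chain of M, has a boundary divisible by y, say da =
  T y b. Then (a, -b) is a cycle of the mapping cone, and the projection of the first component of a
  primitive is a primitive of a.\<close>

lemma koszul_exact_descend:
  assumes ex: "koszul_exact T (insert y X) M i k"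
  shows "koszul_exact T' X M' i k"
  unfolding koszul_exact_def
proof (intro allI impI; elim conjE)
  fix a :: "'v set \<Rightarrow> 'm" assume a: "koszul_chain X (M' k) i a" and cyc: "koszul_diff T' X a = (\<lambda>_. 0)"
  have aM: "a A \<in> M k" for A using a M'_subset by (auto simp: koszul_chain_def)
  have pa: "(\<lambda>A. \<pi> (a A)) = a" using a pi_id by (fastforce simp: koszul_chain_def)
  have kaM: "koszul_diff T X a A \<in> M (k + 1)" for A
    unfolding koszul_diff_def using T_closed aM by (auto intro!: subgroup_add_zero
      subgroup_add_sum subgroup_add_signed subgroup_add_M)
  have kac: "card A + 1 = i \<and> A \<subseteq> X" if "koszul_diff T X a A \<noteq> 0" for A
  proof (cases i)
    case 0
    then show ?thesis using that koszul_diff_chain_0[OF finite_X _ additive_T, of "M' k" a] a by auto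
  next
    case (Suc j)
    have "koszul_chain X (M (k + 1)) j (koszul_diff T X a)"
      using a aM Suc T_closed[of _ _ k]
      by (intro koszul_diff_chain[OF finite_X _ subgroup_add_M _ additive_T, of "M k"]) (auto
        simp: koszul_chain_def)
    then show ?thesis using that Suc by (simp add: koszul_chain_def)
  qed
  have "\<exists>n\<in>M k. koszul_diff T X a A = T y n \<and> (koszul_diff T X a A = 0 \<longrightarrow> n = 0)" for A
  proof -
    have "\<pi> (koszul_diff T X a A) = 0" by (simp add: pi_koszul_diff[OF aM] pa cyc)
    then show ?thesis using pi_kernel[OF kaM] regular by fastforce
  qed
  then obtain b where bM: "\<And>A. b A \<in> M k" and b: "\<And>A. koszul_diff T X a A = T y (b A)"
      and b0: "\<And>A. koszul_diff T X a A = 0 \<Longrightarrow> b A = 0"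
    by metis
  have kb: "koszul_diff T X b A = 0" for A
  proof -
    have "T y (koszul_diff T X b A) = koszul_diff T X (koszul_diff T X a) A" by (simp add:
      T_y_koszul_diff b[abs_def])
    also have "\<dots> = 0" by (rule koszul_diff_koszul_diff_0)
    finally have "T y (koszul_diff T X b A) = 0" .
    moreover have "koszul_diff T X b A \<in> M (k + 1)"
      unfolding koszul_diff_def using T_closed bM by (auto intro!: subgroup_add_zero
        subgroup_add_sum subgroup_add_signed subgroup_add_M)
    ultimately show ?thesis using regular by blast
  qed
  \<comment> \<open>The second component is -b, so that it cancels da = T y b.\<close>
  define z where "z B = (if y \<in> B then - signed y (B - {y}) (b (B - {y})) else a B)" for B
  have z1: "z A = a A" if "A \<subseteq> X" for A using that y_notin by (auto simp: z_def)
  have z2: "signed y A (z (insert y A)) = - b A" if "A \<subseteq> X" for A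
  proof -
    have "insert y A - {y} = A" using that y_notin by auto
    then show ?thesis by (simp add: z_def signed_minus)
  qed
  have "koszul_chain (insert y X) (M k) i z"
    unfolding koszul_chain_def
  proof (intro allI conjI impI)
    fix B
    show "z B \<in> M k" by (simp add: z_def aM bM subgroup_add_signed subgroup_add_minus subgroup_add_M)
    assume nz: "z B \<noteq> 0"
    have "B \<subseteq> insert y X \<and> card B = i"
    proof (cases "y \<in> B")
      case True
      with nz have "b (B - {y}) \<noteq> 0" by (auto simp: z_def)
      then have *: "card (B - {y}) + 1 = i" "B - {y} \<subseteq> X" using kac b0 by blast+
      then have "finite B" using finite_X finite_subset by fastforce
      then show ?thesis using * True card_Suc_Diff1[of B y] by auto
    next
      case False
      then show ?thesis using nz a by (auto simp: z_def koszul_chain_def)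
    qed
    then show "B \<subseteq> insert y X" "card B = i" by auto
  qed
  moreover have "koszul_diff T (insert y X) z = (\<lambda>_. 0)"
  proof
    fix B
    consider "\<not> B \<subseteq> insert y X" | "B \<subseteq> X" | A where "B = insert y A" "A \<subseteq> X"
      by (cases "y \<in> B") (auto dest: mk_disjoint_insert)
    then show "koszul_diff T (insert y X) z B = 0"
    proof cases
      case 1
      then show ?thesis by (auto simp: koszul_diff_def)
    next
      case 2
      have "koszul_diff T X z B = koszul_diff T X a B" by (rule koszul_diff_cong) (rule z1)
      then show ?thesis
        using 2 by (simp add: koszul_diff_insert_1[where T = T, OF finite_X y_notin 2 additive_T] z2 b
            additive.minus[OF additive_T])
    next
      case 3
      have "signed y A (koszul_diff T (insert y X) z (insert y A)) = - koszul_diff T X (\<lambda>B. signed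
        y B (z (insert y B))) A"
        by (rule koszul_diff_insert_2[OF finite_X y_notin 3(2) additive_T])
      also have "koszul_diff T X (\<lambda>B. signed y B (z (insert y B))) A = koszul_diff T X (\<lambda>B. - b B) A"
        by (rule koszul_diff_cong) (rule z2)
      finally show ?thesis unfolding 3(1) by (simp add: koszul_diff_minus[OF additive_T] kb)
    qed
  qed
  ultimately obtain w where w: "koszul_chain (insert y X) (M (k - 1)) (Suc i) w"
      and dw: "koszul_diff T (insert y X) w = z"
    using ex by (auto simp: koszul_exact_def)
  have wM: "w A \<in> M (k - 1)" for A using w by (auto simp: koszul_chain_def)
  define c where "c A = (if A \<subseteq> X then \<pi> (w A) else 0)" for A
  have "koszul_diff T' X c A = a A" for A
  proof (cases "A \<subseteq> X")
    case True
    have "a A = \<pi> (koszul_diff T X w A + T y (signed y A (w (insert y A))))"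
      using pa fun_cong[OF dw, of A] koszul_diff_insert_1[where T = T and z = w, OF finite_X
        y_notin True additive_T]
      by (simp add: z1[OF True] fun_eq_iff)
    also have "\<dots> = \<pi> (koszul_diff T X w A)"
      using pi_T_y[OF subgroup_add_signed[OF subgroup_add_M wM]] by (simp add: additive.add[OF
        additive_pi])
    also have "\<dots> = koszul_diff T' X (\<lambda>A. \<pi> (w A)) A" by (rule pi_koszul_diff[OF wM])
    also have "\<dots> = koszul_diff T' X c A" by (rule koszul_diff_cong) (simp add: c_def)
    finally show ?thesis by simp
  next
    case False
    then show ?thesis using a by (auto simp: koszul_diff_def koszul_chain_def)
  qed
  moreover have "koszul_chain X (M' (k - 1)) (Suc i) c"
    using w pi_closed[OF wM] zero_M' pi_nonzero unfolding koszul_chain_def c_def by auto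
  ultimately show "\<exists>w. koszul_chain X (M' (k - 1)) (Suc i) w \<and> koszul_diff T' X w = a"
    by blast
qed

end

section \<open>Monomial modules\<close>

definition restrict_keys :: "'a set \<Rightarrow> ('a \<Rightarrow>\<^sub>0 'k::comm_monoid_add) \<Rightarrow> ('a \<Rightarrow>\<^sub>0 'k)" where
  "restrict_keys Q p = (\<Sum>m\<in>keys p \<inter> Q. single m (lookup p m))"

lemma lookup_restrict_keys: "lookup (restrict_keys Q p) m = (if m \<in> Q then lookup p m else 0)"
  by (auto simp: restrict_keys_def lookup_sum lookup_single when_def in_keys_iff)

lemma keys_restrict_keys: "keys (restrict_keys Q p) = keys p \<inter> Q"
  by (auto simp: in_keys_iff lookup_restrict_keys split: if_splits)

lemma restrict_keys_UNIV [simp]: "restrict_keys UNIV p = p"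
  by (rule poly_mapping_eqI) (simp add: lookup_restrict_keys)

lemma additive_restrict_keys: "additive (restrict_keys Q :: ('a \<Rightarrow>\<^sub>0 'k::ab_group_add) \<Rightarrow> _)"
  by unfold_locales (rule poly_mapping_eqI, simp add: lookup_restrict_keys lookup_add)

lemma poly_mapping_sum_singles:
  "p = (\<Sum>m\<in>keys p. single m (lookup p m))"
  using restrict_keys_UNIV[of p] by (simp add: restrict_keys_def)

lemma lookup_single_times:
  fixes p :: "'a::cancel_comm_monoid_add \<Rightarrow>\<^sub>0 'k::comm_semiring_1"
  shows "lookup (single a c * p) m =
    (if \<exists>b. m = a + b then c * lookup p (m - a) else 0)"
proof -
  have "single a c * p =
      (\<Sum>b\<in>keys p. single (a + b) (c * lookup p b))"
    by (subst poly_mapping_sum_singles[of p]) (simp add: sum_distrib_left mult_single)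
  then have *: "lookup (single a c * p) m =
      (\<Sum>b\<in>keys p. if a + b = m then c * lookup p b else 0)"
    by (simp add: lookup_sum lookup_single when_def)
  show ?thesis
  proof (cases "\<exists>b. m = a + b")
    case True
    then obtain b where b: "m = a + b" by blast
    have "lookup (single a c * p) m =
       (\<Sum>b'\<in>keys p. if b' = b then c * lookup p b else 0)"
      unfolding * by (rule sum.cong) (auto simp: b)
    also have "\<dots> = c * lookup p b" by (auto simp: in_keys_iff)
    finally show ?thesis using b by simp
  next
    case False
    then show ?thesis by (auto simp: * intro!: sum.neutral)
  qed
qed

lemma poly_mapping_no_2_torsion:
  fixes p :: "'a \<Rightarrow>\<^sub>0 'k::field_char_0"
  assumes "p + p = 0" shows "p = 0"
proof (rule poly_mapping_eqI)
  fix m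
  have "lookup (p + p) m = 0" using assms by simp
  then show "lookup p m = lookup 0 m"
    by (simp add: lookup_add flip: mult_2)
qed

definition multiples :: "'a::plus \<Rightarrow> 'a set" where
  "multiples a = {m. \<exists>b. m = a + b}"

lemma add_multiples: "m \<in> multiples a \<Longrightarrow> b + m \<in> multiples (a::'a::ab_semigroup_add)"
  by (auto simp: multiples_def) (metis add.left_commute)

text \<open>
  The quotient of a monomial module by the monomials \<open>\<mu> y\<close> with \<open>y \<in> L\<close> is realised on the span of
  the monomials divisible by none of them, multiplication being followed by truncation.
\<close>

locale monomial_module =
  fixes \<mu> :: "'v::linorder \<Rightarrow> 'a::cancel_comm_monoid_add" and D :: "int \<Rightarrow> 'a set" and X L :: "'v set"
    and dummy :: "'k::field_char_0 itself"
  assumes shift: "v \<in> X \<Longrightarrow> \<mu> v + m \<in> D (k + 1) \<longleftrightarrow> m \<in> D k"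
    and finite_X: "finite X" and L_subset: "L \<subseteq> X"
    and coprime: "y \<in> L \<Longrightarrow> y' \<in> L \<Longrightarrow> y \<noteq> y' \<Longrightarrow> \<mu> y + m \<in> multiples (\<mu> y') \<Longrightarrow> m \<in> multiples (\<mu> y')"
begin

definition reduced :: "'v set \<Rightarrow> 'a set" where
  "reduced Y = {m. \<forall>y\<in>Y. m \<notin> multiples (\<mu> y)}"

definition truncated :: "'v set \<Rightarrow> int \<Rightarrow> ('a \<Rightarrow>\<^sub>0 'k) set" where
  "truncated Y k = {p. keys p \<subseteq> D k \<inter> reduced Y}"

definition mult_op :: "'v set \<Rightarrow> 'v \<Rightarrow> ('a \<Rightarrow>\<^sub>0 'k) \<Rightarrow> ('a \<Rightarrow>\<^sub>0 'k)" where
  "mult_op Y v p = restrict_keys (reduced Y) (single (\<mu> v) 1 * p)"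

lemma reduced_empty [simp]: "reduced {} = UNIV"
  by (simp add: reduced_def)

lemma reduced_factor: "a + m \<in> reduced Y \<Longrightarrow> m \<in> reduced Y"
  using add_multiples by (auto simp: reduced_def)

text \<open>The discarded monomials are closed under multiplication by monomials, so truncating
  before a product changes nothing after it.\<close>

lemma restrict_keys_times_restrict_keys:
  "restrict_keys (reduced Y) (single a 1 * restrict_keys (reduced Y) p) =
    restrict_keys (reduced Y) (single a 1 * p)" for p :: "'a \<Rightarrow>\<^sub>0 'k"
  by (rule poly_mapping_eqI) (auto simp: lookup_restrict_keys lookup_single_times dest: reduced_factor)

lemma mult_op_mult_op: "mult_op Y v (mult_op Y w p) = restrict_keys (reduced Y) (single (\<mu> v + \<mu>
  w) 1 * p)"
  by (simp add: mult_op_def restrict_keys_times_restrict_keys mult_single flip: mult.assoc)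

lemma additive_mult_op: "additive (mult_op Y v)"
  by unfold_locales (simp add: mult_op_def distrib_left additive.add[OF additive_restrict_keys])

lemma truncated_iff: "p \<in> truncated Y k \<longleftrightarrow> (\<forall>m. lookup p m \<noteq> 0 \<longrightarrow> m \<in> D k \<and> m \<in> reduced Y)"
  by (auto simp: truncated_def in_keys_iff)

lemma subgroup_add_truncated: "subgroup_add (truncated Y k)"
proof -
  have "a + b \<in> truncated Y k" if "a \<in> truncated Y k" "b \<in> truncated Y k" for a b
    using keys_add[of a b] that unfolding truncated_def by blast
  moreover have "- a \<in> truncated Y k" if "a \<in> truncated Y k" for a
    using that by (simp add: truncated_iff)
  moreover have "0 \<in> truncated Y k" by (simp add: truncated_def)
  ultimately show ?thesis unfolding subgroup_add_def by blast
qed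

lemma mult_op_closed:
  assumes "v \<in> X" "p \<in> truncated Y k" shows "mult_op Y v p \<in> truncated Y (k + 1)"
proof -
  have "m \<in> D (k + 1) \<and> m \<in> reduced Y" if "lookup (mult_op Y v p) m \<noteq> 0" for m
    using that assms shift
    by (auto simp: mult_op_def lookup_restrict_keys lookup_single_times truncated_iff split: if_splits)
  then show ?thesis by (auto simp: truncated_iff)
qed

lemma reduced_insert: "reduced (insert y Y) = reduced Y \<inter> {m. m \<notin> multiples (\<mu> y)}"
  by (auto simp: reduced_def)

text \<open>The place where coprimality enters: multiplying by \<mu> y creates no divisibility by
  the other \<mu> y', so y stays regular after dividing by the elements of Y.\<close>

lemma reduced_add:
  assumes "insert y Y \<subseteq> L" "y \<notin> Y" shows "\<mu> y + m \<in> reduced Y \<longleftrightarrow> m \<in> reduced Y"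
  using assms coprime[of y _ m] by (auto simp: reduced_def dest: add_multiples[of m _ "\<mu> y"])

lemma regular_quotient_step:
  assumes "insert y Y \<subseteq> L" "y \<notin> Y" "y \<notin> X'" "insert y X' \<subseteq> X"
  shows "regular_quotient (mult_op Y) (mult_op (insert y Y)) (truncated Y) (truncated (insert y Y))
    (restrict_keys (reduced (insert y Y))) X' y"
proof (rule regular_quotient.intro)
  note simps = truncated_iff mult_op_def lookup_restrict_keys lookup_single_times reduced_insert
  show "finite X'" using assms finite_X finite_subset by auto
  show "y \<notin> X'" by fact
  show "additive (restrict_keys (reduced (insert y Y)) :: ('a \<Rightarrow>\<^sub>0 'k) \<Rightarrow> _)" by (rule
    additive_restrict_keys)
  fix v w :: 'v and m :: "'a \<Rightarrow>\<^sub>0 'k" and k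
  show "mult_op Y v (mult_op Y w m) = mult_op Y w (mult_op Y v m)" by (simp add: mult_op_mult_op
    add.commute)
  show "mult_op Y v m \<in> truncated Y (k + 1)" if "v \<in> insert y X'" "m \<in> truncated Y k"
    using that assms mult_op_closed by auto
  show "truncated (insert y Y) k \<subseteq> truncated Y k" by (auto simp: truncated_def reduced_insert)
  show "restrict_keys (reduced (insert y Y)) m \<in> truncated (insert y Y) k" if "m \<in> truncated Y k"
    using that by (auto simp: simps split: if_splits)
  show "restrict_keys (reduced (insert y Y)) m = m" if "m \<in> truncated (insert y Y) k"
    by (rule poly_mapping_eqI) (use that in \<open>auto simp: simps\<close>)
  show "restrict_keys (reduced (insert y Y)) (mult_op Y y m) = 0" if "m \<in> truncated Y k"
    by (rule poly_mapping_eqI) (auto simp: simps multiples_def)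
  show "restrict_keys (reduced (insert y Y)) (mult_op Y v m) = mult_op (insert y Y) v
    (restrict_keys (reduced (insert y Y)) m)"
    if "v \<in> X'" "m \<in> truncated Y k"
  proof -
    have "restrict_keys (reduced (insert y Y)) (mult_op Y v m) =
        restrict_keys (reduced (insert y Y)) (single (\<mu> v) 1 * m)"
      by (rule poly_mapping_eqI) (auto simp: mult_op_def lookup_restrict_keys reduced_insert)
    then show ?thesis by (simp add: mult_op_def restrict_keys_times_restrict_keys)
  qed
  show "m = 0" if "m \<in> truncated Y k" "mult_op Y y m = 0"
  proof (rule poly_mapping_eqI)
    fix a
    have "lookup (mult_op Y y m) (\<mu> y + a) = 0" using that by simp
    then show "lookup m a = lookup 0 a"
      using that(1) reduced_add[OF assms(1,2)] by (auto simp: simps split: if_splits)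
  qed
  show "\<exists>n\<in>truncated Y (k - 1). m = mult_op Y y n"
    if m: "m \<in> truncated Y k" and 0: "restrict_keys (reduced (insert y Y)) m = 0"
  proof -
    \<comment> \<open>Every monomial of m is a multiple of \<mu> y, since otherwise it would survive
      the projection; n divides them one by one.\<close>
    define n where "n = (\<Sum>a\<in>keys m.
      single (a - \<mu> y) (lookup m a))"
    have mult: "a \<in> reduced Y \<and> (\<exists>b. a = \<mu> y + b)" if "a \<in> keys m" for a
    proof -
      have "lookup (restrict_keys (reduced (insert y Y)) m) a = 0" using 0 by simp
      then show ?thesis using that m by (auto simp: simps in_keys_iff multiples_def split: if_splits)
    qed
    have "mult_op Y y n = (\<Sum>a\<in>keys m. mult_op Y y (single (a - \<mu> y) (lookup m a)))"
      by (simp add: n_def additive.sum[OF additive_mult_op])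
    also have "\<dots> = (\<Sum>a\<in>keys m. single a (lookup m a))"
    proof (rule sum.cong[OF refl])
      fix a assume "a \<in> keys m"
      with mult obtain b where "a \<in> reduced Y" "a = \<mu> y + b" by blast
      then show "mult_op Y y (single (a - \<mu> y) (lookup m a)) =
          single a (lookup m a)"
        by (intro poly_mapping_eqI) (auto simp: mult_op_def mult_single lookup_restrict_keys
          lookup_single when_def)
    qed
    also have "\<dots> = m" by (rule poly_mapping_sum_singles[symmetric])
    finally have eq: "m = mult_op Y y n" by simp
    have "n \<in> truncated Y (k - 1)" unfolding n_def
    proof (intro subgroup_add_sum subgroup_add_truncated)
      fix a assume a: "a \<in> keys m"
      with mult obtain b where b: "a \<in> reduced Y" "a = \<mu> y + b" by blast
      have "a \<in> D k" using a m by (auto simp: truncated_def)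
      then have "b \<in> D (k - 1)" using shift[of y b "k - 1"] b assms by auto
      then show "single (a - \<mu> y) (lookup m a) \<in> truncated Y (k - 1)"
        using b reduced_add[OF assms(1,2)] by (auto simp: truncated_def)
    qed
    with eq show ?thesis by blast
  qed
qed (auto intro: additive_mult_op subgroup_add_truncated poly_mapping_no_2_torsion)

text \<open>Each element of Y is regular modulo the earlier ones, so they can be divided out one at
  a time. Right to left carries Green's result for the dualising module down to its quotient; left
  to right carries exactness of a quotient up to R or to S.\<close>

lemma koszul_exact_reduce:
  assumes "Y \<subseteq> L"
  shows "koszul_exact (mult_op Y) (X - Y) (truncated Y) i k \<longleftrightarrow> koszul_exact (mult_op {}) X
    (truncated {}) i k"
proof -
  have "finite Y" using assms L_subset finite_X by (meson finite_subset)
  then show ?thesis using assms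
  proof (induction Y rule: finite_induct)
    case (insert y Y)
    interpret regular_quotient "mult_op Y" "mult_op (insert y Y)" "truncated Y" "truncated (insert y Y)"
      "restrict_keys (reduced (insert y Y))" "X - insert y Y" y
      using insert L_subset by (intro regular_quotient_step) auto
    have "insert y (X - insert y Y) = X - Y" using insert L_subset by auto
    then have "koszul_exact (mult_op (insert y Y)) (X - insert y Y) (truncated (insert y Y)) i k \<longleftrightarrow>
        koszul_exact (mult_op Y) (X - Y) (truncated Y) i k"
      using koszul_exact_lift[of i k] koszul_exact_descend[of i k] by auto
    then show ?case using insert by simp
  qed simp
qed

end

section \<open>Green vanishing\<close>

interpretation poly_space: vector_space "smult :: 'k::field \<Rightarrow> 'k poly \<Rightarrow> 'k poly"
  by unfold_locales (simp_all add: smult_add_right smult_add_left)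

text \<open>The map subtracting the right multiple of f projects onto the polynomials vanishing at x
  and kills f. Hence the hyperplane of such polynomials in the span needs one generator fewer, which
  pays for the drop of q in Green's induction.\<close>

lemma span_vanishing_at:
  fixes S :: "'k::field poly set"
  assumes "f \<in> S" "poly f x \<noteq> 0" "u \<in> poly_space.span S" "poly u x = 0"
  shows "u \<in> poly_space.span ((\<lambda>u. u - smult (poly u x / poly f x) f) ` (S - {f}))"
proof -
  define g where "g u = u - smult (poly u x / poly f x) f" for u
  have "module_hom smult smult g"
    by unfold_locales (simp_all add: g_def smult_add_left smult_diff_right add_divide_distrib
        smult_add_right mult.commute)
  moreover have "u = g u" using assms(4) by (simp add: g_def)
  ultimately have "u \<in> poly_space.span (g ` S)"
    using assms(3) module_hom.span_image by (metis imageI)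
  moreover have "g ` S \<subseteq> insert 0 (g ` (S - {f}))" using assms(1,2) by (auto simp: g_def)
  ultimately show ?thesis
    using poly_space.span_mono poly_space.span_insert_0 unfolding g_def by blast
qed

text \<open>
  Green's vanishing argument: contraction with the point \<open>x\<close> of the curve \<open>t \<mapsto> (t ^ \<kappa> v)\<^sub>v\<close> sends a
  cycle to a cycle with coefficients in the hyperplane of the sections that vanish at \<open>x\<close>.
\<close>

lemma green_vanishing:
  fixes \<alpha> :: "'v::linorder set \<Rightarrow> 'k::field_char_0 poly"
  assumes "finite X" "inj_on \<kappa> X" "finite S" "card S \<le> q"
    "koszul_chain X (poly_space.span S) q \<alpha>"
    "koszul_diff (\<lambda>v p. monom 1 (\<kappa> v) * p) X \<alpha> = (\<lambda>_. 0)"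
  shows "\<alpha> = (\<lambda>_. 0)"
  using assms(3-)
proof (induction q arbitrary: S \<alpha>)
  case 0
  then show ?case by (auto simp: koszul_chain_def)
next
  case (Suc q)
  show ?case
  proof (cases "S \<subseteq> {0}")
    case True
    then have "poly_space.span S \<subseteq> {0}"
      using poly_space.span_mono[OF True] by (simp add: poly_space.span_insert_0[of "{}", simplified])
    then show ?thesis using Suc.prems(3) by (auto simp: koszul_chain_def)
  next
    case False
    then obtain f where f: "f \<in> S" "f \<noteq> 0" by auto
    let ?T = "\<lambda>x v. smult (x ^ \<kappa> v) :: 'k poly \<Rightarrow> 'k poly"
    let ?M = "\<lambda>v p. monom 1 (\<kappa> v) * p :: 'k poly"
    have addT: "additive (?T x v)" and addM: "additive (?M v)" for x v
      by (unfold_locales, simp_all add: smult_add_right distrib_left)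
    have \<alpha>S: "\<alpha> A \<in> poly_space.span S" for A using Suc.prems(3) by (auto simp: koszul_chain_def)
    have subS: "subgroup_add (poly_space.span S)"
      by (auto simp: subgroup_add_def poly_space.span_zero poly_space.span_add poly_space.span_neg)
    have contraction: "koszul_diff (?T x) X \<alpha> = (\<lambda>_. 0)" if x: "poly f x \<noteq> 0" for x
    proof -
      define S' where "S' = (\<lambda>u. u - smult (poly u x / poly f x) f) ` (S - {f})"
      have chain: "koszul_chain X (poly_space.span S) q (koszul_diff (?T x) X \<alpha>)"
        by (rule koszul_diff_chain[OF assms(1) Suc.prems(3) subS _ addT]) (rule poly_space.span_scale)
      \<comment> \<open>At x the monomial of degree \<kappa> v takes the value x ^ \<kappa> v. So
        the contraction evaluated at x is the original cycle condition evaluated at x.\<close>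
      have "poly (koszul_diff (?T x) X \<alpha> A) x = 0" for A
      proof -
        have e: "additive (\<lambda>p :: 'k poly. poly p x)" by unfold_locales simp
        have "poly (koszul_diff (?T x) X \<alpha> A) x = koszul_diff (\<lambda>v c. x ^ \<kappa> v * c) X (\<lambda>A. poly (\<alpha> A) x) A"
          by (rule koszul_diff_hom[OF e]) simp
        also have "\<dots> = poly (koszul_diff ?M X \<alpha> A) x"
          by (rule koszul_diff_hom[OF e, symmetric]) (simp add: poly_monom)
        finally show ?thesis using Suc.prems(4) by simp
      qed
      then have "koszul_chain X (poly_space.span S') q (koszul_diff (?T x) X \<alpha>)"
        using chain span_vanishing_at[OF f(1) x] unfolding koszul_chain_def S'_def by blast
      moreover have "card S' \<le> card (S - {f})"
        unfolding S'_def using Suc.prems(1) by (intro card_image_le) simp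
      then have "finite S'" "card S' \<le> q"
        using Suc.prems(1,2) f(1) by (auto simp: S'_def)
      moreover have "koszul_diff ?M X (koszul_diff (?T x) X \<alpha>) = (\<lambda>_. 0)"
      proof
        fix A
        have "koszul_diff ?M X (koszul_diff (?T x) X \<alpha>) A = - koszul_diff (?T x) X (koszul_diff ?M X \<alpha>) A"
          by (rule koszul_diff_koszul_diff[OF assms(1) addM addT]) simp
        also have "\<dots> = 0" unfolding Suc.prems(4) by (simp add: koszul_diff_zero[OF addT])
        finally show "koszul_diff ?M X (koszul_diff (?T x) X \<alpha>) A = 0" .
      qed
      ultimately show ?thesis using Suc.IH[of S'] by blast
    qed
    have zero: "\<alpha> (insert v A) = 0" if A: "A \<subseteq> X" and v: "v \<in> X - A" for v A
    proof (rule poly_eqI)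
      fix l
      \<comment> \<open>For a fixed coefficient index l, the contractions at all points of the curve
        assemble into one polynomial h in the parameter. It vanishes wherever f does not, so f h
        vanishes everywhere and h = 0. Injectivity of \<kappa> keeps the terms of h apart.\<close>
      define h where "h = (\<Sum>v\<in>X - A. monom (signed v A (coeff (\<alpha> (insert v A)) l)) (\<kappa> v))"
      have "poly (f * h) x = 0" for x
      proof (cases "poly f x = 0")
        case False
        have "coeff (koszul_diff (?T x) X \<alpha> A) l = 0" using contraction[OF False] by simp
        moreover have "coeff (signed v A p) l = signed v A (coeff p l)" for v and p :: "'k poly"
          by (simp add: signed_def)
        ultimately have "(\<Sum>v\<in>X - A. signed v A (x ^ \<kappa> v * coeff (\<alpha> (insert v A)) l)) = 0"
          using A by (simp add: koszul_diff_def coeff_sum)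
        moreover have "poly h x = (\<Sum>v\<in>X - A. signed v A (x ^ \<kappa> v * coeff (\<alpha> (insert v A)) l))"
          unfolding h_def poly_sum by (rule sum.cong) (auto simp: poly_monom signed_def)
        ultimately show ?thesis by simp
      qed simp
      then have "f * h = 0" using poly_all_0_iff_0 by blast
      then have "h = 0" using f(2) by simp
      then have "coeff h (\<kappa> v) = 0" by simp
      moreover have "coeff h (\<kappa> v) = (\<Sum>w\<in>X - A. if w = v then signed v A (coeff (\<alpha> (insert v A))
        l) else 0)"
        unfolding h_def coeff_sum
        by (rule sum.cong) (use assms(2) v in \<open>auto simp: inj_on_def\<close>)
      ultimately show "coeff (\<alpha> (insert v A)) l = coeff 0 l"
        using v assms(1) by simp
    qed
    show ?thesis
    proof (rule ext, rule ccontr)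
      fix B assume "\<alpha> B \<noteq> 0"
      then have B: "B \<subseteq> X" "card B = Suc q" using Suc.prems(3) by (auto simp: koszul_chain_def)
      then obtain v A where "B = insert v A" "v \<notin> A" by (metis card_Suc_eq)
      then show False using zero[of A v] B \<open>\<alpha> B \<noteq> 0\<close> by auto
    qed
  qed
qed

text \<open>A vector outside the column space is separated from it by a linear functional, whose
  values on the unit vectors form a nonzero vector in the kernel of the transpose.\<close>

lemma matrix_surjective_if_transpose_injective:
  fixes D :: "'i \<Rightarrow> 'j \<Rightarrow> 'k::field"
  assumes "finite I" "finite J"
    and inj: "\<And>\<phi>. (\<And>j. j \<in> J \<Longrightarrow> (\<Sum>i\<in>I. \<phi> i * D i j) = 0) \<Longrightarrow> \<forall>i\<in>I. \<phi> i = 0"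
  shows "\<exists>w. \<forall>i\<in>I. (\<Sum>j\<in>J. D i j * w j) = z i"
proof -
  interpret fv: vector_space "\<lambda>(c::'k) (f :: 'i \<Rightarrow> 'k) i. c * f i"
    by unfold_locales (auto simp: fun_eq_iff algebra_simps)
  interpret kv: vector_space "(*) :: 'k \<Rightarrow> 'k \<Rightarrow> 'k"
    by unfold_locales (auto simp: algebra_simps)
  interpret p: vector_space_pair "\<lambda>(c::'k) (f :: 'i \<Rightarrow> 'k) i. c * f i" "(*) :: 'k \<Rightarrow> 'k \<Rightarrow> 'k" ..
  \<comment> \<open>Columns and target are set to 0 off I, so that a functional is determined on
    them by its values at the finitely many unit vectors indexed by I.\<close>
  define C where "C j = (\<lambda>i. if i \<in> I then D i j else 0)" for j
  define Z where "Z = (\<lambda>i. if i \<in> I then z i else 0)"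
  have "Z \<in> fv.span (C ` J)"
  proof (rule ccontr)
    assume Z: "Z \<notin> fv.span (C ` J)"
    obtain B where B: "B \<subseteq> C ` J" "fv.independent B" "C ` J \<subseteq> fv.span B"
      by (rule fv.maximal_independent_subset)
    have "Z \<notin> fv.span B" using Z fv.span_mono[OF B(1)] by blast
    then have "fv.independent (insert Z B)" "Z \<notin> B"
      using B(2) fv.independent_insertI fv.span_base by blast+
    then obtain g where g: "Vector_Spaces.linear (\<lambda>(c::'k) (f :: 'i \<Rightarrow> 'k) i. c * f i) ((*) :: 'k \<Rightarrow>
      'k \<Rightarrow> 'k) g" "\<forall>x\<in>insert Z B. g x = (if x = Z then 1 else 0)"
      using p.linear_independent_extend[of "insert Z B" "\<lambda>x. if x = Z then 1 else 0"] by blast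
    interpret g: Vector_Spaces.linear "\<lambda>(c::'k) (f :: 'i \<Rightarrow> 'k) i. c * f i" "(*) :: 'k \<Rightarrow> 'k \<Rightarrow> 'k" g
      by (rule g(1))
    define \<phi> where "\<phi> i = g (\<lambda>i'. if i' = i then 1 else 0)" for i
    have g_eq: "g f = (\<Sum>i\<in>I. \<phi> i * f i)" if "\<And>i. i \<notin> I \<Longrightarrow> f i = 0" for f
    proof -
      have "f = (\<Sum>i\<in>I. (\<lambda>i'. f i * (if i' = i then 1 else 0)))"
      proof
        fix x
        have "(\<Sum>i\<in>I. (\<lambda>i'. f i * (if i' = i then 1 else 0))) x = (\<Sum>i\<in>I. f i * (if x = i then 1 else 0))"
          by (induction I rule: infinite_finite_induct) auto
        also have "\<dots> = f x" using assms(1) that[of x] by (simp add: if_distrib cong: if_cong)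
        finally show "f x = (\<Sum>i\<in>I. (\<lambda>i'. f i * (if i' = i then 1 else 0))) x" by simp
      qed
      then have "g f = (\<Sum>i\<in>I. g (\<lambda>i'. f i * (if i' = i then 1 else 0)))"
        using g.sum by metis
      also have "\<dots> = (\<Sum>i\<in>I. \<phi> i * f i)"
        by (intro sum.cong refl) (simp add: g.scale \<phi>_def mult.commute)
      finally show ?thesis .
    qed
    have "\<forall>i\<in>I. \<phi> i = 0"
    proof (rule inj)
      fix j assume "j \<in> J"
      then have "C j \<in> fv.span B" using B(3) by auto
      moreover have "g x = 0" if "x \<in> B" for x using g(2) \<open>Z \<notin> B\<close> that by auto
      ultimately have "g (C j) = 0" using g.eq_0_on_span by blast
      then show "(\<Sum>i\<in>I. \<phi> i * D i j) = 0" by (simp add: g_eq C_def)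
    qed
    then have "g Z = 0" by (simp add: g_eq Z_def)
    then show False using g(2) by simp
  qed
  moreover have "fv.span (C ` J) \<subseteq> {\<lambda>i. \<Sum>j\<in>J. C j i * w j | w. True}"
  proof (rule fv.span_minimal)
    show "C ` J \<subseteq> {\<lambda>i. \<Sum>j\<in>J. C j i * w j | w. True}"
    proof (rule image_subsetI, intro CollectI exI conjI TrueI)
      fix j assume "j \<in> J"
      then show "C j = (\<lambda>i. \<Sum>j'\<in>J. C j' i * (if j' = j then 1 else 0))"
        using assms(2) by (simp add: if_distrib cong: if_cong)
    qed
    show "fv.subspace {\<lambda>i. \<Sum>j\<in>J. C j i * w j | w. True}"
    proof (rule fv.subspaceI, goal_cases)
      case 1
      show ?case by (intro CollectI exI[of _ "\<lambda>_. 0"]) (simp add: fun_eq_iff)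
    next
      case (2 x y)
      then obtain w v where "x = (\<lambda>i. \<Sum>j\<in>J. C j i * w j)" "y = (\<lambda>i. \<Sum>j\<in>J. C j i * v j)" by blast
      then have "x + y = (\<lambda>i. \<Sum>j\<in>J. C j i * (w j + v j))"
        by (intro ext) (simp add: distrib_left sum.distrib)
      then show ?case by (intro CollectI exI[of _ "\<lambda>j. w j + v j"] conjI TrueI)
    next
      case (3 c x)
      then obtain w where "x = (\<lambda>i. \<Sum>j\<in>J. C j i * w j)" by blast
      then have "(\<lambda>i. c * x i) = (\<lambda>i. \<Sum>j\<in>J. C j i * (c * w j))"
        by (simp only: sum_distrib_left mult.left_commute[of c])
      then show ?case by (intro CollectI exI[of _ "\<lambda>j. c * w j"] conjI TrueI)
    qed
  qed
  ultimately obtain w where w: "Z = (\<lambda>i. \<Sum>j\<in>J. C j i * w j)" by blast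
  have "(\<Sum>j\<in>J. D i j * w j) = z i" if "i \<in> I" for i
    using fun_cong[OF w, of i] that by (simp add: Z_def C_def)
  then show ?thesis by blast
qed


section \<open>Monomials and evaluation\<close>

lemma keys_add_nat: "keys (m + n) = keys m \<union> keys (n :: 'v \<Rightarrow>\<^sub>0 nat)"
  by (auto simp: in_keys_iff lookup_add)

lemma total_degree_superset:
  "finite W \<Longrightarrow> keys m \<subseteq> W \<Longrightarrow> total_degree m = (\<Sum>v\<in>W. lookup m v)"
  unfolding total_degree_def by (rule sum.mono_neutral_left) (auto simp: in_keys_iff)

lemma total_degree_add: "total_degree (m + n) = total_degree m + total_degree n"
proof -
  let ?W = "keys m \<union> keys n"
  have "total_degree (m + n) = (\<Sum>v\<in>?W. lookup (m + n) v)"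
    by (rule total_degree_superset) (auto simp: keys_add_nat)
  moreover have "total_degree m = (\<Sum>v\<in>?W. lookup m v)"
    by (rule total_degree_superset) auto
  moreover have "total_degree n = (\<Sum>v\<in>?W. lookup n v)"
    by (rule total_degree_superset) auto
  ultimately show ?thesis by (simp add: lookup_add sum.distrib)
qed

lemma total_degree_single [simp]: "total_degree (single v n) = n"
  by (simp add: total_degree_def)

lemma total_degree_0 [simp]: "total_degree 0 = 0"
  by (simp add: total_degree_def)

lemma total_degree_eq_0_iff [simp]: "total_degree m = 0 \<longleftrightarrow> m = 0"
  by (auto simp: total_degree_def in_keys_iff intro!: poly_mapping_eqI)

lemma monomials_add:
  "m \<in> monomials V k \<Longrightarrow> n \<in> monomials V l \<Longrightarrow> m + n \<in> monomials V (k + l)"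
  by (auto simp: monomials_def keys_add_nat total_degree_add)

lemma monomials_add_iff:
  "v \<in> monomials V d \<Longrightarrow> v + m \<in> monomials V (d + k) \<longleftrightarrow> m \<in> monomials V k"
  by (auto simp: monomials_def keys_add_nat total_degree_add)

lemma monomials_neg [simp]: "k < 0 \<Longrightarrow> monomials V k = {}"
  by (auto simp: monomials_def)

lemma monomials_0 [simp]: "monomials V 0 = {0}"
  by (auto simp: monomials_def)

lemma finite_monomials:
  assumes "finite V" shows "finite (monomials V k)"
proof (rule finite_imageD)
  let ?F = "{f. \<forall>x. (x \<in> V \<longrightarrow> f x \<in> {..nat k}) \<and> (x \<notin> V \<longrightarrow> f x = 0)}"
  have "lookup m x \<le> nat k" if "m \<in> monomials V k" for m x
  proof (cases "x \<in> keys m")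
    case True
    then have "lookup m x \<le> total_degree m"
      unfolding total_degree_def by (intro member_le_sum) auto
    with that show ?thesis by (auto simp: monomials_def)
  qed (simp add: in_keys_iff)
  then have "lookup ` monomials V k \<subseteq> ?F"
    by (auto simp: monomials_def in_keys_iff)
  then show "finite (lookup ` monomials V k)"
    using finite_set_of_finite_funs[OF assms, of "{..nat k}" 0] finite_subset by auto
  show "inj_on lookup (monomials V k)"
    by (auto simp: inj_on_def intro: poly_mapping_eqI)
qed

section \<open>Monomials in four variables\<close>

lemma nat_le_3_cases: "(i::nat) \<le> 3 \<Longrightarrow> i = 0 \<or> i = 1 \<or> i = 2 \<or> i = 3"
  by auto

lemma monomials4_iff:
  "m \<in> monomials {..3::nat} k \<longleftrightarrow> (\<forall>i>3. lookup m i = 0) \<and>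
    int (lookup m 0 + lookup m 1 + lookup m 2 + lookup m 3) = k"
proof -
  have "{..3::nat} = {0, 1, 2, 3}" by auto
  then have "total_degree m = lookup m 0 + lookup m 1 + lookup m 2 + lookup m 3"
    if "keys m \<subseteq> {..3::nat}"
    using total_degree_superset[OF _ that] by simp
  moreover have "keys m \<subseteq> {..3::nat} \<longleftrightarrow> (\<forall>i>3. lookup m i = 0)"
    unfolding subset_iff in_keys_iff by (metis atMost_iff not_le)
  ultimately show ?thesis unfolding monomials_def by auto
qed

lemma monomial4_eqI:
  assumes "\<forall>i>3. lookup m i = 0" "\<forall>i>3. lookup n i = 0"
    "lookup m 0 = lookup n 0" "lookup m 1 = lookup n 1"
    "lookup m 2 = lookup n 2" "lookup m 3 = lookup n 3"
  shows "m = (n :: nat \<Rightarrow>\<^sub>0 nat)"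
proof (rule poly_mapping_eqI)
  fix i show "lookup m i = lookup n i"
    using assms nat_le_3_cases[of i] by (cases "i \<le> 3") auto
qed

text \<open>Kronecker substitution: base 4 separates the exponents of monomials of degree at most 3.\<close>

definition kronecker :: "(nat \<Rightarrow>\<^sub>0 nat) \<Rightarrow> nat" where
  "kronecker m = lookup m 0 + 4 * lookup m 1 + 16 * lookup m 2
    + 64 * lookup m 3"

lemma kronecker_add: "kronecker (m + n) = kronecker m + kronecker n"
  by (simp add: kronecker_def lookup_add)

lemma digits4_inject:
  fixes a b c d a' b' c' d' :: nat
  assumes "a + 4 * b + 16 * c + 64 * d = a' + 4 * b' + 16 * c' + 64 * d'"
    "a \<le> 3" "b \<le> 3" "c \<le> 3" "a' \<le> 3" "b' \<le> 3" "c' \<le> 3"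
  shows "a = a' \<and> b = b' \<and> c = c' \<and> d = d'"
proof -
  have step: "r = r' \<and> x = y" if "r + 4 * x = r' + 4 * y" "r \<le> 3" "r' \<le> 3" for r x r' y :: nat
    using that by presburger
  have "a + 4 * (b + 4 * (c + 4 * d)) = a' + 4 * (b' + 4 * (c' + 4 * d'))"
    using assms(1) by simp
  then show ?thesis using step assms(2-) by blast
qed

lemma inj_on_kronecker:
  assumes "k \<le> 3" shows "inj_on kronecker (monomials {..3} k)"
proof (rule inj_onI)
  fix m n assume "m \<in> monomials {..3} k" "n \<in> monomials {..3} k" "kronecker m = kronecker n"
  then show "m = n"
    using digits4_inject[of "lookup m 0" "lookup m 1" "lookup m 2"
        "lookup m 3" "lookup n 0" "lookup n 1"
        "lookup n 2" "lookup n 3"] assms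
    by (intro monomial4_eqI) (auto simp: monomials4_iff kronecker_def)
qed

lemma card_monomials4_2: "card (monomials {..3::nat} 2) \<le> 10"
proof -
  \<comment> \<open>The first four codes belong to the squares, the other six to the products of two
    different coordinates.\<close>
  have "kronecker ` monomials {..3} 2 \<subseteq> {2, 8, 32, 128, 5, 17, 65, 20, 68, 80}"
  proof (rule image_subsetI)
    fix m assume "m \<in> monomials {..3::nat} 2"
    then have *: "lookup m 0 + lookup m 1 + lookup m 2 +
        lookup m 3 = 2"
      by (simp add: monomials4_iff)
    then have "lookup m 0 \<in> {0, 1, 2}" "lookup m 1 \<in> {0, 1, 2}"
      "lookup m 2 \<in> {0, 1, 2}"
      by auto
    with * show "kronecker m \<in> {2, 8, 32, 128, 5, 17, 65, 20, 68, 80}"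
      unfolding kronecker_def by (elim insertE emptyE) simp_all
  qed
  then have "card (kronecker ` monomials {..3} 2) \<le> card {2, 8, 32, 128, 5, 17, 65, 20, 68, 80 :: nat}"
    by (intro card_mono) auto
  also have "\<dots> = 10" by simp
  finally show ?thesis by (simp add: card_image[OF inj_on_kronecker])
qed

lemma multiples_single_iff:
  "m \<in> multiples (single i (c :: nat)) \<longleftrightarrow> c \<le> lookup m i"
proof
  assume "c \<le> lookup m i"
  then have "m = single i c + (m - single i c)"
    by (intro poly_mapping_eqI) (auto simp: lookup_add lookup_single minus_poly_mapping.rep_eq when_def)
  then show "m \<in> multiples (single i c)" unfolding multiples_def by blast
qed (auto simp: multiples_def lookup_add)

text \<open>The pure powers x_i^3, which are at once monomials of R and four of the variables of S.
  Their number is the dimension of R.\<close>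

definition cubes :: "(nat \<Rightarrow>\<^sub>0 nat) set" where
  "cubes = (\<lambda>i. single i 3) ` {..3}"

lemma cubes_subset: "cubes \<subseteq> veronese_vars 3 3"
  by (auto simp: cubes_def veronese_vars_def monomials_def)

text \<open>The residue r = 0 gives R. The residue r = 2 gives the dualising module up to a shift of
  k: the canonical sheaf is O(-4), and -4 is congruent to 2 modulo 3.\<close>

lemma monomial_module_veronese:
  "monomial_module (\<lambda>v. v) (\<lambda>k. monomials {..3} (3 * k + r)) (veronese_vars 3 3) cubes"
proof
  fix v m k assume "v \<in> veronese_vars 3 3"
  then have "v + m \<in> monomials {..3} (3 + (3 * k + r)) \<longleftrightarrow> m \<in> monomials {..3} (3 * k + r)"
    by (intro monomials_add_iff) (simp add: veronese_vars_def)
  then show "v + m \<in> monomials {..3} (3 * (k + 1) + r) \<longleftrightarrow> m \<in> monomials {..3} (3 * k + r)"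
    by (simp add: algebra_simps)
next
  fix y y' m assume "y \<in> cubes" "y' \<in> cubes" "y \<noteq> y'" "y + m \<in> multiples y'"
  then show "m \<in> multiples y'"
    by (auto simp: cubes_def multiples_single_iff lookup_add lookup_single when_def split: if_splits)
qed (use cubes_subset in \<open>simp_all add: veronese_vars_def finite_monomials\<close>)

lemma reduced_cubes_iff:
  "m \<in> monomial_module.reduced (\<lambda>v. v) cubes \<longleftrightarrow> (\<forall>i\<le>3. lookup m i \<le> 2)"
proof -
  have "\<not> 3 \<le> a \<longleftrightarrow> a \<le> 2" for a :: nat by auto
  then show ?thesis by (auto simp: monomial_module.reduced_def[OF monomial_module_veronese[of 0]]
        cubes_def multiples_single_iff)
qed

section \<open>Homomorphisms out of monoid algebras\<close>

definition evaluate :: "('k \<Rightarrow> 'b) \<Rightarrow> ('a \<Rightarrow> 'b) \<Rightarrow> ('a \<Rightarrow>\<^sub>0 'k::zero) \<Rightarrow> 'b::comm_semiring_1" where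
  "evaluate \<iota> g p = (\<Sum>m\<in>keys p. \<iota> (lookup p m) * g m)"

text \<open>Covers two homomorphisms: Kronecker substitution into univariate polynomials, and the
  substitution through which S acts on R.\<close>

locale evaluation =
  fixes \<iota> :: "'k::comm_ring_1 \<Rightarrow> 'b::comm_ring_1" and g :: "'a::comm_monoid_add \<Rightarrow> 'b"
  assumes \<iota>_add: "\<iota> (a + b) = \<iota> a + \<iota> b" and \<iota>_mult: "\<iota> (a * b) = \<iota> a * \<iota> b" and \<iota>_1: "\<iota> 1 = 1"
    and g_add: "g (m + n) = g m * g n" and g_0: "g 0 = 1"
begin

lemma \<iota>_0 [simp]: "\<iota> 0 = 0"
  using \<iota>_add[of 0 0] by simp

lemma evaluate_superset:
  "finite W \<Longrightarrow> keys p \<subseteq> W \<Longrightarrow> evaluate \<iota> g p = (\<Sum>m\<in>W. \<iota> (lookup p m) * g m)"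
  unfolding evaluate_def by (rule sum.mono_neutral_left) (auto simp: in_keys_iff)

lemma evaluate_add: "evaluate \<iota> g (p + q) = evaluate \<iota> g p + evaluate \<iota> g q"
proof -
  let ?W = "keys p \<union> keys q"
  have "evaluate \<iota> g (p + q) = (\<Sum>m\<in>?W. \<iota> (lookup (p + q) m) * g m)"
    by (rule evaluate_superset) (simp_all add: keys_add)
  moreover have "evaluate \<iota> g p = (\<Sum>m\<in>?W. \<iota> (lookup p m) * g m)"
    by (rule evaluate_superset) auto
  moreover have "evaluate \<iota> g q = (\<Sum>m\<in>?W. \<iota> (lookup q m) * g m)"
    by (rule evaluate_superset) auto
  ultimately show ?thesis by (simp add: lookup_add \<iota>_add sum.distrib distrib_right)
qed

lemma evaluate_zero [simp]: "evaluate \<iota> g 0 = 0"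
  by (simp add: evaluate_def)

lemma additive_evaluate: "additive (evaluate \<iota> g)"
  by unfold_locales (rule evaluate_add)

lemma evaluate_single: "evaluate \<iota> g (single m c) = \<iota> c * g m"
  by (simp add: evaluate_def)

lemma evaluate_one: "evaluate \<iota> g 1 = 1"
  using evaluate_single[of 0 1] by (simp add: g_0 \<iota>_1)

lemma evaluate_mult: "evaluate \<iota> g (p * q) = evaluate \<iota> g p * evaluate \<iota> g q"
proof -
  have "p * q = (\<Sum>m\<in>keys p. single m (lookup p m)) *
      (\<Sum>n\<in>keys q. single n (lookup q n))"
    using poly_mapping_sum_singles[of p] poly_mapping_sum_singles[of q] by simp
  also have "\<dots> = (\<Sum>m\<in>keys p. \<Sum>n\<in>keys q.
      single (m + n) (lookup p m * lookup q n))"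
    by (simp add: sum_product mult_single)
  finally have "evaluate \<iota> g (p * q) = (\<Sum>m\<in>keys p. \<Sum>n\<in>keys q.
      \<iota> (lookup p m) * \<iota> (lookup q n) * (g m * g n))"
    by (simp add: additive.sum[OF additive_evaluate] evaluate_single \<iota>_mult g_add)
  then show ?thesis by (simp add: evaluate_def sum_product mult_ac)
qed

end

section \<open>The Artinian reduction\<close>

lemma kronecker_0: "kronecker 0 = 0"
  by (simp add: kronecker_def)

lemma inj_kronecker_2: "inj_on kronecker (monomials {..3} 2)"
  by (rule inj_on_kronecker) simp

interpretation R: monomial_module "\<lambda>v. v" "\<lambda>k. monomials {..3::nat} (3 * k)" "veronese_vars 3 3" cubes
    "TYPE('k::field_char_0)"
  using monomial_module_veronese[of 0] by simp

interpretation W: monomial_module "\<lambda>v. v" "\<lambda>k. monomials {..3::nat} (3 * k + 2)" "veronese_vars 3 3" cubes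
    "TYPE('k::field_char_0)"
  by (rule monomial_module_veronese)

definition Vbar :: "(nat \<Rightarrow>\<^sub>0 nat) set" where
  "Vbar = veronese_vars 3 3 - cubes"

text \<open>A cubic monomial with an exponent above 2 is a pure cube. So the remaining variables are
  also the monomial basis of the degree 1 component of the reduction of R.\<close>

lemma Vbar_eq: "Vbar = monomials {..3} 3 \<inter> R.reduced cubes"
proof -
  have "m \<in> cubes" if m: "m \<in> monomials {..3} 3" and i: "i \<le> 3" "\<not> lookup m i \<le> 2" for m i
  proof -
    have "m = single i 3"
      using m i nat_le_3_cases[OF i(1)]
      by (intro monomial4_eqI) (auto simp: monomials4_iff lookup_single when_def)
    then show ?thesis using i by (auto simp: cubes_def)
  qed
  moreover have "m \<notin> R.reduced cubes" if "m \<in> cubes" for m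
    using that unfolding reduced_cubes_iff by (auto simp: cubes_def lookup_single)
  ultimately show ?thesis unfolding Vbar_def veronese_vars_def reduced_cubes_iff set_eq_iff
    by (simp add: reduced_cubes_iff) blast
qed

lemma finite_Vbar [simp]: "finite Vbar"
  by (simp add: Vbar_def veronese_vars_def finite_monomials)

definition mono4 :: "nat \<Rightarrow> nat \<Rightarrow> nat \<Rightarrow> nat \<Rightarrow> (nat \<Rightarrow>\<^sub>0 nat)" where
  "mono4 a b c d = single 0 a + single 1 b + single 2 c + single 3 d"

lemma lookup_mono4 [simp]:
  "lookup (mono4 a b c d) 0 = a" "lookup (mono4 a b c d) (Suc 0) = b"
  "lookup (mono4 a b c d) 2 = c" "lookup (mono4 a b c d) 3 = d"
  "i > 3 \<Longrightarrow> lookup (mono4 a b c d) i = 0"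
  by (simp_all add: mono4_def lookup_add lookup_single)

lemma kronecker_mono4: "kronecker (mono4 a b c d) = a + 4 * b + 16 * c + 64 * d"
  by (simp add: kronecker_def)

text \<open>The list consists of the twelve x_i^2 x_j and the four products of three distinct
  coordinates; they are told apart by their Kronecker codes. The bound 16 leaves at least 10
  variables after removing at most 6.\<close>

lemma card_Vbar: "card Vbar \<ge> 16"
proof -
  let ?S = "(\<lambda>(a, b, c, d). mono4 a b c d) ` {(2,1,0,0), (2,0,1,0), (2,0,0,1), (1,2,0,0),
    (0,2,1,0), (0,2,0,1),
     (1,0,2,0), (0,1,2,0), (0,0,2,1), (1,0,0,2), (0,1,0,2), (0,0,1,2), (1,1,1,0), (1,1,0,1),
       (1,0,1,1), (0,1,1,1)}"
  have "16 = card (kronecker ` ?S)" by (simp add: image_image kronecker_mono4)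
  also have "\<dots> \<le> card ?S" by (rule card_image_le) simp
  also have "?S \<subseteq> Vbar"
    by (auto simp: Vbar_eq monomials4_iff reduced_cubes_iff dest!: nat_le_3_cases)
  then have "card ?S \<le> card Vbar" by (simp add: card_mono)
  finally show ?thesis .
qed

section \<open>Vanishing for the dualising module\<close>

lemma lookup_koszul_diff:
  "A \<subseteq> X \<Longrightarrow> lookup (koszul_diff T X z A) m =
    (\<Sum>v\<in>X - A. signed v A (lookup (T v (z (insert v A))) m))"
  by (auto simp: koszul_diff_def lookup_sum signed_def intro!: sum.cong)

lemma koszul_exact_trivial:
  assumes "M k \<subseteq> {0}" "0 \<in> M (k - 1)" "\<And>v. additive (T v)"
  shows "koszul_exact T X M i k"
  unfolding koszul_exact_def
proof (intro allI impI; elim conjE)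
  fix z assume "koszul_chain X (M k) i z"
  then have "z = (\<lambda>_. 0)" using assms(1) by (auto simp: koszul_chain_def)
  moreover have "koszul_diff T X (\<lambda>_. 0) = (\<lambda>_. 0)" using koszul_diff_zero[where T = T, OF
    assms(3)] by blast
  ultimately show "\<exists>w. koszul_chain X (M (k - 1)) (Suc i) w \<and> koszul_diff T X w = z"
    using assms(2) by (intro exI[of _ "\<lambda>_. 0"]) (auto simp: koszul_chain_def)
qed

text \<open>There are no forms of degree -1, so exactness at k = 0 means that a cycle of quadrics
  vanishes. Kronecker substitution restricts forms to the curve (t, t^4, t^16, t^64). It is
  multiplicative, so cycles go to cycles; their coefficients lie in the span of at most 10
  polynomials, and Green's vanishing applies. Since it is injective on quadrics, the original cycle
  is zero.\<close>

lemma omega_injective: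
  assumes "q \<ge> 10"
  shows "koszul_exact (W.mult_op {}) (veronese_vars 3 3) (W.truncated {} :: int \<Rightarrow> (_ \<Rightarrow>\<^sub>0
    'k::field_char_0) set) q 0"
  unfolding koszul_exact_def
proof (intro allI impI; elim conjE)
  fix z :: "(nat \<Rightarrow>\<^sub>0 nat) set \<Rightarrow> (nat \<Rightarrow>\<^sub>0 nat) \<Rightarrow>\<^sub>0 'k"
  assume z: "koszul_chain (veronese_vars 3 3) (W.truncated {} 0) q z" and cyc: "koszul_diff
    (W.mult_op {}) (veronese_vars 3 3) z = (\<lambda>_. 0)"
  let ?V = "veronese_vars 3 3"
  let ?\<theta> = "evaluate (\<lambda>c::'k. [:c:]) (\<lambda>m. monom 1 (kronecker m))"
  interpret \<theta>: evaluation "\<lambda>c::'k. [:c:]" "\<lambda>m. monom 1 (kronecker m)"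
    by unfold_locales (simp_all add: kronecker_add mult_monom kronecker_0 one_pCons)
  define S :: "'k poly set" where "S = (\<lambda>m. monom 1 (kronecker m)) ` monomials {..3} 2"
  have fin: "finite (monomials {..3::nat} 2)" by (simp add: finite_monomials)
  have zk: "keys (z A) \<subseteq> monomials {..3} 2" for A
    using z by (auto simp: koszul_chain_def W.truncated_def)
  have "(\<lambda>A. ?\<theta> (z A)) = (\<lambda>_. 0)"
  proof (rule green_vanishing)
    show "finite ?V" by (simp add: veronese_vars_def finite_monomials)
    show "inj_on kronecker ?V" using inj_on_kronecker[of 3] by (simp add: veronese_vars_def)
    show "finite S" using fin by (simp add: S_def)
    show "card S \<le> q"
      using card_image_le[OF fin] card_monomials4_2 assms unfolding S_def by (meson order.trans)
    have "?\<theta> (z A) \<in> poly_space.span S" for A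
      unfolding evaluate_def
    proof (rule poly_space.span_sum)
      fix m assume "m \<in> keys (z A)"
      then have "monom 1 (kronecker m) \<in> S" using zk by (auto simp: S_def)
      then show "[:lookup (z A) m:] * monom 1 (kronecker m) \<in> poly_space.span S"
        using poly_space.span_scale[OF poly_space.span_base] by fastforce
    qed
    moreover have "z A \<noteq> 0" if "?\<theta> (z A) \<noteq> 0" for A using that by auto
    ultimately show "koszul_chain ?V (poly_space.span S) q (\<lambda>A. ?\<theta> (z A))"
      using z unfolding koszul_chain_def by blast
    have "koszul_diff (\<lambda>v p. monom 1 (kronecker v) * p) ?V (\<lambda>A. ?\<theta> (z A)) A = ?\<theta> (koszul_diff
      (W.mult_op {}) ?V z A)" for A
      by (rule koszul_diff_hom[OF \<theta>.additive_evaluate, symmetric]) (simp add: W.mult_op_def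
        \<theta>.evaluate_mult \<theta>.evaluate_single)
    then show "koszul_diff (\<lambda>v p. monom 1 (kronecker v) * p) ?V (\<lambda>A. ?\<theta> (z A)) = (\<lambda>_. 0)"
      using cyc by auto
  qed
  have "z A = 0" for A
  proof (rule poly_mapping_eqI)
    fix m
    show "lookup (z A) m = lookup 0 m"
    proof (cases "m \<in> keys (z A)")
      case True
      have "coeff (?\<theta> (z A)) (kronecker m) = (\<Sum>n\<in>keys (z A). if n = m then lookup (z A) n else 0)"
        unfolding evaluate_def coeff_sum
      proof (rule sum.cong[OF refl])
        fix n assume "n \<in> keys (z A)"
        then have "kronecker n = kronecker m \<longleftrightarrow> n = m"
          using True zk[of A] inj_on_eq_iff[OF inj_kronecker_2] by blast
        then show "coeff ([:lookup (z A) n:] * monom 1 (kronecker n)) (kronecker m) =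
            (if n = m then lookup (z A) n else 0)"
          by auto
      qed
      moreover have "?\<theta> (z A) = 0" using \<open>(\<lambda>A. ?\<theta> (z A)) = (\<lambda>_. 0)\<close> by meson
      ultimately show ?thesis using True by simp
    qed (simp add: in_keys_iff)
  qed
  then have "z = (\<lambda>_. 0)" by auto
  moreover have "koszul_diff (W.mult_op {}) ?V (\<lambda>_. 0) = (\<lambda>_. 0 :: _ \<Rightarrow>\<^sub>0 'k)"
    by (rule ext, rule koszul_diff_zero) (rule W.additive_mult_op)
  ultimately show "\<exists>w. koszul_chain ?V (W.truncated {} (0 - 1)) (Suc q) w \<and> koszul_diff (W.mult_op
    {}) ?V w = z"
    by (intro exI[of _ "\<lambda>_. 0"]) (simp add: koszul_chain_def W.truncated_def)
qed

text \<open>Descent to the Artinian quotient keeps exactness, and it still means injectivity because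
  the component at -1 is zero.\<close>

lemma omega_bar_cycle_zero:
  fixes z :: "(nat \<Rightarrow>\<^sub>0 nat) set \<Rightarrow> (nat \<Rightarrow>\<^sub>0 nat) \<Rightarrow>\<^sub>0 'k::field_char_0"
  assumes "q \<ge> 10" "koszul_chain Vbar (W.truncated cubes 0) q z" "koszul_diff (W.mult_op cubes)
    Vbar z = (\<lambda>_. 0)"
  shows "z A = 0"
proof -
  have "koszul_exact (W.mult_op cubes) Vbar (W.truncated cubes :: int \<Rightarrow> (_ \<Rightarrow>\<^sub>0 'k) set) q 0"
    unfolding Vbar_def by (subst W.koszul_exact_reduce[OF order_refl]) (rule omega_injective[OF assms(1)])
  then obtain w where w: "koszul_chain Vbar (W.truncated cubes (-1)) (Suc q) w" "koszul_diff
    (W.mult_op cubes) Vbar w = z"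
    using assms by (auto simp: koszul_exact_def)
  have "w = (\<lambda>_. 0)" using w(1) by (auto simp: koszul_chain_def W.truncated_def)
  moreover have "koszul_diff (W.mult_op cubes) Vbar (\<lambda>_. 0) A = (0 :: _ \<Rightarrow>\<^sub>0 'k)"
    by (rule koszul_diff_zero) (rule W.additive_mult_op)
  ultimately show ?thesis using w(2) by simp
qed

section \<open>Duality between the two Artinian reductions\<close>

lemma signed_eq_times: "signed v A x = signed v A 1 * (x :: 'k::ring_1)"
  by (simp add: signed_def)

lemma signed_times_signed: "signed v A (1 :: 'k::ring_1) * signed v A 1 = 1"
  by (simp add: signed_def)

lemma signed_disjoint_union:
  assumes "finite A" "finite C" "A \<inter> C = {}"
  shows "signed v (A \<union> C) (1 :: 'k::ring_1) = signed v A 1 * signed v C 1"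
proof -
  have "{a \<in> A \<union> C. a < v} = {a \<in> A. a < v} \<union> {a \<in> C. a < v}" by auto
  moreover have "card \<dots> = card {a \<in> A. a < v} + card {a \<in> C. a < v}"
    using assms by (intro card_Un_disjoint) auto
  ultimately show ?thesis by (auto simp: signed_def)
qed

definition basis :: "int \<Rightarrow> (nat \<Rightarrow>\<^sub>0 nat) set" where
  "basis d = monomials {..3} d \<inter> R.reduced cubes"

text \<open>The socle monomial of K[x_0, ..., x_3]/(x_i^3), of degree 8; subtraction from it pairs
  the basis in degree d with the basis in degree 8 - d.\<close>

definition top4 :: "nat \<Rightarrow>\<^sub>0 nat" where
  "top4 = mono4 2 2 2 2"

lemma finite_basis [simp]: "finite (basis d)"
  by (simp add: basis_def finite_monomials)

lemma basis_iff: "m \<in> basis d \<longleftrightarrow> (\<forall>i>3. lookup m i = 0) \<and>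
    lookup m 0 \<le> 2 \<and> lookup m 1 \<le> 2 \<and>
    lookup m 2 \<le> 2 \<and> lookup m 3 \<le> 2 \<and>
    int (lookup m 0 + lookup m 1 + lookup m 2 + lookup m 3) = d"
  unfolding basis_def Int_iff monomials4_iff reduced_cubes_iff using nat_le_3_cases by fastforce

lemma basis_complement: "m \<in> basis d \<Longrightarrow> top4 - m \<in> basis (8 - d)"
  by (auto simp: basis_iff top4_def minus_poly_mapping.rep_eq)

lemma basis_complement_complement: "m \<in> basis d \<Longrightarrow> top4 - (top4 - m) = m"
  by (rule monomial4_eqI) (auto simp: basis_iff top4_def minus_poly_mapping.rep_eq)

lemma complement_factor:
  assumes "v + t \<in> basis d" shows "top4 - t = v + (top4 - (v + t))"
  using assms
  by (intro monomial4_eqI) (auto simp: basis_iff top4_def minus_poly_mapping.rep_eq lookup_add)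

text \<open>Together with \<open>complement_factor\<close> this is transposition on monomials: v
  carries t to s just when v carries the complement of s to the complement of t. A product that is
  truncated on one side matches a division that fails on the other.\<close>

lemma factor_if_complement:
  assumes "s \<in> basis d" "v + (top4 - s) \<in> basis e" shows "\<exists>t. s = v + t"
proof
  show "s = v + (s - v)"
    using assms
    by (intro monomial4_eqI) (auto simp: basis_iff top4_def minus_poly_mapping.rep_eq lookup_add)
qed

lemma finite_subset_Vbar: "A \<subseteq> Vbar \<Longrightarrow> finite A"
  by (rule finite_subset[OF _ finite_Vbar])

text \<open>
  Since \<open>Vbar\<close> has 16 elements and the top degree of the Artinian reduction is 8, complementing
  both the subset and the monomial turns the transpose of the last differential of the reduction of
  \<open>R\<close> into the first differential of the reduction of the module of forms of degree \<open>3k + 2\<close>.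
\<close>

lemma transpose_injective:
  fixes \<phi> :: "(nat \<Rightarrow>\<^sub>0 nat) set \<Rightarrow> (nat \<Rightarrow>\<^sub>0 nat) \<Rightarrow> 'k::field_char_0"
  assumes "p \<le> 6"
    and ortho: "\<And>A c. A \<subseteq> Vbar \<Longrightarrow> card A = Suc p \<Longrightarrow> c \<in> basis 3 \<Longrightarrow>
      (\<Sum>v\<in>A. if v + c \<in> basis 6 then \<phi> (A - {v}) (v + c) * signed v (A - {v}) 1 else 0) = 0"
    and A: "A \<subseteq> Vbar" "card A = p" and b: "b \<in> basis 6"
  shows "\<phi> A b = 0"
proof -
  define q where "q = card Vbar - p"
  have q: "q \<ge> 10" using card_Vbar assms(1) by (simp add: q_def)
  \<comment> \<open>Up to a sign depending only on the size of C, this is the sign of the shuffle of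
    C and its complement. With it, \<psi> below is the Hodge star of \<phi> combined with
    complementation of monomials.\<close>
  define \<epsilon> :: "_ \<Rightarrow> 'k" where "\<epsilon> C = (\<Prod>v\<in>C. signed v Vbar 1)" for C
  define \<psi> where "\<psi> C = (if C \<subseteq> Vbar \<and> card C = q then
    \<Sum>t\<in>basis 2. single t (\<epsilon> C * \<phi> (Vbar - C) (top4 - t)) else 0)" for C
  have lookup_\<psi>: "lookup (\<psi> C) t =
      (if C \<subseteq> Vbar \<and> card C = q \<and> t \<in> basis 2 then \<epsilon> C * \<phi> (Vbar - C) (top4 - t) else 0)" for C t
    by (simp add: \<psi>_def lookup_sum lookup_single when_def)
  have chain: "koszul_chain Vbar (W.truncated cubes 0) q \<psi>"
    unfolding koszul_chain_def
  proof (intro allI conjI impI)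
    fix C
    show "\<psi> C \<in> W.truncated cubes 0" by (auto simp: W.truncated_iff lookup_\<psi> basis_def split: if_splits)
    assume "\<psi> C \<noteq> 0"
    then show "C \<subseteq> Vbar" "card C = q" by (auto simp: \<psi>_def split: if_splits)
  qed
  have "koszul_diff (W.mult_op cubes) Vbar \<psi> C = 0" for C
  \<comment> \<open>A nonzero value forces C to have q - 1 elements and a monomial s of degree 5 to
    occur, which are the only cases in which the orthogonality relation has to be matched.\<close>
  proof (rule ccontr)
    assume nz: "koszul_diff (W.mult_op cubes) Vbar \<psi> C \<noteq> 0"
    have "koszul_chain Vbar (W.truncated cubes 1) (q - 1) (koszul_diff (W.mult_op cubes) Vbar \<psi>)"
    proof (rule koszul_diff_chain)
      show "koszul_chain Vbar (W.truncated cubes 0) (Suc (q - 1)) \<psi>" using chain q by simp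
      show "W.mult_op cubes v m \<in> W.truncated cubes 1" if "v \<in> Vbar" "m \<in> W.truncated cubes 0" for
        v and m :: "_ \<Rightarrow>\<^sub>0 'k"
        using that W.mult_op_closed[of v m cubes 0] by (simp add: Vbar_def)
    qed (simp_all add: W.subgroup_add_truncated W.additive_mult_op)
    then have C: "C \<subseteq> Vbar" "card C = q - 1" and kW: "koszul_diff (W.mult_op cubes) Vbar \<psi> C \<in>
      W.truncated cubes 1"
      using nz by (auto simp: koszul_chain_def)
    obtain s where s: "lookup (koszul_diff (W.mult_op cubes) Vbar \<psi> C) s \<noteq> 0"
      using nz by (metis poly_mapping_eqI lookup_zero)
    then have sb: "s \<in> basis 5" using kW by (auto simp: W.truncated_iff basis_def)
    define A where "A = Vbar - C"
    define c where "c = top4 - s"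
    have c: "c \<in> basis 3" using basis_complement[OF sb] by (simp add: c_def)
    have fC: "finite C" by (rule finite_subset_Vbar[OF C(1)])
    have cA: "card A = Suc p" and AV: "A \<subseteq> Vbar"
      using C q card_mono[OF finite_Vbar C(1)] assms(1) fC card_Vbar by (auto simp: A_def
        card_Diff_subset q_def)
    have summand: "signed v C (lookup (W.mult_op cubes v (\<psi> (insert v C))) s) =
        \<epsilon> C * (if v + c \<in> basis 6 then \<phi> (A - {v}) (v + c) * signed v (A - {v}) 1 else 0)" if v:
          "v \<in> A" for v
    proof (cases "\<exists>t. s = v + t")
      case True
      then obtain t where t: "s = v + t" by blast
      have "v + c = top4 - t" using complement_factor[of v t 5] sb by (simp add: t c_def)
      moreover have "v \<in> monomials {..3} 3" using v by (simp add: A_def Vbar_eq)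
      then have tb: "t \<in> basis 2"
        using sb monomials_add_iff[of v "{..3}" 3 t 2] W.reduced_factor unfolding basis_def t by auto
      moreover have "top4 - t \<in> basis 6" using basis_complement[OF tb] by simp
      moreover have "Vbar - insert v C = A - {v}" by (auto simp: A_def)
      moreover have "card (insert v C) = q" "insert v C \<subseteq> Vbar"
        using v C q fC by (auto simp: A_def)
      moreover have "s \<in> W.reduced cubes" using sb by (simp add: basis_def)
      moreover have "\<epsilon> (insert v C) = signed v Vbar 1 * \<epsilon> C"
        using v fC by (simp add: \<epsilon>_def A_def)
      \<comment> \<open>C and A partition Vbar, so the sign of v relative to Vbar is a product of
        two signs, and the one for C is squared away.\<close>
      moreover have "signed v C 1 * signed v Vbar 1 = signed v (A - {v}) (1 :: 'k)"
      proof -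
        have "signed v Vbar (1::'k) = signed v (C \<union> A) 1" using C(1) by (simp add: A_def Un_absorb1)
        also have "\<dots> = signed v C 1 * signed v A 1"
          using fC by (intro signed_disjoint_union) (auto simp: A_def)
        also have "signed v A (1::'k) = signed v (A - {v}) 1"
          unfolding signed_def by (rule arg_cong[where f = "\<lambda>S. if even (card S) then _ else _"]) auto
        finally show ?thesis by (simp add: signed_times_signed flip: mult.assoc)
      qed
      ultimately show ?thesis
        by (simp add: W.mult_op_def lookup_restrict_keys lookup_single_times lookup_\<psi> t
          signed_eq_times[of v C "_ * _"] mult_ac)
    next
      case False
      then have "v + c \<notin> basis 6" using factor_if_complement[OF sb, of v 6] by (auto simp: c_def)
      with False show ?thesis by (simp add: W.mult_op_def lookup_restrict_keys lookup_single_times)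
    qed
    have "lookup (koszul_diff (W.mult_op cubes) Vbar \<psi> C) s =
        (\<Sum>v\<in>A. \<epsilon> C * (if v + c \<in> basis 6 then \<phi> (A - {v}) (v + c) * signed v (A - {v}) 1 else 0))"
      unfolding lookup_koszul_diff[OF C(1)] A_def[symmetric] by (rule sum.cong[OF refl]) (rule summand)
    also have "\<dots> = 0" by (simp add: ortho[OF AV cA c] flip: sum_distrib_left)
    finally show False using s by simp
  qed
  then have \<psi>0: "\<psi> C = 0" for C using omega_bar_cycle_zero[OF q chain] by blast
  have "Vbar - A \<subseteq> Vbar" "card (Vbar - A) = q" "Vbar - (Vbar - A) = A" "top4 - b \<in> basis 2"
    using A finite_subset_Vbar[OF A(1)] basis_complement[OF b] by (auto simp: card_Diff_subset q_def)
  then have "\<epsilon> (Vbar - A) * \<phi> A b = 0"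
    using lookup_\<psi>[of "Vbar - A" "top4 - b"] \<psi>0[of "Vbar - A"] by (simp add:
      basis_complement_complement[OF b])
  moreover have "\<epsilon> C \<noteq> 0" for C
    by (cases "finite C") (simp_all add: \<epsilon>_def)
  ultimately show ?thesis by simp
qed

text \<open>The component at k = 3 would have degree 9, beyond the top degree 8, so exactness here
  amounts to surjectivity of the differential. As a matrix this has rows (A, b) with b of degree 6
  and columns (A, c) with c of degree 3; injectivity of its transpose is
  \<open>transpose_injective\<close>.\<close>

lemma rbar_exact_2:
  assumes "p \<le> 6"
  shows "koszul_exact (R.mult_op cubes) Vbar (R.truncated cubes :: int \<Rightarrow> (_ \<Rightarrow>\<^sub>0 'k::field_char_0)
    set) p 2"
  unfolding koszul_exact_def
proof (intro allI impI; elim conjE)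
  fix z :: "(nat \<Rightarrow>\<^sub>0 nat) set \<Rightarrow> (nat \<Rightarrow>\<^sub>0 nat) \<Rightarrow>\<^sub>0 'k"
  assume z: "koszul_chain Vbar (R.truncated cubes 2) p z"
  define I where "I = {A. A \<subseteq> Vbar \<and> card A = p} \<times> basis 6"
  define J where "J = {A. A \<subseteq> Vbar \<and> card A = Suc p} \<times> basis 3"
  \<comment> \<open>At most one v contributes to an entry. Writing the entry as a sum over v lets
    the row sums and the column sums both collapse after an exchange of summations.\<close>
  define D :: "_ \<Rightarrow> _ \<Rightarrow> 'k" where "D i j = (\<Sum>v\<in>Vbar. if v \<in> fst j \<and> i = (fst j - {v}, v + snd j)
    then signed v (fst i) 1 else 0)" for i j
  have fin: "finite {A. A \<subseteq> Vbar \<and> P A}" for P by (rule finite_subset[of _ "Pow Vbar"]) auto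
  have finI: "finite I" and finJ: "finite J" unfolding I_def J_def using fin by auto
  have "\<exists>w. \<forall>i\<in>I. (\<Sum>j\<in>J. D i j * w j) = lookup (z (fst i)) (snd i)"
  proof (rule matrix_surjective_if_transpose_injective[OF finI finJ])
    fix \<phi> assume *: "\<And>j. j \<in> J \<Longrightarrow> (\<Sum>i\<in>I. \<phi> i * D i j) = 0"
    show "\<forall>i\<in>I. \<phi> i = 0"
    proof clarify
      fix A b assume "(A, b) \<in> I"
      then have Ab: "A \<subseteq> Vbar" "card A = p" "b \<in> basis 6" by (auto simp: I_def)
      show "\<phi> (A, b) = 0"
      proof (rule transpose_injective[OF assms _ Ab, of "\<lambda>A b. \<phi> (A, b)"])
        fix A c assume Ac: "A \<subseteq> Vbar" "card A = Suc p" "c \<in> basis 3"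
        then have fA: "finite A" using finite_subset_Vbar by blast
        have "0 = (\<Sum>i\<in>I. \<phi> i * D i (A, c))" using *[of "(A, c)"] Ac by (simp add: J_def)
        also have "\<dots> = (\<Sum>i\<in>I. \<Sum>v\<in>Vbar. if i = (A - {v}, v + c) then (if v \<in> A then \<phi> (A - {v}, v +
          c) * signed v (A - {v}) 1 else 0) else 0)"
          unfolding D_def sum_distrib_left by (intro sum.cong refl) auto
        also have "\<dots> = (\<Sum>v\<in>Vbar. \<Sum>i\<in>I. if i = (A - {v}, v + c) then (if v \<in> A then \<phi> (A - {v}, v +
          c) * signed v (A - {v}) 1 else 0) else 0)"
          by (rule sum.swap)
        also have "\<dots> = (\<Sum>v\<in>Vbar. if (A - {v}, v + c) \<in> I then (if v \<in> A then \<phi> (A - {v}, v + c) *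
          signed v (A - {v}) 1 else 0) else 0)"
          using finI by simp
        also have "\<dots> = (\<Sum>v\<in>Vbar. if v \<in> A then (if v + c \<in> basis 6 then \<phi> (A - {v}, v + c) *
          signed v (A - {v}) 1 else 0) else 0)"
          using Ac fA by (intro sum.cong refl) (auto simp: I_def)
        also have "\<dots> = (\<Sum>v\<in>A. if v + c \<in> basis 6 then \<phi> (A - {v}, v + c) * signed v (A - {v}) 1 else 0)"
          using Ac(1) by (simp add: sum.If_cases Int_absorb1)
        finally show "(\<Sum>v\<in>A. if v + c \<in> basis 6 then \<phi> (A - {v}, v + c) * signed v (A - {v}) 1
          else 0) = 0" by simp
      qed
    qed
  qed
  then obtain w where w: "\<And>A b. (A, b) \<in> I \<Longrightarrow> (\<Sum>j\<in>J. D (A, b) j * w j) = lookup (z A) b"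
    by fastforce
  define W where "W C = (if C \<subseteq> Vbar \<and> card C = Suc p then \<Sum>c\<in>basis 3. single c (w (C, c)) else 0)" for C
  have lookup_W: "lookup (W C) c = (if (C, c) \<in> J then w (C, c) else 0)" for C c
    by (auto simp: W_def J_def lookup_sum lookup_single when_def)
  have chainW: "koszul_chain Vbar (R.truncated cubes (2 - 1)) (Suc p) W"
    unfolding koszul_chain_def
  proof (intro allI conjI impI)
    fix C
    show "W C \<in> R.truncated cubes (2 - 1)" by (auto simp: R.truncated_iff lookup_W J_def basis_def
      split: if_splits)
    assume "W C \<noteq> 0"
    then show "C \<subseteq> Vbar" "card C = Suc p" by (auto simp: W_def split: if_splits)
  qed
  have chain2: "koszul_chain Vbar (R.truncated cubes 2) p (koszul_diff (R.mult_op cubes) Vbar W)"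
  proof (rule koszul_diff_chain[OF _ chainW])
    show "R.mult_op cubes v m \<in> R.truncated cubes 2" if "v \<in> Vbar" "m \<in> R.truncated cubes (2 - 1)"
      for v and m :: "_ \<Rightarrow>\<^sub>0 'k"
      using that R.mult_op_closed[of v m cubes 1] by (simp add: Vbar_def)
  qed (simp_all add: R.subgroup_add_truncated R.additive_mult_op)
  have "koszul_diff (R.mult_op cubes) Vbar W A = z A" for A
  proof (cases "A \<subseteq> Vbar \<and> card A = p")
    case False
    then have "z A = 0" "koszul_diff (R.mult_op cubes) Vbar W A = 0" using z chain2 unfolding
      koszul_chain_def by blast+
    then show ?thesis by simp
  next
    case A: True
    then have fA: "finite A" using finite_subset_Vbar by blast
    show ?thesis
    proof (rule poly_mapping_eqI)
      fix b
      show "lookup (koszul_diff (R.mult_op cubes) Vbar W A) b = lookup (z A) b"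
      proof (cases "b \<in> basis 6")
        case False
        have "lookup y b = 0" if "y \<in> R.truncated cubes 2" for y :: "_ \<Rightarrow>\<^sub>0 'k"
          using False that by (auto simp: R.truncated_iff basis_def)
        then show ?thesis using z chain2 by (simp add: koszul_chain_def)
      next
        case b: True
        \<comment> \<open>Solves the incidence of an entry for the column instead of the row;
          \<open>b - v\<close> is a true quotient because b is a multiple of v.\<close>
        have eq: "v \<in> C \<and> (A, b) = (C - {v}, v + c) \<longleftrightarrow> v \<notin> A \<and> b \<in> multiples v \<and> (C, c) = (insert v
          A, b - v)" for v C c
          by (auto simp: multiples_def)
        have "lookup (z A) b = (\<Sum>j\<in>J. D (A, b) j * w j)"
          using w[of A b] A b by (simp add: I_def)
        also have "\<dots> = (\<Sum>j\<in>J. \<Sum>v\<in>Vbar. if j = (insert v A, b - v) then (if v \<notin> A \<and> b \<in> multiples v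
          then signed v A (w (insert v A, b - v)) else 0) else 0)"
          unfolding D_def sum_distrib_right
        proof (intro sum.cong refl)
          fix j :: "(nat \<Rightarrow>\<^sub>0 nat) set \<times> (nat \<Rightarrow>\<^sub>0 nat)" and v
          obtain C c where j: "j = (C, c)" by (cases j)
          show "(if v \<in> fst j \<and> (A, b) = (fst j - {v}, v + snd j) then signed v (fst (A, b)) 1
            else 0) * w j =
             (if j = (insert v A, b - v) then if v \<notin> A \<and> b \<in> multiples v then signed v A (w
               (insert v A, b - v)) else 0 else 0)"
            unfolding j fst_conv snd_conv eq by (auto simp: signed_def)
        qed
        also have "\<dots> = (\<Sum>v\<in>Vbar. \<Sum>j\<in>J. if j = (insert v A, b - v) then (if v \<notin> A \<and> b \<in> multiples v
          then signed v A (w (insert v A, b - v)) else 0) else 0)"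
          by (rule sum.swap)
        also have "\<dots> = (\<Sum>v\<in>Vbar. if (insert v A, b - v) \<in> J then (if v \<notin> A \<and> b \<in> multiples v then
          signed v A (w (insert v A, b - v)) else 0) else 0)"
          using finJ by simp
        also have "\<dots> = (\<Sum>v\<in>Vbar. if v \<in> Vbar - A then signed v A (lookup (R.mult_op cubes v (W
          (insert v A))) b) else 0)"
          using b by (intro sum.cong refl)
            (auto simp: R.mult_op_def lookup_restrict_keys lookup_single_times lookup_W basis_def
              multiples_def)
        also have "\<dots> = (\<Sum>v\<in>Vbar - A. signed v A (lookup (R.mult_op cubes v (W (insert v A))) b))"
          by (rule sum.mono_neutral_cong_right) auto
        finally show ?thesis using A by (simp add: lookup_koszul_diff)
      qed
    qed
  qed
  then show "\<exists>w. koszul_chain Vbar (R.truncated cubes (2 - 1)) (Suc p) w \<and> koszul_diff (R.mult_op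
    cubes) Vbar w = z"
    using chainW by blast
qed


text \<open>Chains have constant coefficients, and different variables are different monomials. So
  the coefficient of the monomial v in the boundary at C - {v} is that of z at C up to sign: the
  differential is injective.\<close>

lemma rbar_exact_0:
  assumes "i \<ge> 1"
  shows "koszul_exact (R.mult_op cubes) Vbar (R.truncated cubes :: int \<Rightarrow> (_ \<Rightarrow>\<^sub>0 'k::field_char_0)
    set) i 0"
  unfolding koszul_exact_def
proof (intro allI impI; elim conjE)
  fix z :: "(nat \<Rightarrow>\<^sub>0 nat) set \<Rightarrow> (nat \<Rightarrow>\<^sub>0 nat) \<Rightarrow>\<^sub>0 'k"
  assume z: "koszul_chain Vbar (R.truncated cubes 0) i z" and cyc: "koszul_diff (R.mult_op cubes)
    Vbar z = (\<lambda>_. 0)"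
  have z0: "lookup (z C) m = 0" if "m \<noteq> 0" for C m
    using z that by (auto simp: koszul_chain_def R.truncated_iff)
  have "z C = 0" for C
  proof (rule ccontr)
    assume nz: "z C \<noteq> 0"
    then have C: "C \<subseteq> Vbar" "card C = i" using z by (auto simp: koszul_chain_def)
    with assms have "C \<noteq> {}" by auto
    then obtain v A where A: "C = insert v A" "v \<notin> A" using mk_disjoint_insert by (metis ex_in_conv)
    have v: "v \<in> R.reduced cubes" using A C by (auto simp: Vbar_eq)
    have "0 = lookup (koszul_diff (R.mult_op cubes) Vbar z A) v" using cyc by simp
    also have "\<dots> = (\<Sum>u\<in>Vbar - A. signed u A (lookup (R.mult_op cubes u (z (insert u A))) v))"
      by (rule lookup_koszul_diff) (use A C in auto)
    also have "\<dots> = (\<Sum>u\<in>Vbar - A. if u = v then signed v A (lookup (z C) 0) else 0)"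
    proof (rule sum.cong[OF refl])
      fix u
      have "b = 0 \<longleftrightarrow> u = v" if "v = u + b" for b using that by auto
      then show "signed u A (lookup (R.mult_op cubes u (z (insert u A))) v) =
          (if u = v then signed v A (lookup (z C) 0) else 0)"
        using v A(1) z0 by (auto simp: R.mult_op_def lookup_restrict_keys lookup_single_times
          dest: spec[of _ 0])
    qed
    also have "\<dots> = signed v A (lookup (z C) 0)" using A C by simp
    finally have "lookup (z C) 0 = 0" by simp
    then have "z C = 0" using z0 by (intro poly_mapping_eqI) (metis lookup_zero)
    with nz show False by simp
  qed
  then have "z = (\<lambda>_. 0)" by auto
  then show "\<exists>w. koszul_chain Vbar (R.truncated cubes (0 - 1)) (Suc i) w \<and> koszul_diff (R.mult_op
    cubes) Vbar w = z"
    using cyc by (intro exI[of _ "\<lambda>_. 0"]) (simp add: koszul_chain_def R.truncated_def)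
qed

text \<open>The component is spanned by the variables in Vbar acting on 1, so each term of z {}
  lifts to the singleton of its own monomial.\<close>

lemma rbar_exact_1:
  "koszul_exact (R.mult_op cubes) Vbar (R.truncated cubes :: int \<Rightarrow> (_ \<Rightarrow>\<^sub>0 'k::field_char_0) set) 0 1"
  unfolding koszul_exact_def
proof (intro allI impI; elim conjE)
  fix z :: "(nat \<Rightarrow>\<^sub>0 nat) set \<Rightarrow> (nat \<Rightarrow>\<^sub>0 nat) \<Rightarrow>\<^sub>0 'k"
  assume z: "koszul_chain Vbar (R.truncated cubes 1) 0 z"
  define w where "w C = (if \<exists>v\<in>Vbar. C = {v} then
    single 0 (lookup (z {}) (the_elem C)) else 0 :: (nat \<Rightarrow>\<^sub>0 nat) \<Rightarrow>\<^sub>0 'k)" for C :: "(nat \<Rightarrow>\<^sub>0 nat) set"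
  have w_chain: "koszul_chain Vbar (R.truncated cubes (1 - 1)) (Suc 0) w"
    unfolding koszul_chain_def
  proof (intro allI conjI impI)
    fix C
    show "w C \<in> R.truncated cubes (1 - 1)"
      by (auto simp: w_def R.truncated_iff lookup_single when_def reduced_cubes_iff split: if_splits)
    assume "w C \<noteq> 0"
    then show "C \<subseteq> Vbar" "card C = Suc 0" by (auto simp: w_def split: if_splits)
  qed
  have zk: "keys (z {}) \<subseteq> Vbar"
    using z by (auto simp: koszul_chain_def R.truncated_def Vbar_eq)
  have "koszul_diff (R.mult_op cubes) Vbar w A = z A" for A
  proof (cases "A = {}")
    case False
    then have "z A = 0" using z finite_subset_Vbar unfolding koszul_chain_def by (metis card_eq_0_iff)
    moreover have "w (insert v A) = 0" if "v \<notin> A" for v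
      using False that by (auto simp: w_def)
    then have "koszul_diff (R.mult_op cubes) Vbar w A = 0"
      by (auto simp: koszul_diff_def additive.zero[OF R.additive_mult_op] intro!: sum.neutral)
    ultimately show ?thesis by simp
  next
    case True
    have "koszul_diff (R.mult_op cubes) Vbar w {} = (\<Sum>v\<in>Vbar. single v (lookup (z {}) v))"
      unfolding koszul_diff_def
    proof (simp, rule sum.cong[OF refl])
      fix v assume "v \<in> Vbar"
      then have "w {v} = single 0 (lookup (z {}) v)" "v \<in> R.reduced cubes"
        by (auto simp: w_def Vbar_eq)
      then show "signed v {} (R.mult_op cubes v (w {v})) = single v (lookup (z {}) v)"
        by (intro poly_mapping_eqI)
          (auto simp: signed_def R.mult_op_def mult_single lookup_restrict_keys lookup_single when_def)
    qed
    also have "\<dots> = (\<Sum>v\<in>keys (z {}). single v (lookup (z {}) v))"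
      using zk by (intro sum.mono_neutral_right) (auto simp: in_keys_iff)
    also have "\<dots> = z {}" by (rule poly_mapping_sum_singles[symmetric])
    finally show ?thesis using True by simp
  qed
  then show "\<exists>w. koszul_chain Vbar (R.truncated cubes (1 - 1)) (Suc 0) w \<and> koszul_diff (R.mult_op
    cubes) Vbar w = z"
    using w_chain by blast
qed

text \<open>The positions left out are k = i = 0, where the generator 1 sits, k = 1 with i \<ge> 1,
  the linear strand, and k = 2 with i \<ge> 7.\<close>

theorem veronese_koszul_exact:
  assumes "k < 0 \<or> k \<ge> 3 \<or> k = 0 \<and> i \<ge> 1 \<or> k = 1 \<and> i = 0 \<or> k = 2 \<and> i \<le> 6"
  shows "koszul_exact (\<lambda>v p. single v 1 * p) (veronese_vars 3 3)
    (veronese_module 3 3 :: int \<Rightarrow> (nat, 'k::field_char_0) mvpoly set) i k"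
proof -
  have "koszul_exact (R.mult_op cubes) Vbar (R.truncated cubes :: int \<Rightarrow> (_ \<Rightarrow>\<^sub>0 'k) set) i k"
  proof (cases "k < 0 \<or> k \<ge> 3")
    case True
    have "m \<notin> monomials {..3} (3 * k)" if "m \<in> R.reduced cubes" for m
    proof -
      \<comment> \<open>For k \<ge> 3 the degree 3k is at least 9, while a reduced monomial has
        degree at most 8.\<close>
      have "m \<notin> basis (3 * k)" using True by (auto simp: basis_iff)
      with that show ?thesis by (auto simp: basis_def)
    qed
    then have "R.truncated cubes k \<subseteq> {0 :: _ \<Rightarrow>\<^sub>0 'k}"
      by (force simp: R.truncated_iff intro: poly_mapping_eqI)
    moreover have "(0 :: _ \<Rightarrow>\<^sub>0 'k) \<in> R.truncated cubes (k - 1)" by (simp add: R.truncated_def)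
    ultimately show ?thesis by (rule koszul_exact_trivial) (rule R.additive_mult_op)
  next
    case False
    with assms rbar_exact_0 rbar_exact_1 rbar_exact_2 show ?thesis by auto
  qed
  then have "koszul_exact (R.mult_op {}) (veronese_vars 3 3) (R.truncated {} :: int \<Rightarrow> (_ \<Rightarrow>\<^sub>0 'k) set) i k"
    unfolding Vbar_def by (subst (asm) R.koszul_exact_reduce[OF order_refl])
  moreover have "R.truncated {} = (veronese_module 3 3 :: int \<Rightarrow> (_ \<Rightarrow>\<^sub>0 'k) set)"
    by (simp add: fun_eq_iff R.truncated_def veronese_module_def sections_def forms_def)
      (simp add: mult.commute)
  moreover have "R.mult_op {} = (\<lambda>v p. single v 1 * p :: _ \<Rightarrow>\<^sub>0 'k)"
    by (simp add: fun_eq_iff R.mult_op_def)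
  ultimately show ?thesis by simp
qed

section \<open>Free modules\<close>

lemma subgroup_add_forms: "subgroup_add (forms V k :: ('v, 'k::ab_group_add) mvpoly set)"
proof -
  have "a + b \<in> forms V k" if "a \<in> forms V k" "b \<in> forms V k" for a b :: "('v, 'k) mvpoly"
    using keys_add[of a b] that unfolding forms_def by blast
  moreover have "- a \<in> forms V k" if "a \<in> forms V k" for a :: "('v, 'k) mvpoly"
    using that by (simp add: forms_def in_keys_iff subset_iff)
  moreover have "(0 :: ('v, 'k) mvpoly) \<in> forms V k" by (simp add: forms_def)
  ultimately show ?thesis unfolding subgroup_add_def by blast
qed

lemma forms_times: "p \<in> forms V a \<Longrightarrow> q \<in> forms V b \<Longrightarrow> p * q \<in> forms V (a + b)"
  using keys_mult[of p q] monomials_add unfolding forms_def by blast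

lemma forms_single: "m \<in> monomials V k \<Longrightarrow> single m c \<in> forms V k"
  by (simp add: forms_def)

lemma forms_const: "single 0 c \<in> forms V 0"
  by (simp add: forms_single)

lemma forms_one: "(1 :: ('v, 'k::comm_ring_1) mvpoly) \<in> forms V 0"
  by (metis forms_const single_one)

definition pvar :: "'v \<Rightarrow> ('v, 'k::comm_ring_1) mvpoly" where
  "pvar v = single (single v 1) 1"

lemma pvar_forms: "v \<in> V \<Longrightarrow> pvar v \<in> forms V 1"
  unfolding pvar_def by (rule forms_single) (simp add: monomials_def)

lemma lookup_pvar_times_0: "lookup (pvar v * p) 0 = 0"
proof -
  have "0 \<noteq> single v (1::nat) + b" for b
    by (metis add_is_0 lookup_add lookup_single_eq lookup_zero one_neq_zero)
  then show ?thesis by (simp add: pvar_def lookup_single_times)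
qed

lemma forms_lookup_degree:
  "p \<in> forms V k \<Longrightarrow> lookup p m \<noteq> 0 \<Longrightarrow> int (total_degree m) = k"
  by (auto simp: forms_def monomials_def in_keys_iff)

lemma forms_0_eq:
  assumes "p \<in> forms V 0" shows "p = single 0 (lookup p 0)"
proof (rule poly_mapping_eqI)
  fix m show "lookup p m = lookup (single 0 (lookup p 0)) m"
    using forms_lookup_degree[OF assms, of m] by (auto simp: lookup_single when_def)
qed

text \<open>Here the variables form the regular sequence, on the polynomial ring itself. Dividing by
  all of them leaves the field in degree 0 and no exterior generators, so homology survives only at
  i = k = 0. The hypothesis on the constant term settles that position.\<close>

lemma forms_koszul_exact:
  fixes z :: "'v::linorder set \<Rightarrow> ('v, 'k::field_char_0) mvpoly"
  assumes V: "finite V" and z: "koszul_chain V (forms V k) i z" and cyc: "koszul_diff (\<lambda>v p. pvar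
    v * p) V z = (\<lambda>_. 0)"
    and const: "lookup (z {}) 0 = 0"
  shows "\<exists>w. koszul_chain V (forms V (k - 1)) (Suc i) w \<and> koszul_diff (\<lambda>v p. pvar v * p) V w = z"
proof -
  interpret M: monomial_module "\<lambda>v. single v (Suc 0)" "monomials V" V V "TYPE('k)"
  proof
    fix v m k assume "v \<in> V"
    then show "single v (Suc 0) + m \<in> monomials V (k + 1) \<longleftrightarrow> m \<in> monomials V k"
      using monomials_add_iff[of "single v (Suc 0)" V 1 m k] by (simp add: monomials_def add.commute)
  next
    fix y y' :: 'v and m assume "y \<noteq> y'" "single y (Suc 0) + m \<in> multiples (single y' (Suc 0))"
    then show "m \<in> multiples (single y' (Suc 0))"
      by (simp add: multiples_single_iff lookup_add lookup_single)
  qed (simp_all add: V)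
  have truncated: "M.truncated {} = forms V" and mult_op: "M.mult_op {} = (\<lambda>v p. pvar v * p ::
    ('v, 'k) mvpoly)"
    by (intro ext, unfold M.truncated_def M.mult_op_def M.reduced_empty forms_def pvar_def, simp_all)
  have reduced: "m = 0" if "m \<in> monomials V k" "m \<in> M.reduced V" for m k
  proof (rule poly_mapping_eqI)
    fix x show "lookup m x = lookup 0 x"
      using that by (cases "x \<in> V") (auto simp: M.reduced_def multiples_single_iff monomials_def
        in_keys_iff subset_iff)
  qed
  consider "i = 0" "k = 0" | "i \<noteq> 0" | "i = 0" "k \<noteq> 0" by fast
  then show ?thesis
  proof cases
    case 1
    have "z A = 0" for A
    proof (cases "A = {}")
      case True
      have "z {} \<in> forms V 0" using z 1 by (simp add: koszul_chain_def)
      then show ?thesis using forms_0_eq[of "z {}"] const True by simp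
    next
      case False
      show ?thesis
      proof (rule ccontr)
        assume "z A \<noteq> 0"
        then have "A \<subseteq> V" "card A = 0" using z 1 by (auto simp: koszul_chain_def)
        then show False using False V finite_subset by fastforce
      qed
    qed
    then show ?thesis using cyc by (intro exI[of _ "\<lambda>_. 0"])
        (auto simp: koszul_chain_def fun_eq_iff forms_def koszul_diff_def)
  next
    case 2
    have "koszul_exact (M.mult_op V) (V - V) (M.truncated V) i k"
      unfolding koszul_exact_def
    proof (intro allI impI; elim conjE)
      fix z :: "'v set \<Rightarrow> ('v, 'k) mvpoly"
      assume "koszul_chain (V - V) (M.truncated V k) i z"
      then have "z = (\<lambda>_. 0)" using 2 by (fastforce simp: koszul_chain_def)
      then show "\<exists>w. koszul_chain (V - V) (M.truncated V (k - 1)) (Suc i) w \<and> koszul_diff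
        (M.mult_op V) (V - V) w = z"
        by (intro exI[of _ "\<lambda>_. 0"]) (auto simp: koszul_chain_def M.truncated_def koszul_diff_def)
    qed
    then have "koszul_exact (M.mult_op {}) V (M.truncated {}) i k" using M.koszul_exact_reduce[of
      V] by blast
    then show ?thesis using z cyc unfolding koszul_exact_def truncated mult_op by blast
  next
    case 3
    have "koszul_exact (M.mult_op V) (V - V) (M.truncated V :: int \<Rightarrow> ('v, 'k) mvpoly set) i k"
    proof (rule koszul_exact_trivial)
      show "M.truncated V k \<subseteq> {0 :: ('v, 'k) mvpoly}"
      proof
        fix p :: "('v, 'k) mvpoly" assume p: "p \<in> M.truncated V k"
        have "lookup p m = 0" for m
        proof (rule ccontr)
          assume "lookup p m \<noteq> 0"
          then have "m \<in> monomials V k" "m \<in> M.reduced V" using p by (auto simp: M.truncated_iff)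
          with reduced have "m \<in> monomials V k" "m = 0" by blast+
          with 3 show False by (simp add: monomials_def)
        qed
        then show "p \<in> {0}" by (auto intro: poly_mapping_eqI)
      qed
    qed (simp_all add: M.truncated_def M.additive_mult_op)
    then have "koszul_exact (M.mult_op {}) V (M.truncated {}) i k" using M.koszul_exact_reduce[of
      V] by blast
    then show ?thesis using z cyc unfolding koszul_exact_def truncated mult_op by blast
  qed
qed

section \<open>Graded components of free modules\<close>

definition free_deg :: "'v set \<Rightarrow> nat \<Rightarrow> (nat \<Rightarrow> int) \<Rightarrow> int \<Rightarrow> (nat \<Rightarrow> ('v, 'k::zero) mvpoly) set" where
  "free_deg V n sh k = {u. (\<forall>e<n. u e \<in> forms V (k - sh e)) \<and> (\<forall>e\<ge>n. u e = 0)}"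

definition vec_act :: "('v, 'k::comm_ring_1) mvpoly \<Rightarrow> (nat \<Rightarrow> ('v, 'k) mvpoly) \<Rightarrow> nat \<Rightarrow> ('v, 'k)
  mvpoly" where
  "vec_act p u = (\<lambda>e. p * u e)"

lemma additive_vec_act: "additive (vec_act p)"
  by unfold_locales (simp add: vec_act_def fun_eq_iff distrib_left)

lemma subgroup_add_free_deg: "subgroup_add (free_deg V n sh k :: (nat \<Rightarrow> ('v, 'k::ab_group_add)
  mvpoly) set)"
proof -
  have "a + b \<in> free_deg V n sh k" if "a \<in> free_deg V n sh k" "b \<in> free_deg V n sh k" for a b ::
    "nat \<Rightarrow> ('v, 'k) mvpoly"
    using that by (simp add: free_deg_def subgroup_add_add[OF subgroup_add_forms])
  moreover have "- a \<in> free_deg V n sh k" if "a \<in> free_deg V n sh k" for a :: "nat \<Rightarrow> ('v, 'k) mvpoly"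
    using that by (simp add: free_deg_def subgroup_add_minus[OF subgroup_add_forms])
  ultimately show ?thesis
    unfolding subgroup_add_def by (simp add: free_deg_def subgroup_add_zero[OF subgroup_add_forms])
qed

lemma vec_act_closed: "p \<in> forms V a \<Longrightarrow> u \<in> free_deg V n sh k \<Longrightarrow> vec_act p u \<in> free_deg V n sh (a + k)"
  using forms_times[of p V a] by (auto simp: free_deg_def vec_act_def diff_add_eq add_diff_eq[symmetric])

lemma sum_fun_apply: "(\<Sum>i\<in>I. f i) x = (\<Sum>i\<in>I. f i x)"
  by (induction I rule: infinite_finite_induct) auto

lemma fun_no_2_torsion:
  fixes u :: "'i \<Rightarrow> 'a \<Rightarrow>\<^sub>0 'k::field_char_0"
  assumes "u + u = 0" shows "u = 0"
proof
  fix x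
  have "u x + u x = 0" using fun_cong[OF assms, of x] by simp
  from poly_mapping_no_2_torsion[OF this] show "u x = 0 x" by simp
qed

lemma free_deg_koszul_exact:
  fixes z :: "'v::linorder set \<Rightarrow> nat \<Rightarrow> ('v, 'k::field_char_0) mvpoly"
  assumes V: "finite V" and z: "koszul_chain V (free_deg V n sh k) i z" and cyc: "koszul_diff (\<lambda>v.
    vec_act (pvar v)) V z = (\<lambda>_. 0)"
    and const: "\<And>e. lookup (z {} e) 0 = 0"
  shows "\<exists>w. koszul_chain V (free_deg V n sh (k - 1)) (Suc i) w \<and> koszul_diff (\<lambda>v. vec_act (pvar
    v)) V w = z"
proof -
  have comp: "koszul_diff (\<lambda>v. vec_act (pvar v)) V z A e = koszul_diff (\<lambda>v p. pvar v * p) V (\<lambda>A. z A e) A"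
    for z :: "'v set \<Rightarrow> nat \<Rightarrow> ('v, 'k) mvpoly" and A e
  proof -
    have "additive (\<lambda>u :: nat \<Rightarrow> ('v, 'k) mvpoly. u e)" by unfold_locales simp
    from koszul_diff_hom[OF this, where T = "\<lambda>v. vec_act (pvar v)" and z = z] show ?thesis by
      (simp add: vec_act_def)
  qed
  have "\<exists>w. koszul_chain V (forms V (k - 1 - sh e)) (Suc i) w \<and> koszul_diff (\<lambda>v p. pvar v * p) V w
    = (\<lambda>A. z A e)"
    if "e < n" for e
  proof -
    have "koszul_chain V (forms V (k - sh e)) i (\<lambda>A. z A e)"
      unfolding koszul_chain_def
    proof (intro allI conjI impI)
      fix A
      have "z A \<in> free_deg V n sh k" using z by (simp add: koszul_chain_def)
      then show "z A e \<in> forms V (k - sh e)" using that by (simp add: free_deg_def)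
      assume "z A e \<noteq> 0"
      then have "z A \<noteq> 0" by auto
      then show "A \<subseteq> V" "card A = i" using z unfolding koszul_chain_def by blast+
    qed
    moreover have "koszul_diff (\<lambda>v p. pvar v * p) V (\<lambda>A. z A e) = (\<lambda>_. 0)"
      using cyc comp[of z _ e] by (auto simp: fun_eq_iff)
    ultimately have "\<exists>w. koszul_chain V (forms V (k - sh e - 1)) (Suc i) w \<and> koszul_diff (\<lambda>v p.
      pvar v * p) V w = (\<lambda>A. z A e)"
      using const V by (intro forms_koszul_exact) auto
    moreover have "k - sh e - 1 = k - 1 - sh e" by simp
    ultimately show ?thesis by metis
  qed
  then obtain w where w: "\<And>e. e < n \<Longrightarrow> koszul_chain V (forms V (k - 1 - sh e)) (Suc i) (w e) \<and>
      koszul_diff (\<lambda>v p. pvar v * p) V (w e) = (\<lambda>A. z A e)"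
    by metis
  define w' where "w' A e = (if e < n then w e A else 0)" for A e
  have "koszul_diff (\<lambda>v. vec_act (pvar v)) V w' A e = z A e" for A e
  proof (cases "e < n")
    case True
    then show ?thesis using w[OF True] unfolding comp by (simp add: w'_def)
  next
    case False
    then have "z A e = 0" using z by (auto simp: koszul_chain_def free_deg_def)
    with False show ?thesis unfolding comp by (simp add: w'_def koszul_diff_def)
  qed
  moreover have "koszul_chain V (free_deg V n sh (k - 1)) (Suc i) w'"
    unfolding koszul_chain_def
  proof (intro allI conjI impI)
    fix A
    show "w' A \<in> free_deg V n sh (k - 1)" using w by (auto simp: free_deg_def w'_def koszul_chain_def)
    assume "w' A \<noteq> 0"
    then obtain e where "e < n" "w e A \<noteq> 0" by (auto simp: w'_def fun_eq_iff split: if_splits)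
    then show "A \<subseteq> V" "card A = Suc i" using w by (auto simp: koszul_chain_def)
  qed
  ultimately show ?thesis by blast
qed

section \<open>Syzygies\<close>

definition gen_map :: "(('v, 'k::zero) mvpoly \<Rightarrow> 'm \<Rightarrow> 'm::ab_group_add) \<Rightarrow> nat \<Rightarrow> (nat \<Rightarrow> 'm) \<Rightarrow>
    (nat \<Rightarrow> ('v, 'k) mvpoly) \<Rightarrow> 'm" where
  "gen_map act n g u = (\<Sum>e<n. act (u e) (g e))"

definition relations :: "'v set \<Rightarrow> (('v, 'k::zero) mvpoly \<Rightarrow> 'm \<Rightarrow> 'm::ab_group_add) \<Rightarrow> nat \<Rightarrow> (nat \<Rightarrow>
  int) \<Rightarrow> (nat \<Rightarrow> 'm) \<Rightarrow>
    int \<Rightarrow> (nat \<Rightarrow> ('v, 'k) mvpoly) set" where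
  "relations V act n sh g k = {u \<in> free_deg V n sh k. gen_map act n g u = 0}"

definition generates :: "'v set \<Rightarrow> (('v, 'k::zero) mvpoly \<Rightarrow> 'm \<Rightarrow> 'm::ab_group_add) \<Rightarrow> (int \<Rightarrow> 'm set) \<Rightarrow>
    nat \<Rightarrow> (nat \<Rightarrow> int) \<Rightarrow> (nat \<Rightarrow> 'm) \<Rightarrow> bool" where
  "generates V act N n sh g \<longleftrightarrow> (\<forall>e<n. g e \<in> N (sh e)) \<and> (\<forall>k. N k \<subseteq> gen_map act n g ` free_deg V n sh k)"

text \<open>Minimality is put as a condition on relations because this is what the exactness of the
  Koszul complex of a free module asks of the chain at the empty set.\<close>

definition minimal_pres :: "'v set \<Rightarrow> (('v, 'k::zero) mvpoly \<Rightarrow> 'm \<Rightarrow> 'm::ab_group_add) \<Rightarrow> (int \<Rightarrow> 'm set) \<Rightarrow>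
    nat \<Rightarrow> (nat \<Rightarrow> int) \<Rightarrow> (nat \<Rightarrow> 'm) \<Rightarrow> bool" where
  "minimal_pres V act N n sh g \<longleftrightarrow> generates V act N n sh g \<and>
     (\<forall>k. \<forall>u\<in>relations V act n sh g k. \<forall>e. lookup (u e) 0 = 0)"

definition unit_vec :: "nat \<Rightarrow> nat \<Rightarrow> ('v, 'k::comm_ring_1) mvpoly" where
  "unit_vec e = (\<lambda>e'. if e' = e then 1 else 0)"

lemma unit_vec_free_deg: "e < n \<Longrightarrow> sh e = k \<Longrightarrow> unit_vec e \<in> free_deg V n sh k"
  by (auto simp: free_deg_def unit_vec_def forms_one subgroup_add_zero[OF subgroup_add_forms])

definition component :: "nat \<Rightarrow> (nat \<Rightarrow> int) \<Rightarrow> int \<Rightarrow> (nat \<Rightarrow> ('v, 'k::comm_ring_1) mvpoly) \<Rightarrow> nat \<Rightarrow>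
  ('v, 'k) mvpoly" where
  "component n sh k u = (\<lambda>e. restrict_keys {m. int (total_degree m) + sh e = k} (u e))"

lemma restrict_keys_zero [simp]: "restrict_keys Q 0 = 0"
  by (simp add: restrict_keys_def)

lemma component_free_deg: "u \<in> free_mod V n \<Longrightarrow> component n sh k u \<in> free_deg V n sh k"
  by (auto simp: free_mod_def free_deg_def component_def forms_def monomials_def polys_def
    keys_restrict_keys restrict_keys_zero)

lemma free_deg_free_mod: "u \<in> free_deg V n sh k \<Longrightarrow> u \<in> free_mod V n"
  by (auto simp: free_mod_def free_deg_def forms_def monomials_def polys_def)

definition component_support :: "nat \<Rightarrow> (nat \<Rightarrow> int) \<Rightarrow> (nat \<Rightarrow> ('v, 'k::comm_ring_1) mvpoly) \<Rightarrow> int set" where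
  "component_support n sh u = (\<Union>e<n. (\<lambda>m. int (total_degree m) + sh e) ` keys (u e))"

lemma finite_component_support: "finite (component_support n sh u)"
  by (simp add: component_support_def)

lemma sum_component:
  assumes "u \<in> free_mod V n" "finite K" "component_support n sh u \<subseteq> K"
  shows "(\<Sum>k\<in>K. component n sh k u) = u"
proof (rule ext, rule poly_mapping_eqI)
  fix e m
  have "lookup ((\<Sum>k\<in>K. component n sh k u) e) m =
      (\<Sum>k\<in>K. if int (total_degree m) + sh e = k then lookup (u e) m else 0)"
    by (simp add: sum_fun_apply lookup_sum component_def lookup_restrict_keys)
  also have "\<dots> = lookup (u e) m"
  proof (cases "lookup (u e) m = 0")
    case False
    then have "e < n" using assms(1) by (auto simp: free_mod_def not_less[symmetric])
    with False have "int (total_degree m) + sh e \<in> K"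
      using assms(3) unfolding component_support_def by (force simp: in_keys_iff)
    then show ?thesis using assms(2) by simp
  next
    case True
    then show ?thesis by (simp only: if_cancel sum.neutral_const)
  qed
  finally show "lookup ((\<Sum>k\<in>K. component n sh k u) e) m = lookup (u e) m" .
qed

text \<open>The axioms are chosen so that the relations of such a module form such a module again,
  and the construction can be iterated. Finite-dimensional components that vanish in low degrees
  give finite generation; \<open>N_direct\<close> makes the sum of the components direct.\<close>

locale graded_module =
  fixes V :: "'v::linorder set" and act :: "('v, 'k::field_char_0) mvpoly \<Rightarrow> 'm::ab_group_add \<Rightarrow> 'm"
    and N :: "int \<Rightarrow> 'm set"
  assumes finite_V: "finite V"
    and act_add_left: "act (p + q) m = act p m + act q m"
    and act_add_right: "act p (m + m') = act p m + act p m'"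
    and act_mult: "act (p * q) m = act p (act q m)"
    and act_one: "act 1 m = m"
    and subgroup_add_N: "subgroup_add (N k)"
    and act_closed: "p \<in> forms V a \<Longrightarrow> m \<in> N k \<Longrightarrow> act p m \<in> N (a + k)"
    and N_direct: "finite I \<Longrightarrow> (\<And>k. k \<in> I \<Longrightarrow> x k \<in> N k) \<Longrightarrow> sum x I = 0 \<Longrightarrow> k \<in> I \<Longrightarrow> x k = 0"
    and N_span: "\<exists>G. finite G \<and> N k \<subseteq> module.span (\<lambda>c. act (single 0 c)) G"
    and N_bounded: "\<exists>k0. \<forall>k<k0. N k \<subseteq> {0}"
begin

lemma additive_act: "additive (act p)"
  by unfold_locales (rule act_add_right)

lemma act_zero_left: "act 0 m = 0"
  using act_add_left[of 0 0 m] by simp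

lemma act_zero_right: "act p 0 = 0"
  by (rule additive.zero[OF additive_act])

sublocale scalar: vector_space "\<lambda>c. act (single 0 c)"
  by unfold_locales
    (simp_all add: act_add_right single_add act_add_left act_one mult_single flip: act_mult)

lemma no_2_torsion: "a + a = 0 \<Longrightarrow> a = (0::'m)"
proof -
  assume "a + a = 0"
  have "a = act (single 0 (1/2)) (a + a)"
    using act_one[of a] by (simp add: act_add_right flip: act_add_left single_add)
  then show "a = 0" by (simp add: \<open>a + a = 0\<close> act_zero_right)
qed

lemma gen_map_add: "gen_map act n g (u + w) = gen_map act n g u + gen_map act n g w"
  by (simp add: gen_map_def act_add_left sum.distrib)

lemma additive_gen_map: "additive (gen_map act n g)"
  by unfold_locales (rule gen_map_add)

lemma gen_map_vec_act: "gen_map act n g (vec_act p u) = act p (gen_map act n g u)"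
  by (simp add: gen_map_def vec_act_def act_mult additive.sum[OF additive_act])

lemma gen_map_closed:
  assumes "\<forall>e<n. g e \<in> N (sh e)" "u \<in> free_deg V n sh k" shows "gen_map act n g u \<in> N k"
  unfolding gen_map_def
proof (rule subgroup_add_sum[OF subgroup_add_N])
  fix e assume "e \<in> {..<n}"
  then have "u e \<in> forms V (k - sh e)" "g e \<in> N (sh e)" using assms by (auto simp: free_deg_def)
  from act_closed[OF this] show "act (u e) (g e) \<in> N k" by simp
qed

lemma gen_map_unit_vec: "e < n \<Longrightarrow> gen_map act n g (unit_vec e) = g e"
  by (simp add: gen_map_def unit_vec_def if_distrib[of "\<lambda>p. act p _"] act_one act_zero_left cong: if_cong)

text \<open>Dimension shifting, the connecting map of the Tor sequence made explicit. Minimality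
  gives z a primitive w in the free module. The image of w in N is a cycle, hence the boundary of
  some y, and a lift u of y corrects w to w - du, which consists of relations and still bounds
  z.\<close>

lemma kernel_exact:
  assumes pres: "minimal_pres V act N n sh g" and ex: "koszul_exact (\<lambda>v. act (pvar v)) V N (Suc i)
    (k - 1)"
  shows "koszul_exact (\<lambda>v. vec_act (pvar v)) V (relations V act n sh g) i k"
  unfolding koszul_exact_def
proof (intro allI impI; elim conjE)
  fix z :: "'v set \<Rightarrow> nat \<Rightarrow> ('v, 'k) mvpoly"
  assume z: "koszul_chain V (relations V act n sh g k) i z" and cyc: "koszul_diff (\<lambda>v. vec_act
    (pvar v)) V z = (\<lambda>_. 0)"
  let ?h = "gen_map act n g" and ?dF = "koszul_diff (\<lambda>v. vec_act (pvar v)) V" and ?dN =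
    "koszul_diff (\<lambda>v. act (pvar v)) V"
  have g: "\<forall>e<n. g e \<in> N (sh e)" using pres by (simp add: minimal_pres_def generates_def)
  have zk: "z A \<in> relations V act n sh g k" for A using z by (simp add: koszul_chain_def)
  have h_d: "?h (?dF w A) = ?dN (\<lambda>A. ?h (w A)) A" for w A
    by (rule koszul_diff_hom[OF additive_gen_map]) (rule gen_map_vec_act)
  have "koszul_chain V (free_deg V n sh k) i z" using z by (auto simp: koszul_chain_def relations_def)
  moreover have "lookup (z {} e) 0 = 0" for e
    using pres zk[of "{}"] by (simp add: minimal_pres_def)
  ultimately obtain w where w: "koszul_chain V (free_deg V n sh (k - 1)) (Suc i) w" and dw: "?dF w = z"
    using free_deg_koszul_exact[OF finite_V _ cyc] by blast
  have "koszul_chain V (N (k - 1)) (Suc i) (\<lambda>A. ?h (w A))"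
    using w gen_map_closed[OF g] additive.zero[OF additive_gen_map] unfolding koszul_chain_def by metis
  moreover have "?dN (\<lambda>A. ?h (w A)) = (\<lambda>_. 0)"
    using h_d[of w] zk unfolding dw by (simp add: fun_eq_iff relations_def)
  ultimately obtain y where y: "koszul_chain V (N (k - 1 - 1)) (Suc (Suc i)) y" and dy: "?dN y =
    (\<lambda>A. ?h (w A))"
    using ex by (auto simp: koszul_exact_def)
  have "\<exists>u\<in>free_deg V n sh (k - 1 - 1). ?h u = y A \<and> (y A = 0 \<longrightarrow> u = 0)" for A
  proof (cases "y A = 0")
    case True
    then show ?thesis
      by (intro bexI[of _ 0]) (simp_all add: additive.zero[OF additive_gen_map]
        subgroup_add_zero[OF subgroup_add_free_deg])
  next
    case False
    have "y A \<in> N (k - 1 - 1)" using y by (simp add: koszul_chain_def)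
    then show ?thesis using pres False unfolding minimal_pres_def generates_def by fastforce
  qed
  then obtain u where u: "\<And>A. u A \<in> free_deg V n sh (k - 1 - 1)" "\<And>A. ?h (u A) = y A" "\<And>A. y A = 0
    \<Longrightarrow> u A = 0"
    by metis
  have u_chain: "koszul_chain V (free_deg V n sh (k - 1 - 1)) (Suc (Suc i)) u"
    using u y unfolding koszul_chain_def by metis
  have du_chain: "koszul_chain V (free_deg V n sh (k - 1)) (Suc i) (?dF u)"
  proof (rule koszul_diff_chain[OF finite_V u_chain subgroup_add_free_deg])
    show "vec_act (pvar v) m \<in> free_deg V n sh (k - 1)" if "v \<in> V" "m \<in> free_deg V n sh (k - 1 -
      1)" for v m
      using vec_act_closed[OF pvar_forms that(2), of v] that(1) by simp
  qed (rule additive_vec_act)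
  define w' where "w' A = w A - ?dF u A" for A
  have "koszul_chain V (relations V act n sh g (k - 1)) (Suc i) w'"
    unfolding koszul_chain_def
  proof (intro allI conjI impI)
    fix A
    have "?h (w' A) = 0"
      by (simp add: w'_def additive.diff[OF additive_gen_map] h_d u(2) dy)
    moreover have "w' A \<in> free_deg V n sh (k - 1)"
      unfolding w'_def using w du_chain by (intro subgroup_add_diff[OF subgroup_add_free_deg])
        (auto simp: koszul_chain_def)
    ultimately show "w' A \<in> relations V act n sh g (k - 1)" by (simp add: relations_def)
    assume "w' A \<noteq> 0"
    then have "w A \<noteq> 0 \<or> ?dF u A \<noteq> 0" by (auto simp: w'_def)
    then show "A \<subseteq> V" "card A = Suc i" using w du_chain unfolding koszul_chain_def by blast+
  qed
  moreover have "?dF w' = z"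
  proof
    fix A
    have "?dF (?dF u) A = 0"
    proof (rule koszul_diff_koszul_diff_zero[OF finite_V])
      show "additive (vec_act p)" for p :: "('v, 'k) mvpoly" by (rule additive_vec_act)
      show "vec_act (pvar v) (vec_act (pvar w) m) = vec_act (pvar w) (vec_act (pvar v) m)" for v w
        and m :: "nat \<Rightarrow> ('v, 'k) mvpoly"
        by (simp add: vec_act_def mult.left_commute)
    qed (rule fun_no_2_torsion)
    moreover have "?dF w' A = ?dF w A - ?dF (?dF u) A"
      unfolding w'_def by (rule koszul_diff_diff) (rule additive_vec_act)
    ultimately show "?dF w' A = z A" using dw by simp
  qed
  ultimately show "\<exists>w. koszul_chain V (relations V act n sh g (k - 1)) (Suc i) w \<and> ?dF w = z" by blast
qed

text \<open>A chain of exterior degree 0 is always a cycle, so exactness there says that the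
  variables carry the component at k - 1 onto the one at k.\<close>

lemma exact_0_decompose:
  assumes "koszul_exact (\<lambda>v. act (pvar v)) V N 0 k" "x \<in> N k"
  shows "\<exists>y. (\<forall>v. y v \<in> N (k - 1)) \<and> x = (\<Sum>v\<in>V. act (pvar v) (y v))"
proof -
  define z where "z A = (if A = {} then x else 0)" for A :: "'v set"
  have "koszul_chain V (N k) 0 z"
    using assms(2) by (auto simp: koszul_chain_def z_def subgroup_add_zero[OF subgroup_add_N])
  moreover from this have "koszul_diff (\<lambda>v. act (pvar v)) V z = (\<lambda>_. 0)"
    by (rule koszul_diff_chain_0[OF finite_V]) (rule additive_act)
  ultimately obtain w where w: "koszul_chain V (N (k - 1)) (Suc 0) w" "koszul_diff (\<lambda>v. act (pvar
    v)) V w = z"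
    using assms(1) by (auto simp: koszul_exact_def)
  have "x = koszul_diff (\<lambda>v. act (pvar v)) V w {}" using w(2) by (simp add: z_def)
  also have "\<dots> = (\<Sum>v\<in>V. act (pvar v) (w {v}))" by (simp add: koszul_diff_def signed_def)
  finally show ?thesis using w(1) by (intro exI[of _ "\<lambda>v. w {v}"]) (simp add: koszul_chain_def)
qed

text \<open>If a generator of degree k were a combination of variables times elements of degree k -
  1, its unit vector minus a lift of that combination would be a relation with constant term 1,
  against minimality.\<close>

lemma no_generator:
  assumes pres: "minimal_pres V act N n sh g" and ex: "koszul_exact (\<lambda>v. act (pvar v)) V N 0 k"
    and e: "e < n"
  shows "sh e \<noteq> k"
proof
  assume k: "sh e = k"
  have g: "\<forall>e<n. g e \<in> N (sh e)" and surj: "N (k - 1) \<subseteq> gen_map act n g ` free_deg V n sh (k - 1)"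
    using pres by (simp_all add: minimal_pres_def generates_def)
  obtain y where y: "\<And>v. y v \<in> N (k - 1)" "g e = (\<Sum>v\<in>V. act (pvar v) (y v))"
    using exact_0_decompose[OF ex, of "g e"] g e k by auto
  from y(1) surj have "\<forall>v. \<exists>u\<in>free_deg V n sh (k - 1). gen_map act n g u = y v"
  proof (intro allI)
    fix v
    have "y v \<in> gen_map act n g ` free_deg V n sh (k - 1)" using y(1)[of v] surj by blast
    then show "\<exists>u\<in>free_deg V n sh (k - 1). gen_map act n g u = y v" by auto
  qed
  then obtain u where u: "\<And>v. u v \<in> free_deg V n sh (k - 1)" "\<And>v. gen_map act n g (u v) = y v"
    by metis
  define w where "w = unit_vec e - (\<Sum>v\<in>V. vec_act (pvar v) (u v))"
  have "w \<in> free_deg V n sh k" unfolding w_def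
  proof (intro subgroup_add_diff[OF subgroup_add_free_deg] subgroup_add_sum[OF subgroup_add_free_deg])
    show "unit_vec e \<in> free_deg V n sh k" using unit_vec_free_deg[where sh = sh] e k by blast
    fix v assume "v \<in> V"
    then show "vec_act (pvar v) (u v) \<in> free_deg V n sh k"
      using vec_act_closed[OF pvar_forms[of v V] u(1)[of v]] by simp
  qed
  moreover have "gen_map act n g w = 0"
    by (simp add: w_def additive.diff[OF additive_gen_map] additive.sum[OF additive_gen_map]
      gen_map_unit_vec[OF e]
        gen_map_vec_act u(2) y(2))
  ultimately have "lookup (w e) 0 = 0" using pres by (simp add: minimal_pres_def relations_def)
  moreover have "lookup (w e) 0 = 1"
    by (simp add: w_def unit_vec_def lookup_minus sum_fun_apply lookup_sum vec_act_def
      lookup_pvar_times_0)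
  ultimately show False by simp
qed

lemma gen_map_component:
  assumes g: "\<forall>e<n. g e \<in> N (sh e)" and u: "u \<in> free_mod V n" and h: "gen_map act n g u \<in> N k"
  shows "gen_map act n g (component n sh k u) = gen_map act n g u"
proof -
  let ?h = "gen_map act n g" and ?K = "insert k (component_support n sh u)"
  \<comment> \<open>Subtracting the whole image from the k-th term makes the sum zero, so that
    directness applies; k is inserted because it may lie outside the support.\<close>
  define x where "x l = ?h (component n sh l u) - (if l = k then ?h u else 0)" for l
  have "?h u = (\<Sum>l\<in>?K. ?h (component n sh l u))"
    using sum_component[OF u, of ?K sh] additive.sum[OF additive_gen_map] finite_component_support
      by (metis finite_insert subset_insertI)
  then have "sum x ?K = 0"
    by (simp add: x_def sum_subtractf finite_component_support)
  then have "x k = 0"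
  proof (rule N_direct[rotated 2])
    show "x l \<in> N l" for l
      unfolding x_def using gen_map_closed[OF g component_free_deg[OF u]] h
      by (auto intro!: subgroup_add_diff[OF subgroup_add_N] subgroup_add_zero[OF subgroup_add_N])
  qed (simp_all add: finite_component_support)
  then show ?thesis by (simp add: x_def)
qed

end

section \<open>Free modules and relation modules as graded modules\<close>

lemma subgroup_add_free_mod: "subgroup_add (free_mod V n :: (nat \<Rightarrow> ('v, 'k::ab_group_add) mvpoly) set)"
proof -
  have "a + b \<in> polys V" if "a \<in> polys V" "b \<in> polys V" for a b :: "('v, 'k) mvpoly"
    using keys_add[of a b] that unfolding polys_def by blast
  moreover have "- a \<in> polys V" if "a \<in> polys V" for a :: "('v, 'k) mvpoly"
    using that by (simp add: polys_def in_keys_iff)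
  moreover have "(0 :: ('v, 'k) mvpoly) \<in> polys V" by (simp add: polys_def)
  ultimately show ?thesis unfolding subgroup_add_def by (auto simp: free_mod_def)
qed

lemma forms_direct:
  assumes "finite I" "\<And>k. k \<in> I \<Longrightarrow> x k \<in> forms V (c k)" "inj_on c I" "sum x I = 0" "k \<in> I"
  shows "x k = (0 :: ('v, 'k::ab_group_add) mvpoly)"
proof (rule poly_mapping_eqI, rule ccontr)
  fix m assume "lookup (x k) m \<noteq> lookup (0 :: ('v, 'k) mvpoly) m"
  then have nz: "lookup (x k) m \<noteq> 0" by simp
  have deg: "int (total_degree m) = c l" if "l \<in> I" "lookup (x l) m \<noteq> 0" for l
    using forms_lookup_degree[OF assms(2)] that by blast
  have "0 = (\<Sum>l\<in>I. lookup (x l) m)" using assms(4) by (metis lookup_sum lookup_zero)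
  also have "\<dots> = lookup (x k) m + (\<Sum>l\<in>I - {k}. lookup (x l) m)"
    using assms(1,5) by (rule sum.remove)
  also have "(\<Sum>l\<in>I - {k}. lookup (x l) m) = 0"
  proof (rule sum.neutral, rule ballI, rule ccontr)
    fix l assume l: "l \<in> I - {k}" "lookup (x l) m \<noteq> 0"
    then have "c l = c k" using deg[of l] deg[of k] nz assms(5) by simp
    with l(1) assms(3,5) show False by (auto dest: inj_onD)
  qed
  finally show False using nz by simp
qed

lemma free_deg_direct:
  assumes "finite I" "\<And>k. k \<in> I \<Longrightarrow> x k \<in> free_deg V n sh k" "sum x I = 0" "k \<in> I"
  shows "x k = (0 :: nat \<Rightarrow> ('v, 'k::ab_group_add) mvpoly)"
proof
  fix e
  show "x k e = 0 e"
  proof (cases "e < n")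
    case True
    have "(\<Sum>k\<in>I. x k e) = sum x I e" by (simp add: sum_fun_apply)
    then have "x k e = 0"
      using assms(1,3,4) by (intro forms_direct[where c = "\<lambda>k. k - sh e" and x = "\<lambda>k. x k e" and V = V])
        (use assms(2) True in \<open>auto simp: free_deg_def inj_on_def\<close>)
    then show ?thesis by simp
  next
    case False
    then show ?thesis using assms(2)[OF assms(4)] by (simp add: free_deg_def)
  qed
qed

lemma free_deg_bounded: "\<exists>k0. \<forall>k<k0. (free_deg V n sh k :: (nat \<Rightarrow> ('v, 'k::zero) mvpoly) set) \<subseteq> {0}"
proof (intro exI allI impI subsetI)
  fix k and u :: "nat \<Rightarrow> ('v, 'k) mvpoly"
  assume k: "k < Min (insert 0 (sh ` {..<n}))" and u: "u \<in> free_deg V n sh k"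
  have "u e = 0" for e
  proof (cases "e < n")
    case True
    then have "k - sh e < 0" using k by auto
    then show ?thesis using u True by (auto simp: free_deg_def forms_def)
  qed (use u in \<open>simp add: free_deg_def\<close>)
  then show "u \<in> {0}" by (simp add: fun_eq_iff)
qed

lemma free_deg_span:
  assumes "finite V"
  shows "\<exists>G. finite G \<and> free_deg V n sh k \<subseteq>
    module.span (\<lambda>c. vec_act (single 0 c) :: (nat \<Rightarrow> ('v, 'k::field_char_0) mvpoly) \<Rightarrow> _) G"
proof -
  interpret vector_space "\<lambda>c. vec_act (single 0 c) :: (nat \<Rightarrow> ('v, 'k) mvpoly) \<Rightarrow> _"
    by unfold_locales (simp_all add: fun_eq_iff vec_act_def single_add distrib_left distrib_right
      mult_single flip: mult.assoc)
  define b :: "nat \<times> ('v \<Rightarrow>\<^sub>0 nat) \<Rightarrow> nat \<Rightarrow> ('v, 'k) mvpoly" where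
    "b = (\<lambda>(e, m) e'. if e' = e then single m 1 else 0)"
  define G where "G = b ` (SIGMA e:{..<n}. monomials V (k - sh e))"
  have "u \<in> span G" if u: "u \<in> free_deg V n sh k" for u
  proof -
    have "u = (\<Sum>e<n. \<Sum>m\<in>keys (u e). vec_act (single 0 (lookup (u e) m)) (b (e, m)))"
    proof
      fix e'
      have "(\<Sum>e<n. \<Sum>m\<in>keys (u e). vec_act (single 0 (lookup (u e) m)) (b (e, m))) e' =
          (\<Sum>e<n. if e' = e then \<Sum>m\<in>keys (u e'). single m (lookup (u e') m) else 0)"
        unfolding sum_fun_apply by (rule sum.cong) (auto simp: vec_act_def b_def mult_single)
      also have "\<dots> = u e'"
        using u by (simp add: free_deg_def not_less flip: poly_mapping_sum_singles)
      finally show "u e' = (\<Sum>e<n. \<Sum>m\<in>keys (u e). vec_act (single 0 (lookup (u e) m)) (b (e, m))) e'" ..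
    qed
    also have "\<dots> \<in> span G"
    proof (intro span_sum span_scale span_base)
      fix e m assume "e \<in> {..<n}" "m \<in> keys (u e)"
      then show "b (e, m) \<in> G" using u by (auto simp: G_def free_deg_def forms_def)
    qed
    finally show ?thesis .
  qed
  moreover have "finite G" using finite_monomials[OF assms] by (simp add: G_def)
  ultimately show ?thesis by blast
qed

context graded_module
begin

lemma subgroup_add_relations: "subgroup_add (relations V act n sh g k)"
proof -
  have "subgroup_add (free_deg V n sh k :: (nat \<Rightarrow> ('v, 'k) mvpoly) set)" by (rule subgroup_add_free_deg)
  then show ?thesis
    by (simp add: subgroup_add_def relations_def gen_map_add additive.zero[OF additive_gen_map]
      additive.minus[OF additive_gen_map])
qed

lemma relations_graded_module: "graded_module V vec_act (relations V act n sh g)"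
proof
  fix p q :: "('v, 'k) mvpoly" and m m' :: "nat \<Rightarrow> ('v, 'k) mvpoly" and a k
  show "vec_act (p + q) m = vec_act p m + vec_act q m" by (simp add: fun_eq_iff vec_act_def distrib_right)
  show "vec_act p (m + m') = vec_act p m + vec_act p m'" by (simp add: fun_eq_iff vec_act_def
    distrib_left)
  show "vec_act (p * q) m = vec_act p (vec_act q m)" by (simp add: fun_eq_iff vec_act_def mult.assoc)
  show "vec_act 1 m = m" by (simp add: fun_eq_iff vec_act_def)
  show "vec_act p m \<in> relations V act n sh g (a + k)" if "p \<in> forms V a" "m \<in> relations V act n sh g k"
    using that by (simp add: relations_def gen_map_vec_act act_zero_right vec_act_closed)
  show "\<exists>G. finite G \<and> relations V act n sh g k \<subseteq> module.span (\<lambda>c. vec_act (single 0 c)) G"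
    using free_deg_span[OF finite_V, of n sh k] by (auto simp: relations_def)
  show "\<exists>k0. \<forall>k<k0. relations V act n sh g k \<subseteq> {0}"
    using free_deg_bounded[of V n sh] by (fastforce simp: relations_def)
  fix I :: "int set" and x
  assume "finite I" "\<And>k. k \<in> I \<Longrightarrow> x k \<in> relations V act n sh g k" "sum x I = 0" "k \<in> I"
  then show "x k = 0" by (intro free_deg_direct[of I x V n sh k]) (auto simp: relations_def)
qed (simp_all add: finite_V subgroup_add_relations)

section \<open>Existence of minimal presentations\<close>

lemma gen_map_image_free_deg_subgroup_add: "subgroup_add (gen_map act n g ` free_deg V n sh k)"
proof -
  have F: "subgroup_add (free_deg V n sh k :: (nat \<Rightarrow> ('v, 'k) mvpoly) set)" by (rule
    subgroup_add_free_deg)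
  show ?thesis
    unfolding subgroup_add_def
  proof (intro conjI ballI; (elim imageE)?)
    show "0 \<in> gen_map act n g ` free_deg V n sh k"
      using subgroup_add_zero[OF F] additive.zero[OF additive_gen_map] by (metis image_eqI)
  next
    fix a b u w assume "a = gen_map act n g u" "u \<in> free_deg V n sh k" "b = gen_map act n g w" "w
      \<in> free_deg V n sh k"
    then show "a + b \<in> gen_map act n g ` free_deg V n sh k"
      using subgroup_add_add[OF F] gen_map_add by (metis image_eqI)
  next
    fix a u assume "a = gen_map act n g u" "u \<in> free_deg V n sh k"
    then show "- a \<in> gen_map act n g ` free_deg V n sh k"
      using subgroup_add_minus[OF F] additive.minus[OF additive_gen_map] by (metis image_eqI)
  qed
qed

lemma gen_map_image_act:
  assumes "p \<in> forms V a" "x \<in> gen_map act n g ` free_deg V n sh k"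
  shows "act p x \<in> gen_map act n g ` free_deg V n sh (a + k)"
  using assms vec_act_closed gen_map_vec_act by (smt (verit, best) image_iff)

lemma generates_surj:
  assumes "generates V act N n sh g" "x \<in> N k" shows "\<exists>u\<in>free_deg V n sh k. gen_map act n g u = x"
proof -
  have "x \<in> gen_map act n g ` free_deg V n sh k" using assms unfolding generates_def by blast
  then show ?thesis by auto
qed

text \<open>Bases of the finitely many components from \<open>k0\<close> to K suffice: below
  \<open>k0\<close> the module is zero, and above K each component is reached from the previous one
  by the variables.\<close>

lemma exists_generates:
  assumes ex: "\<And>k. k > K \<Longrightarrow> koszul_exact (\<lambda>v. act (pvar v)) V N 0 k"
  shows "\<exists>n sh g. generates V act N n sh g"
proof -
  obtain k0 where k0: "\<And>k. k < k0 \<Longrightarrow> N k \<subseteq> {0}" using N_bounded by blast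
  have "\<exists>B\<subseteq>N k. finite B \<and> N k \<subseteq> scalar.span B" for k
  proof -
    obtain G where G: "finite G" "N k \<subseteq> scalar.span G" using N_span by blast
    obtain B where B: "B \<subseteq> N k" "scalar.independent B" "N k \<subseteq> scalar.span B"
      by (rule scalar.maximal_independent_subset)
    have "B \<subseteq> scalar.span G" using B(1) G(2) by (rule subset_trans)
    then have "finite B" using scalar.independent_span_bound[OF G(1) B(2)] by simp
    then show ?thesis using B(1,3) by (intro exI[of _ B]) simp
  qed
  then obtain B where B: "\<And>k. B k \<subseteq> N k" "\<And>k. finite (B k)" "\<And>k. N k \<subseteq> scalar.span (B k)" by metis
  define P where "P = (SIGMA k:{k0..K}. B k)"
  have "finite P" unfolding P_def using B(2) by blast
  then obtain f where f: "bij_betw f {0..<card P} P" using ex_bij_betw_nat_finite by blast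
  define n sh g where "n = card P" and "sh = fst \<circ> f" and "g = snd \<circ> f"
  have fP: "f e \<in> P" if "e < n" for e using f that by (auto simp: bij_betw_def n_def)
  have g: "\<forall>e<n. g e \<in> N (sh e)"
    using fP B(1) by (fastforce simp: P_def g_def sh_def)
  have "N k \<subseteq> gen_map act n g ` free_deg V n sh k" for k
  proof (induction "nat (k - k0)" arbitrary: k rule: less_induct)
    case less
    note A = gen_map_image_free_deg_subgroup_add[of n g sh k]
    consider "k < k0" | "k0 \<le> k" "k \<le> K" | "k0 \<le> k" "K < k" by linarith
    then show ?case
    proof cases
      case 1
      then show ?thesis using k0 subgroup_add_zero[OF A] by blast
    next
      case 2
      have "B k \<subseteq> gen_map act n g ` free_deg V n sh k"
      proof
        fix x assume "x \<in> B k"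
        then have "(k, x) \<in> P" using 2 by (simp add: P_def)
        moreover have "P = f ` {0..<n}" using f by (simp add: bij_betw_def n_def)
        ultimately obtain e where e: "e < n" "f e = (k, x)" by (metis (no_types, lifting)
          atLeastLessThan_iff imageE)
        then have "gen_map act n g (unit_vec e) = x" by (simp add: gen_map_unit_vec g_def)
        moreover have "unit_vec e \<in> free_deg V n sh k" using e unit_vec_free_deg[of e n sh k V] by
          (simp add: sh_def)
        ultimately show "x \<in> gen_map act n g ` free_deg V n sh k" by blast
      qed
      moreover have "scalar.subspace (gen_map act n g ` free_deg V n sh k)"
        using subgroup_add_zero[OF A] subgroup_add_add[OF A] gen_map_image_act[OF forms_const, of
          _ n g sh k]
        by (intro scalar.subspaceI) auto
      ultimately show ?thesis using B(3) scalar.span_minimal by blast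
    next
      case 3
      show ?thesis
      proof
        fix x assume "x \<in> N k"
        then obtain y where y: "\<And>v. y v \<in> N (k - 1)" "x = (\<Sum>v\<in>V. act (pvar v) (y v))"
          using exact_0_decompose[OF ex[OF 3(2)]] by blast
        show "x \<in> gen_map act n g ` free_deg V n sh k" unfolding y(2)
        proof (rule subgroup_add_sum[OF A])
          fix v assume v: "v \<in> V"
          have "y v \<in> gen_map act n g ` free_deg V n sh (k - 1)"
          proof (cases "k = k0")
            case True
            then have "y v = 0" using y(1)[of v] k0[of "k - 1"] by auto
            then show ?thesis using subgroup_add_zero[OF gen_map_image_free_deg_subgroup_add] by simp
          next
            case False
            then show ?thesis using less[of "k - 1"] 3 y(1) by fastforce
          qed
          from gen_map_image_act[OF pvar_forms[OF v] this]
          show "act (pvar v) (y v) \<in> gen_map act n g ` free_deg V n sh k" by simp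
        qed
      qed
    qed
  qed
  with g show ?thesis unfolding generates_def by blast
qed

text \<open>A nonzero constant term makes the entry of u at \<open>e0\<close> a unit d, by
  homogeneity. Subtracting a multiple of u then clears the entry at \<open>e0\<close> of any vector
  without changing its image, so that generator is redundant.\<close>

lemma generates_remove:
  assumes generates: "generates V act N n sh g" and u: "u \<in> relations V act n sh g k" and c:
    "lookup (u e0) 0 \<noteq> 0"
  shows "\<exists>sh' g'. generates V act N (n - 1) sh' g' \<and> n > 0"
proof -
  have uF: "u \<in> free_deg V n sh k" and u0: "gen_map act n g u = 0" using u by (auto simp: relations_def)
  have e0: "e0 < n" using uF c by (auto simp: free_deg_def not_less[symmetric])
  then have ue0: "u e0 \<in> forms V (k - sh e0)" using uF by (simp add: free_deg_def)
  have k: "k = sh e0" using forms_lookup_degree[OF ue0 c] by simp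
  define d where "d = lookup (u e0) 0"
  have d: "d \<noteq> 0" using c by (simp add: d_def)
  have ue0d: "u e0 = single 0 d" using forms_0_eq ue0 k by (simp add: d_def)
  \<comment> \<open>Renumbering after the removal: the last generator takes the place of
    \<open>e0\<close>.\<close>
  define s where "s e = (if e = e0 then n - 1 else e)" for e
  have s: "bij_betw s {..<n - 1} ({..<n} - {e0})"
  proof (rule bij_betwI')
    show "s x = s y \<longleftrightarrow> x = y" if "x \<in> {..<n - 1}" "y \<in> {..<n - 1}" for x y
      using that by (auto simp: s_def)
    show "s x \<in> {..<n} - {e0}" if "x \<in> {..<n - 1}" for x
      using that by (auto simp: s_def)
    show "\<exists>x\<in>{..<n - 1}. y = s x" if "y \<in> {..<n} - {e0}" for y
      using that e0 by (intro bexI[of _ "if y = n - 1 then e0 else y"]) (auto simp: s_def)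
  qed
  have "generates V act N (n - 1) (sh \<circ> s) (g \<circ> s)"
    unfolding generates_def
  proof (intro conjI allI impI subsetI)
    have sn: "s e < n" if "e < n - 1" for e using that by (auto simp: s_def)
    then show "(g \<circ> s) e \<in> N ((sh \<circ> s) e)" if "e < n - 1" for e
      using that generates by (simp add: generates_def)
    fix l x assume "x \<in> N l"
    then obtain w where w: "w \<in> free_deg V n sh l" "gen_map act n g w = x"
      using generates_surj[OF generates] by blast
    define q where "q = w e0 * single 0 (1 / d)"
    have "w e0 \<in> forms V (l - sh e0)" using w(1) e0 by (simp add: free_deg_def)
    then have qf: "q \<in> forms V (l - k)" unfolding q_def k using forms_times[OF _ forms_const] by fastforce
    define w' where "w' = w - vec_act q u"
    have w': "w' \<in> free_deg V n sh l"
      unfolding w'_def using subgroup_add_diff[OF subgroup_add_free_deg w(1)] vec_act_closed[OF qf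
        uF] by simp
    have hw': "gen_map act n g w' = x"
      by (simp add: w'_def additive.diff[OF additive_gen_map] w(2) gen_map_vec_act u0 act_zero_right)
    have w'e0: "w' e0 = 0"
      using d by (simp add: w'_def vec_act_def q_def ue0d mult.assoc mult_single)
    define v where "v e = (if e < n - 1 then w' (s e) else 0)" for e
    have "v \<in> free_deg V (n - 1) (sh \<circ> s) l" using w' sn by (simp add: free_deg_def v_def)
    moreover have "gen_map act (n - 1) (g \<circ> s) v = x"
    proof -
      have "gen_map act (n - 1) (g \<circ> s) v = (\<Sum>e<n - 1. act (w' (s e)) (g (s e)))"
        by (simp add: gen_map_def v_def)
      also have "\<dots> = (\<Sum>e\<in>{..<n} - {e0}. act (w' e) (g e))"
        by (rule sum.reindex_bij_betw[OF s])
      also have "\<dots> = gen_map act n g w'"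
        unfolding gen_map_def by (rule sum.mono_neutral_left) (auto simp: w'e0 act_zero_left)
      finally show ?thesis using hw' by simp
    qed
    ultimately show "x \<in> gen_map act (n - 1) (g \<circ> s) ` free_deg V (n - 1) (sh \<circ> s) l" by blast
  qed
  with e0 show ?thesis by (metis not_gr_zero not_less_zero)
qed

text \<open>A generating family of least size is minimal, because a relation with a constant term
  would allow one generator to be removed.\<close>

lemma exists_minimal_pres:
  assumes ex: "\<And>k. k > K \<Longrightarrow> koszul_exact (\<lambda>v. act (pvar v)) V N 0 k"
  shows "\<exists>n sh g. minimal_pres V act N n sh g"
proof -
  define n where "n = (LEAST n. \<exists>sh g. generates V act N n sh g)"
  have "\<exists>sh g. generates V act N n sh g"
    unfolding n_def using exists_generates[OF ex] by (rule LeastI_ex)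
  then obtain sh g where g: "generates V act N n sh g" by blast
  have "lookup (u e) 0 = 0" if "u \<in> relations V act n sh g k" for u e k
  proof (rule ccontr)
    assume "lookup (u e) 0 \<noteq> 0"
    from generates_remove[OF g that this] obtain sh' g' where "generates V act N (n - 1) sh' g'"
      "n > 0" by blast
    then have "(LEAST n. \<exists>sh g. generates V act N n sh g) \<le> n - 1" by (intro Least_le) blast
    then have "n \<le> n - 1" by (simp flip: n_def)
    with \<open>n > 0\<close> show False by simp
  qed
  with g show ?thesis unfolding minimal_pres_def by blast
qed

section \<open>From graded components to total modules\<close>

lemma gen_map_image_free_mod:
  assumes generates: "generates V act N n sh g"
  shows "gen_map act n g ` free_mod V n = total_module N"
proof
  have g: "\<forall>e<n. g e \<in> N (sh e)" using generates by (simp add: generates_def)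
  show "gen_map act n g ` free_mod V n \<subseteq> total_module N"
  proof (rule image_subsetI)
    fix u :: "nat \<Rightarrow> ('v, 'k) mvpoly" assume u: "u \<in> free_mod V n"
    have "gen_map act n g u = (\<Sum>k\<in>component_support n sh u. gen_map act n g (component n sh k u))"
      using sum_component[OF u finite_component_support order_refl] additive.sum[OF
        additive_gen_map] by metis
    then show "gen_map act n g u \<in> total_module N"
      unfolding total_module_def using finite_component_support gen_map_closed[OF g
        component_free_deg[OF u]] by blast
  qed
  show "total_module N \<subseteq> gen_map act n g ` free_mod V n"
  proof
    fix x assume "x \<in> total_module N"
    then obtain I y where y: "finite I" "\<And>k. k \<in> I \<Longrightarrow> y k \<in> N k" "x = (\<Sum>k\<in>I. y k)"
      unfolding total_module_def by blast
    have "\<exists>u\<in>free_mod V n. gen_map act n g u = y k" if "k \<in> I" for k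
      using generates_surj[OF generates y(2)[OF that]] by (auto intro: free_deg_free_mod)
    then obtain u where u: "\<And>k. k \<in> I \<Longrightarrow> u k \<in> free_mod V n" "\<And>k. k \<in> I \<Longrightarrow> gen_map act n g (u k) = y k"
      by metis
    have "gen_map act n g (\<Sum>k\<in>I. u k) = x" using u(2) by (simp add: additive.sum[OF
      additive_gen_map] y(3))
    moreover have "(\<Sum>k\<in>I. u k) \<in> free_mod V n" by (rule subgroup_add_sum[OF
      subgroup_add_free_mod]) (rule u(1))
    ultimately show "x \<in> gen_map act n g ` free_mod V n" by blast
  qed
qed

lemma total_module_relations:
  assumes g: "\<forall>e<n. g e \<in> N (sh e)"
  shows "total_module (relations V act n sh g) = {u \<in> free_mod V n. gen_map act n g u = 0}"
proof (intro equalityI subsetI)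
  fix u assume "u \<in> total_module (relations V act n sh g)"
  then obtain I y where y: "\<And>k. k \<in> I \<Longrightarrow> y k \<in> relations V act n sh g k" "u = (\<Sum>k\<in>I. y k)"
    unfolding total_module_def by blast
  have "u \<in> free_mod V n"
    unfolding y(2) by (rule subgroup_add_sum[OF subgroup_add_free_mod]) (use y(1) in \<open>auto simp:
      relations_def intro: free_deg_free_mod\<close>)
  moreover have "gen_map act n g u = 0"
    using y(1) by (simp add: y(2) additive.sum[OF additive_gen_map] relations_def)
  ultimately show "u \<in> {u \<in> free_mod V n. gen_map act n g u = 0}" by simp
next
  fix u assume "u \<in> {u \<in> free_mod V n. gen_map act n g u = 0}"
  then have u: "u \<in> free_mod V n" "gen_map act n g u = 0" by auto
  have "component n sh k u \<in> relations V act n sh g k" for k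
    using gen_map_component[OF g u(1), of k] component_free_deg[OF u(1)] u(2) by (simp add:
      relations_def subgroup_add_zero[OF subgroup_add_N])
  then show "u \<in> total_module (relations V act n sh g)"
    unfolding total_module_def using sum_component[OF u(1) finite_component_support order_refl]
      finite_component_support
    by (intro CollectI exI[of _ "component_support n sh u"] exI[of _ "\<lambda>k. component n sh k u"]) auto
qed

lemma minimal_pres_if_image:
  assumes g: "\<forall>e<n. g e \<in> N (sh e)" and im: "gen_map act n g ` free_mod V n = total_module N"
    and min: "\<And>u e. u \<in> free_mod V n \<Longrightarrow> gen_map act n g u = 0 \<Longrightarrow> lookup (u e) 0 = 0"
  shows "minimal_pres V act N n sh g"
  unfolding minimal_pres_def generates_def
proof (intro conjI allI ballI subsetI)
  fix k x assume x: "x \<in> N k"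
  then have "x \<in> total_module N"
    unfolding total_module_def by (intro CollectI exI[of _ "{k}"] exI[of _ "\<lambda>_. x"]) simp
  then have "x \<in> gen_map act n g ` free_mod V n" using im by simp
  then obtain u where u: "u \<in> free_mod V n" "gen_map act n g u = x" by auto
  then show "x \<in> gen_map act n g ` free_deg V n sh k"
    using gen_map_component[OF g u(1)] x component_free_deg[OF u(1)] by (metis image_eqI)
next
  fix k u e assume "u \<in> relations V act n sh g k"
  then show "lookup (u e) 0 = 0" by (auto simp: relations_def intro!: min intro: free_deg_free_mod)
qed (use g in blast)

lemma minimal_pres_lookup_0:
  assumes pres: "minimal_pres V act N n sh g" and u: "u \<in> free_mod V n" "gen_map act n g u = 0"
  shows "lookup (u e) 0 = 0"
proof -
  have "u \<in> total_module (relations V act n sh g)"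
    using total_module_relations[of n g sh] pres u by (simp add: minimal_pres_def generates_def)
  then obtain I y where y: "\<And>k. k \<in> I \<Longrightarrow> y k \<in> relations V act n sh g k" "u = (\<Sum>k\<in>I. y k)"
    unfolding total_module_def by blast
  have "lookup (y k e) 0 = 0" if "k \<in> I" for k
    using y(1)[OF that] pres unfolding minimal_pres_def by blast
  then show ?thesis by (simp add: y(2) sum_fun_apply lookup_sum)
qed

end

section \<open>The Veronese module\<close>

text \<open>There are no exterior monomials beyond the number of variables. This is what bounds the
  length of the resolution.\<close>

lemma koszul_exact_above_card:
  assumes "finite X" "i > card X" "\<And>k. 0 \<in> M k" "\<And>v. additive (T v)"
  shows "koszul_exact T X M i k"
  unfolding koszul_exact_def
proof (intro allI impI; elim conjE)
  fix z assume z: "koszul_chain X (M k) i z"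
  have "z A = 0" for A
  proof (rule ccontr)
    assume "z A \<noteq> 0"
    then have "A \<subseteq> X" "card A = i" using z unfolding koszul_chain_def by blast+
    then have "i \<le> card X" using card_mono[OF assms(1)] by blast
    with assms(2) show False by simp
  qed
  moreover have "koszul_diff T X (\<lambda>_. 0) A = 0" for A by (rule koszul_diff_zero) (rule assms(4))
  ultimately show "\<exists>w. koszul_chain X (M (k - 1)) (Suc i) w \<and> koszul_diff T X w = z"
    using assms(3) by (intro exI[of _ "\<lambda>_. 0"]) (simp add: koszul_chain_def fun_eq_iff)
qed

section \<open>The substitution homomorphism and the action on R\<close>

lemma evaluation_subst:
  "evaluation (single 0) (\<lambda>m. \<Prod>v\<in>keys m. f v ^ lookup m v)"
  for f :: "'v \<Rightarrow> ('w, 'k::comm_ring_1) mvpoly"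
proof
  fix m n :: "'v \<Rightarrow>\<^sub>0 nat"
  let ?W = "keys m \<union> keys n"
  have *: "(\<Prod>v\<in>keys m. f v ^ lookup m v) = (\<Prod>v\<in>?W. f v ^ lookup m v)"
    if "keys m \<subseteq> ?W" for m
    by (rule prod.mono_neutral_left) (use that in \<open>auto simp: in_keys_iff\<close>)
  show "(\<Prod>v\<in>keys (m + n). f v ^ lookup (m + n) v) =
     (\<Prod>v\<in>keys m. f v ^ lookup m v) *
     (\<Prod>v\<in>keys n. f v ^ lookup n v)"
    by (simp add: * keys_add_nat lookup_add power_add prod.distrib)
qed (simp_all add: single_add mult_single)

lemma subst_poly_evaluate:
  "subst_poly f = evaluate (single 0) (\<lambda>m. \<Prod>v\<in>keys m. f v ^ lookup m v)"
  by (simp add: fun_eq_iff subst_poly_def evaluate_def)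

lemma subst_poly_add: "subst_poly f (p + q) = subst_poly f p + subst_poly f q"
  and subst_poly_mult: "subst_poly f (p * q) = subst_poly f p * subst_poly f q"
  and subst_poly_one: "subst_poly f 1 = 1"
  and subst_poly_const: "subst_poly f (single 0 c) = single 0 c"
  and subst_poly_pvar: "subst_poly f (pvar v) = f v"
proof -
  interpret evaluation "single 0" "\<lambda>m. \<Prod>v\<in>keys m. f v ^ lookup m v"
    by (rule evaluation_subst)
  show "subst_poly f (p + q) = subst_poly f p + subst_poly f q"
    and "subst_poly f (p * q) = subst_poly f p * subst_poly f q"
    and "subst_poly f 1 = 1"
    and "subst_poly f (single 0 c) = single 0 c"
    and "subst_poly f (pvar v) = f v"
    by (simp_all add: subst_poly_evaluate evaluate_add evaluate_mult evaluate_one evaluate_single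
      pvar_def)
qed

lemma forms_prod:
  fixes f :: "'v \<Rightarrow> ('w, 'k::comm_ring_1) mvpoly"
  assumes "finite S" "\<And>v. v \<in> S \<Longrightarrow> f v \<in> forms W d"
  shows "(\<Prod>v\<in>S. f v ^ e v) \<in> forms W (d * int (\<Sum>v\<in>S. e v))"
  using assms
proof (induction S rule: finite_induct)
  case (insert v S)
  have "f v ^ n \<in> forms W (d * int n)" for n
  proof (induction n)
    case (Suc n)
    then show ?case using forms_times[OF insert.prems(1)[of v] Suc] by (simp add: distrib_left)
  qed (simp add: forms_one)
  then show ?case using forms_times[OF _ insert.IH, of "f v ^ e v" "d * int (e v)"] insert
    by (simp add: distrib_left)
qed (simp add: forms_one)

lemma subst_poly_forms:
  fixes f :: "'v \<Rightarrow> ('w, 'k::comm_ring_1) mvpoly"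
  assumes "p \<in> forms V a" "\<And>v. v \<in> V \<Longrightarrow> f v \<in> forms W d"
  shows "subst_poly f p \<in> forms W (d * a)"
  unfolding subst_poly_def
proof (rule subgroup_add_sum[OF subgroup_add_forms])
  fix m assume "m \<in> keys p"
  then have m: "m \<in> monomials V a" using assms(1) by (auto simp: forms_def)
  have "(\<Prod>v\<in>keys m. f v ^ lookup m v) \<in> forms W (d * a)"
    using forms_prod[of "keys m" f W d "lookup m"] m assms(2)
    by (auto simp: monomials_def total_degree_def)
  from forms_times[OF forms_const this]
  show "single 0 (lookup p m) *
      (\<Prod>v\<in>keys m. f v ^ lookup m v) \<in> forms W (d * a)" by simp
qed

abbreviation cubic_vars :: "(nat \<Rightarrow>\<^sub>0 nat) set" where "cubic_vars \<equiv> veronese_vars 3 3"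

abbreviation cubic_module :: "int \<Rightarrow> (nat, 'k::zero) mvpoly set" where "cubic_module \<equiv> veronese_module 3 3"

lemma cubic_module_eq: "cubic_module k = forms {..3} (3 * k)"
  by (simp add: veronese_module_def sections_def mult.commute)

lemma action_pvar: "veronese_action (pvar v) = (\<lambda>p. single v 1 * p)"
  by (simp add: fun_eq_iff veronese_action_def subst_poly_pvar)

lemma veronese_graded_module:
  "graded_module cubic_vars veronese_action (cubic_module :: int \<Rightarrow> (nat, 'k::field_char_0) mvpoly set)"
proof
  fix p q :: "(nat \<Rightarrow>\<^sub>0 nat, 'k) mvpoly" and m m' :: "(nat, 'k) mvpoly" and a k
  show "finite cubic_vars" by (simp add: veronese_vars_def finite_monomials)
  show "veronese_action (p + q) m = veronese_action p m + veronese_action q m"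
    by (simp add: veronese_action_def subst_poly_add distrib_right)
  show "veronese_action p (m + m') = veronese_action p m + veronese_action p m'"
    by (simp add: veronese_action_def distrib_left)
  show "veronese_action (p * q) m = veronese_action p (veronese_action q m)"
    by (simp add: veronese_action_def subst_poly_mult mult.assoc)
  show "veronese_action 1 m = m" by (simp add: veronese_action_def subst_poly_one)
  show "subgroup_add (cubic_module k :: (nat, 'k) mvpoly set)" unfolding cubic_module_eq by (rule
    subgroup_add_forms)
  show "veronese_action p m \<in> cubic_module (a + k)" if "p \<in> forms cubic_vars a" "m \<in> cubic_module k"
  proof -
    have "subst_poly (\<lambda>m. single m 1) p \<in> forms {..3} (3 * a)"
      by (rule subst_poly_forms[OF that(1)]) (simp add: veronese_vars_def forms_single)
    from forms_times[OF this] that(2) show ?thesis by (simp add: veronese_action_def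
      cubic_module_eq distrib_left)
  qed
  show "\<exists>k0. \<forall>k<k0. (cubic_module k :: (nat, 'k) mvpoly set) \<subseteq> {0}"
    by (intro exI[of _ 0]) (auto simp: cubic_module_eq forms_def)
  show "\<exists>G. finite G \<and> (cubic_module k :: (nat, 'k) mvpoly set) \<subseteq> module.span (\<lambda>c. veronese_action
    (single 0 c)) G"
  proof -
    interpret vector_space "\<lambda>c. veronese_action (single 0 c) :: (nat, 'k) mvpoly \<Rightarrow> _"
      by unfold_locales (simp_all add: veronese_action_def subst_poly_const subst_poly_one subst_poly_add
          single_add distrib_left distrib_right mult_single flip: mult.assoc)
    define G :: "(nat, 'k) mvpoly set" where "G = (\<lambda>m. single m 1) ` monomials {..3} (3 * k)"
    have "x \<in> span G" if "x \<in> cubic_module k" for x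
    proof -
      have "(\<Sum>m\<in>keys x. veronese_action (single 0 (lookup x m)) (single m 1)) \<in> span G"
        using that by (intro span_sum span_scale span_base) (auto simp: G_def cubic_module_eq forms_def)
      then show ?thesis
        by (simp add: veronese_action_def subst_poly_const mult_single flip: poly_mapping_sum_singles)
    qed
    moreover have "finite G" by (simp add: G_def finite_monomials)
    ultimately show ?thesis by blast
  qed
  fix I :: "int set" and x :: "int \<Rightarrow> (nat, 'k) mvpoly"
  assume "finite I" "\<And>k. k \<in> I \<Longrightarrow> x k \<in> cubic_module k" "sum x I = 0" "k \<in> I"
  then show "x k = 0"
    by (intro forms_direct[where c = "(*) 3" and x = x and V = "{..3}"]) (auto simp:
      cubic_module_eq inj_on_def)
qed

section \<open>Unwinding an arbitrary minimal resolution\<close>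

context graded_module
begin

text \<open>A resolution states exactness for total modules. This turns one step of it into a
  minimal presentation of the relation module, the input for the next dimension shift.\<close>

lemma minimal_pres_kernel:
  assumes pres: "minimal_pres V act N n sh g"
    and g': "\<And>e. e < n' \<Longrightarrow> g' e \<in> free_deg V n sh (sh' e)"
    and im: "{u \<in> free_mod V n. gen_map act n g u = 0} = gen_map vec_act n' g' ` free_mod V n'"
    and min: "\<And>u e. u \<in> free_mod V n' \<Longrightarrow> gen_map vec_act n' g' u = 0 \<Longrightarrow> lookup (u e) 0 = 0"
  shows "minimal_pres V vec_act (relations V act n sh g) n' sh' g'"
proof -
  interpret K: graded_module V vec_act "relations V act n sh g" by (rule relations_graded_module)
  have g: "\<forall>e<n. g e \<in> N (sh e)" using pres by (simp add: minimal_pres_def generates_def)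
  show ?thesis
  proof (rule K.minimal_pres_if_image)
    show "\<forall>e<n'. g' e \<in> relations V act n sh g (sh' e)"
    proof (intro allI impI)
      fix e assume e: "e < n'"
      then have "unit_vec e \<in> free_mod V n'"
        using free_deg_free_mod unit_vec_free_deg[of e n' sh' "sh' e"] by blast
      then have "gen_map vec_act n' g' (unit_vec e) \<in> {u \<in> free_mod V n. gen_map act n g u = 0}"
        unfolding im by blast
      then have "gen_map act n g (g' e) = 0" using K.gen_map_unit_vec[OF e] by simp
      then show "g' e \<in> relations V act n sh g (sh' e)" using g'[OF e] by (simp add: relations_def)
    qed
    show "gen_map vec_act n' g' ` free_mod V n' = total_module (relations V act n sh g)"
      using im total_module_relations[OF g] by simp
  qed (rule min)
qed

end

text \<open>
  \<open>syz_exact i N\<close> says that the Koszul homology of \<open>N\<close> vanishes wherever that of the Veronese module,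
  shifted by \<open>i\<close>, does: this is what dimension shifting gives for an \<open>i\<close>-th syzygy module \<open>N\<close>.
\<close>

definition syz_exact :: "nat \<Rightarrow> (int \<Rightarrow> (nat \<Rightarrow> (nat \<Rightarrow>\<^sub>0 nat, 'k::field_char_0) mvpoly) set) \<Rightarrow> bool" where
  "syz_exact i K \<longleftrightarrow> (\<forall>l k.
     koszul_exact (\<lambda>v. veronese_action (pvar v)) cubic_vars (cubic_module :: int \<Rightarrow> (nat, 'k)
       mvpoly set) (i + l) (k - int i) \<longrightarrow>
     koszul_exact (\<lambda>v. vec_act (pvar v)) cubic_vars K l k)"

lemma syz_exact_1:
  fixes g :: "nat \<Rightarrow> (nat, 'k::field_char_0) mvpoly"
  assumes "minimal_pres cubic_vars veronese_action cubic_module n sh g"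
  shows "syz_exact 1 (relations cubic_vars veronese_action n sh g)"
  unfolding syz_exact_def
  using graded_module.kernel_exact[OF veronese_graded_module assms] by simp

lemma syz_exact_Suc:
  fixes g :: "nat \<Rightarrow> nat \<Rightarrow> (nat \<Rightarrow>\<^sub>0 nat, 'k::field_char_0) mvpoly"
  assumes K: "graded_module cubic_vars vec_act K" "syz_exact i K" and "minimal_pres cubic_vars
    vec_act K n sh g"
  shows "syz_exact (Suc i) (relations cubic_vars vec_act n sh g)"
  unfolding syz_exact_def
proof (intro allI impI)
  fix l k
  assume "koszul_exact (\<lambda>v. veronese_action (pvar v)) cubic_vars (cubic_module :: int \<Rightarrow> (nat, 'k)
    mvpoly set) (Suc i + l) (k - int (Suc i))"
  then have "koszul_exact (\<lambda>v. vec_act (pvar v)) cubic_vars K (Suc l) (k - 1)"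
    using K(2) unfolding syz_exact_def by (simp add: algebra_simps)
  then show "koszul_exact (\<lambda>v. vec_act (pvar v)) cubic_vars (relations cubic_vars vec_act n sh g) l k"
    by (rule graded_module.kernel_exact[OF K(1) assms(3)])
qed

lemma veronese_action_exact:
  assumes "k < 0 \<or> k \<ge> 3 \<or> k = 0 \<and> i \<ge> 1 \<or> k = 1 \<and> i = 0 \<or> k = 2 \<and> i \<le> 6 \<or> i > card cubic_vars"
  shows "koszul_exact (\<lambda>v. veronese_action (pvar v)) cubic_vars (cubic_module :: int \<Rightarrow> (nat,
    'k::field_char_0) mvpoly set) i k"
proof (cases "i > card cubic_vars")
  case True
  interpret graded_module cubic_vars veronese_action "cubic_module :: int \<Rightarrow> (nat, 'k) mvpoly set"
    by (rule veronese_graded_module)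
  show ?thesis by (rule koszul_exact_above_card[OF finite_V True subgroup_add_zero[OF
    subgroup_add_N]]) (rule additive_act)
next
  case False
  then show ?thesis unfolding action_pvar using assms by (intro veronese_koszul_exact) auto
qed

lemma augmentation_eq_gen_map: "augmentation act F = gen_map act (rk F 0) (aug F)"
  by (simp add: fun_eq_iff augmentation_def gen_map_def)

definition columns where
  "columns F i e = (\<lambda>a. if a < rk F (i - 1) then mat F i a e else 0)"

lemma differential_eq_gen_map: "differential F i = gen_map vec_act (rk F i) (columns F i)"
  by (auto simp: fun_eq_iff differential_def gen_map_def sum_fun_apply vec_act_def columns_def
    mult.commute intro!: sum.cong)

text \<open>Entry i is the kernel of the map out of F_i, thus the syzygy module of order i + 1; it
  is presented by the free module of index i + 1. The first clause differs because that map is the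
  augmentation.\<close>

primrec syzygy where
  "syzygy F 0 = relations cubic_vars veronese_action (rk F 0) (shift F 0) (aug F)"
| "syzygy F (Suc i) = relations cubic_vars vec_act (rk F (Suc i)) (shift F (Suc i)) (columns F (Suc i))"

text \<open>Minimality of a resolution restricts images of differentials, while
  \<open>minimal_pres\<close> restricts kernels; exactness identifies the two.\<close>

lemma resolution_lookup_0:
  assumes F: "minimal_graded_free_resolution V act M F"
    and u: "u \<in> free_mod V (rk F i)" "(if i = 0 then augmentation act F u = 0 else differential F
      i u = (\<lambda>_. 0))"
  shows "lookup (u e) 0 = 0"
proof (cases "e < rk F i")
  case True
  have "u \<in> differential F (i + 1) ` free_mod V (rk F (i + 1))"
  proof (cases "i = 0")
    case True
    then have "u \<in> {u \<in> free_mod V (rk F 0). augmentation act F u = 0}" using u by simp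
    also have "\<dots> = differential F 1 ` free_mod V (rk F 1)"
      using F by (simp add: minimal_graded_free_resolution_def graded_free_resolution_def)
    finally show ?thesis using True by simp
  next
    case False
    then have "u \<in> {u \<in> free_mod V (rk F i). differential F i u = (\<lambda>_. 0)}" using u by simp
    also have "\<dots> = differential F (i + 1) ` free_mod V (rk F (i + 1))"
      using F False unfolding minimal_graded_free_resolution_def graded_free_resolution_def by simp
    finally show ?thesis .
  qed
  then obtain w where "u = differential F (i + 1) w" "w \<in> free_mod V (rk F (i + 1))" by blast
  moreover have "\<forall>i\<ge>1. \<forall>u\<in>free_mod V (rk F i). \<forall>a<rk F (i - 1). differential F i u a \<in> irrelevant_ideal V"
    using F by (simp add: minimal_graded_free_resolution_def)
  ultimately have "u e \<in> irrelevant_ideal V" using True by fastforce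
  then show ?thesis by (simp add: irrelevant_ideal_def)
qed (use u in \<open>simp add: free_mod_def\<close>)

lemma columns_free_deg:
  assumes F: "graded_free_resolution V act M F" and e: "e < rk F (Suc i)"
  shows "columns F (Suc i) e \<in> free_deg V (rk F i) (shift F i) (shift F (Suc i) e)"
proof -
  have "\<forall>i\<ge>1. \<forall>a<rk F (i - 1). \<forall>e<rk F i. mat F i a e \<in> forms V (shift F i e - shift F (i - 1) a)"
    using F by (simp add: graded_free_resolution_def)
  from this[rule_format, of "Suc i"] show ?thesis
    using e by (simp add: free_deg_def columns_def)
qed

lemma resolution_minimal_pres_0:
  assumes F: "veronese_resolution 3 3 (F :: (_, 'k::field_char_0, _) graded_free_complex)"
  shows "minimal_pres cubic_vars veronese_action (cubic_module :: int \<Rightarrow> (nat, 'k) mvpoly set) (rk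
    F 0) (shift F 0) (aug F)"
proof (rule graded_module.minimal_pres_if_image[OF veronese_graded_module])
  have "graded_free_resolution cubic_vars veronese_action cubic_module F"
    using F by (simp add: minimal_graded_free_resolution_def)
  then show "\<forall>e<rk F 0. aug F e \<in> cubic_module (shift F 0 e)"
    and "gen_map veronese_action (rk F 0) (aug F) ` free_mod cubic_vars (rk F 0) = total_module
      cubic_module"
    by (simp_all add: graded_free_resolution_def augmentation_eq_gen_map)
  show "lookup (u e) 0 = 0"
    if "u \<in> free_mod cubic_vars (rk F 0)" "gen_map veronese_action (rk F 0) (aug F) u = 0" for u e
    by (rule resolution_lookup_0[OF F that(1)]) (simp add: augmentation_eq_gen_map that(2))
qed

lemma resolution_syzygy:
  assumes F: "veronese_resolution 3 3 (F :: (_, 'k::field_char_0, _) graded_free_complex)"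
  shows "graded_module cubic_vars vec_act (syzygy F i) \<and> syz_exact (Suc i) (syzygy F i) \<and>
    minimal_pres cubic_vars vec_act (syzygy F i) (rk F (Suc i)) (shift F (Suc i)) (columns F (Suc i))"
proof (induction i)
  case 0
  interpret graded_module cubic_vars veronese_action "cubic_module :: int \<Rightarrow> (nat, 'k) mvpoly set"
    by (rule veronese_graded_module)
  note pres = resolution_minimal_pres_0[OF F]
  have G: "graded_free_resolution cubic_vars veronese_action cubic_module F"
    using F by (simp add: minimal_graded_free_resolution_def)
  have "minimal_pres cubic_vars vec_act (relations cubic_vars veronese_action (rk F 0) (shift F 0)
    (aug F)) (rk F (Suc 0)) (shift F (Suc 0)) (columns F (Suc 0))"
  proof (rule minimal_pres_kernel[OF pres])
    show "columns F (Suc 0) e \<in> free_deg cubic_vars (rk F 0) (shift F 0) (shift F (Suc 0) e)" if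
      "e < rk F (Suc 0)" for e
      by (rule columns_free_deg[OF G that])
    show "{u \<in> free_mod cubic_vars (rk F 0). gen_map veronese_action (rk F 0) (aug F) u = 0} =
        gen_map vec_act (rk F (Suc 0)) (columns F (Suc 0)) ` free_mod cubic_vars (rk F (Suc 0))"
      using G unfolding graded_free_resolution_def augmentation_eq_gen_map differential_eq_gen_map by simp
    show "lookup (u e) 0 = 0"
      if "u \<in> free_mod cubic_vars (rk F (Suc 0))" "gen_map vec_act (rk F (Suc 0)) (columns F (Suc
        0)) u = 0" for u e
      by (rule resolution_lookup_0[OF F that(1)]) (simp add: differential_eq_gen_map
        that(2)[unfolded zero_fun_def])
  qed
  then show ?case using relations_graded_module syz_exact_1[OF pres] by simp
next
  case (Suc i)
  then interpret graded_module cubic_vars vec_act "syzygy F i" by simp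
  from Suc have pres: "minimal_pres cubic_vars vec_act (syzygy F i) (rk F (Suc i)) (shift F (Suc
    i)) (columns F (Suc i))" by simp
  have G: "graded_free_resolution cubic_vars veronese_action cubic_module F"
    using F by (simp add: minimal_graded_free_resolution_def)
  have "minimal_pres cubic_vars vec_act (relations cubic_vars vec_act (rk F (Suc i)) (shift F (Suc
    i)) (columns F (Suc i)))
      (rk F (Suc (Suc i))) (shift F (Suc (Suc i))) (columns F (Suc (Suc i)))"
  proof (rule minimal_pres_kernel[OF pres])
    show "columns F (Suc (Suc i)) e \<in> free_deg cubic_vars (rk F (Suc i)) (shift F (Suc i)) (shift
      F (Suc (Suc i)) e)"
      if "e < rk F (Suc (Suc i))" for e
      by (rule columns_free_deg[OF G that])
    have "\<forall>i\<ge>1. {u \<in> free_mod cubic_vars (rk F i). differential F i u = (\<lambda>_. 0)}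
       = differential F (i + 1) ` free_mod cubic_vars (rk F (i + 1))"
      using G by (simp add: graded_free_resolution_def)
    from this[rule_format, of "Suc i"]
    show "{u \<in> free_mod cubic_vars (rk F (Suc i)). gen_map vec_act (rk F (Suc i)) (columns F (Suc
      i)) u = 0} =
        gen_map vec_act (rk F (Suc (Suc i))) (columns F (Suc (Suc i))) ` free_mod cubic_vars (rk F
          (Suc (Suc i)))"
      unfolding differential_eq_gen_map by (simp add: zero_fun_def)
    show "lookup (u e) 0 = 0"
      if "u \<in> free_mod cubic_vars (rk F (Suc (Suc i)))" "gen_map vec_act (rk F (Suc (Suc i)))
        (columns F (Suc (Suc i))) u = 0" for u e
      by (rule resolution_lookup_0[OF F that(1)]) (simp add: differential_eq_gen_map
        that(2)[unfolded zero_fun_def])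
  qed
  then show ?case using relations_graded_module syz_exact_Suc[OF _ _ pres] Suc by simp
qed

text \<open>After i dimension shifts the hypothesis becomes exactness of the i-th syzygy module at
  exterior degree 0 in degree j, and a minimal presentation has no generator there.\<close>

lemma resolution_shift:
  assumes F: "veronese_resolution 3 3 (F :: (_, 'k::field_char_0, _) graded_free_complex)"
    and ex: "koszul_exact (\<lambda>v. veronese_action (pvar v)) cubic_vars (cubic_module :: int \<Rightarrow> (nat,
      'k) mvpoly set) i (j - int i)"
    and e: "e < rk F i"
  shows "shift F i e \<noteq> j"
proof (cases i)
  case 0
  then show ?thesis
    using graded_module.no_generator[OF veronese_graded_module resolution_minimal_pres_0[OF F]] ex
      e by simp
next
  case (Suc l)
  then have "koszul_exact (\<lambda>v. vec_act (pvar v)) cubic_vars (syzygy F l) 0 j"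
    using resolution_syzygy[OF F, of l] ex by (simp add: syz_exact_def)
  then show ?thesis
    using graded_module.no_generator[of cubic_vars vec_act "syzygy F l"] resolution_syzygy[OF F,
      of l] e Suc by blast
qed

text \<open>Generators of degree 0 map to constants. Without generators 1 is not reached, and two
  constants always satisfy a scalar relation, which minimality excludes.\<close>

lemma resolution_rk_0:
  assumes F: "veronese_resolution 3 3 (F :: (_, 'k::field_char_0, _) graded_free_complex)"
    and sh: "\<And>e. e < rk F 0 \<Longrightarrow> shift F 0 e = 0"
  shows "rk F 0 = 1"
proof -
  interpret graded_module cubic_vars veronese_action "cubic_module :: int \<Rightarrow> (nat, 'k) mvpoly set"
    by (rule veronese_graded_module)
  let ?n = "rk F 0" and ?g = "aug F"
  have pres: "minimal_pres cubic_vars veronese_action (cubic_module :: int \<Rightarrow> (nat, 'k) mvpoly set)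
    ?n (shift F 0) ?g"
    by (rule resolution_minimal_pres_0[OF F])
  have min: "lookup (u e) 0 = 0" if "u \<in> free_deg cubic_vars ?n (shift F 0) 0" "gen_map
    veronese_action ?n ?g u = 0"
    for u :: "nat \<Rightarrow> (nat \<Rightarrow>\<^sub>0 nat, 'k) mvpoly" and e
    using minimal_pres_lookup_0[OF pres free_deg_free_mod[OF that(1)] that(2)] .
  have unit: "unit_vec e \<in> free_deg cubic_vars ?n (shift F 0) 0" if "e < ?n" for e
    by (rule unit_vec_free_deg[where sh = "shift F 0" and k = 0]) (use that sh in auto)
  have const: "\<exists>c. ?g e = single 0 c" if "e < ?n" for e
  proof -
    have "?g e \<in> cubic_module 0" using pres that sh unfolding minimal_pres_def generates_def by fastforce
    then show ?thesis using forms_0_eq unfolding cubic_module_eq by fastforce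
  qed
  have "?n \<noteq> 0"
  proof
    assume "?n = 0"
    have "(1 :: (nat, 'k) mvpoly) \<in> cubic_module 0" by (simp add: cubic_module_eq forms_one)
    then obtain u where "gen_map veronese_action ?n ?g u = 1"
      using generates_surj[of ?n "shift F 0" ?g 1 0] pres by (auto simp: minimal_pres_def)
    with \<open>?n = 0\<close> show False by (simp add: gen_map_def)
  qed
  moreover have "\<not> 1 < ?n"
  proof
    assume n: "1 < ?n"
    obtain a b where a: "?g 0 = single 0 a" and b: "?g 1 = single 0 b"
      using const[of 0] const[of 1] n by auto
    \<comment> \<open>The scalar relation between the two constants. Minimality gives b = 0, and
      then the second unit vector alone is a relation with a nonzero constant term.\<close>
    define u where "u = vec_act (single 0 b) (unit_vec 0) - vec_act (single 0 a) (unit_vec 1 ::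
      nat \<Rightarrow> (nat \<Rightarrow>\<^sub>0 nat, 'k) mvpoly)"
    have "u \<in> free_deg cubic_vars ?n (shift F 0) 0"
      unfolding u_def using vec_act_closed[OF forms_const unit] n
      by (intro subgroup_add_diff[OF subgroup_add_free_deg]) fastforce+
    moreover have "gen_map veronese_action ?n ?g u = 0"
      using n gen_map_unit_vec[of 0 ?n ?g] gen_map_unit_vec[of 1 ?n ?g]
      by (simp add: u_def additive.diff[OF additive_gen_map] gen_map_vec_act a b[unfolded
        One_nat_def] veronese_action_def subst_poly_const
          mult_single mult.commute)
    ultimately have "lookup (u 0) 0 = 0" by (rule min)
    then have "b = 0" by (simp add: u_def vec_act_def unit_vec_def)
    then have "gen_map veronese_action ?n ?g (unit_vec 1) = 0" using gen_map_unit_vec[OF n, of ?g]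
      b by simp
    then have "lookup (unit_vec 1 1 :: (nat \<Rightarrow>\<^sub>0 nat, 'k) mvpoly) 0 = 0"
      using min[OF unit[OF n]] by simp
    then show False by (simp add: unit_vec_def)
  qed
  ultimately show ?thesis by linarith
qed

lemma veronese_betti:
  assumes F: "veronese_resolution 3 3 (F :: (_, 'k::field_char_0, _) graded_free_complex)"
  shows "betti F 0 0 = 1" "j \<noteq> 0 \<Longrightarrow> betti F 0 j = 0"
    "1 \<le> i \<Longrightarrow> i \<le> 6 \<Longrightarrow> j \<noteq> int i + 1 \<Longrightarrow> betti F i j = 0"
proof -
  have sh0: "shift F 0 e = 0" if "e < rk F 0" for e
  proof (rule ccontr)
    assume "shift F 0 e \<noteq> 0"
    then have "koszul_exact (\<lambda>v. veronese_action (pvar v)) cubic_vars (cubic_module :: int \<Rightarrow> (nat,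
      'k) mvpoly set) 0 (shift F 0 e - int 0)"
      by (intro veronese_action_exact) auto
    from resolution_shift[OF F this that] show False by simp
  qed
  have "rk F 0 = 1" by (rule resolution_rk_0[OF F sh0])
  then have "{e. e < rk F 0 \<and> shift F 0 e = 0} = {0}" using sh0 by auto
  then show "betti F 0 0 = 1" by (simp add: betti_def)
  show "betti F 0 j = 0" if "j \<noteq> 0" using sh0 that by (auto simp: betti_def)
  show "betti F i j = 0" if "1 \<le> i" "i \<le> 6" "j \<noteq> int i + 1"
  proof -
    \<comment> \<open>The module degree j - i differs from 1 here; the value 2 is where i \<le> 6 is
      used, and the value 0 where i \<ge> 1 is.\<close>
    have "koszul_exact (\<lambda>v. veronese_action (pvar v)) cubic_vars (cubic_module :: int \<Rightarrow> (nat, 'k)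
      mvpoly set) i (j - int i)"
      using that by (intro veronese_action_exact) auto
    from resolution_shift[OF F this] show ?thesis by (auto simp: betti_def)
  qed
qed

section \<open>Existence of a finite minimal resolution\<close>

text \<open>
  \<open>(n, sh, K)\<close> records the rank and the shifts of one step of the resolution and the kernel of its map.
\<close>

definition good_step :: "nat \<Rightarrow> nat \<times> (nat \<Rightarrow> int) \<times> (int \<Rightarrow> (nat \<Rightarrow> (nat \<Rightarrow>\<^sub>0 nat, 'k::field_char_0)
  mvpoly) set) \<Rightarrow> bool" where
  "good_step i = (\<lambda>(n, sh, K). graded_module cubic_vars vec_act K \<and> syz_exact (Suc i) K \<and> (\<forall>k. K k
    \<subseteq> free_deg cubic_vars n sh k) \<and>
     (\<forall>k. \<forall>u\<in>K k. \<forall>e. lookup (u e) 0 = 0))"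

lemma good_step_minimal_pres:
  assumes "good_step i (n, sh, K)" shows "\<exists>n' sh' g. minimal_pres cubic_vars vec_act K n' sh' g"
proof -
  interpret graded_module cubic_vars vec_act K using assms by (simp add: good_step_def)
  show ?thesis
  proof (rule exists_minimal_pres)
    \<comment> \<open>Shifted by i + 1, such a k becomes a degree of at least 3, where the complex
      of R is exact at every exterior degree.\<close>
    fix k assume "k > int i + 3"
    then have "koszul_exact (\<lambda>v. veronese_action (pvar v)) cubic_vars (cubic_module :: int \<Rightarrow> (nat,
      'a) mvpoly set) (Suc i + 0) (k - int (Suc i))"
      by (intro veronese_action_exact) auto
    then show "koszul_exact (\<lambda>v. vec_act (pvar v)) cubic_vars K 0 k" using assms unfolding
      good_step_def syz_exact_def by fast
  qed
qed

lemma good_step_Suc: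
  assumes "good_step i (n, sh, K)" "minimal_pres cubic_vars vec_act K n' sh' g"
  shows "good_step (Suc i) (n', sh', relations cubic_vars vec_act n' sh' g)"
  using assms graded_module.relations_graded_module[of cubic_vars vec_act K n' sh' g]
    syz_exact_Suc[of K "Suc i" n' sh' g]
  by (auto simp: good_step_def minimal_pres_def) (auto simp: relations_def)

lemma good_step_0:
  fixes g :: "nat \<Rightarrow> (nat, 'k::field_char_0) mvpoly"
  assumes "minimal_pres cubic_vars veronese_action cubic_module n sh g"
  shows "good_step 0 (n, sh, relations cubic_vars veronese_action n sh g)"
  using assms graded_module.relations_graded_module[OF veronese_graded_module, of n sh g]
    syz_exact_1[OF assms]
  by (auto simp: good_step_def minimal_pres_def) (auto simp: relations_def)

lemma exists_veronese_resolution: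
  "\<exists>F :: (nat \<Rightarrow>\<^sub>0 nat, 'k::field_char_0, (nat, 'k) mvpoly) graded_free_complex. veronese_resolution 3 3 F"
proof -
  interpret R: graded_module cubic_vars veronese_action "cubic_module :: int \<Rightarrow> (nat, 'k) mvpoly
    set" by (rule veronese_graded_module)
  \<comment> \<open>The bound 0 works because the complex of R is exact at exterior degree 0 in
    every positive degree.\<close>
  have "\<exists>n sh g. minimal_pres cubic_vars veronese_action (cubic_module :: int \<Rightarrow> (nat, 'k) mvpoly
    set) n sh g"
    by (rule R.exists_minimal_pres[of 0]) (intro veronese_action_exact, auto)
  then obtain n0 sh0 g0 where pres0: "minimal_pres cubic_vars veronese_action (cubic_module :: int
    \<Rightarrow> (nat, 'k) mvpoly set) n0 sh0 g0"
    by blast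
  \<comment> \<open>The clause for i = 0 fixes the start of the sequence, so that the first kernel
    is that of the chosen augmentation.\<close>
  define P where "P i x \<longleftrightarrow> good_step i x \<and> (i = 0 \<longrightarrow> x = (n0, sh0, relations cubic_vars
    veronese_action n0 sh0 g0))"
    for i and x :: "nat \<times> (nat \<Rightarrow> int) \<times> (int \<Rightarrow> (nat \<Rightarrow> (nat \<Rightarrow>\<^sub>0 nat, 'k) mvpoly) set)"
  define Q where "Q x y g \<longleftrightarrow> (case (x, y) of ((n, sh, K), (n', sh', K')) \<Rightarrow>
      minimal_pres cubic_vars vec_act K n' sh' g \<and> K' = relations cubic_vars vec_act n' sh' g)"
    for x y :: "nat \<times> (nat \<Rightarrow> int) \<times> (int \<Rightarrow> (nat \<Rightarrow> (nat \<Rightarrow>\<^sub>0 nat, 'k) mvpoly) set)" and g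
  have "\<exists>f. \<forall>i. P i (f i) \<and> (\<exists>g. Q (f i) (f (Suc i)) g)"
  proof (rule dependent_nat_choice)
    show "\<exists>x. P 0 x" using good_step_0[OF pres0] by (auto simp: P_def)
    fix x i assume x: "P i x"
    obtain n sh K where x_eq: "x = (n, sh, K)" by (cases x)
    then have good: "good_step i (n, sh, K)" using x by (simp add: P_def)
    then obtain n' sh' g where "minimal_pres cubic_vars vec_act K n' sh' g" using
      good_step_minimal_pres by blast
    then show "\<exists>y. P (Suc i) y \<and> (\<exists>g. Q x y g)"
      using good_step_Suc[OF good] unfolding P_def Q_def x_eq
      by (intro exI[of _ "(n', sh', relations cubic_vars vec_act n' sh' g)"]) auto
  qed
  then obtain f where f: "\<And>i. P i (f i)" "\<And>i. \<exists>g. Q (f i) (f (Suc i)) g" by blast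
  from f(2) obtain G where G: "\<And>i. Q (f i) (f (Suc i)) (G i)" by metis
  define n sh K where "n i = fst (f i)" and "sh i = fst (snd (f i))" and "K i = snd (snd (f i))" for i
  have f_eq: "f i = (n i, sh i, K i)" for i by (simp add: n_def sh_def K_def)
  have good: "good_step i (n i, sh i, K i)" for i using f(1)[of i] by (simp add: P_def f_eq)
  have f0: "n 0 = n0" "sh 0 = sh0" "K 0 = relations cubic_vars veronese_action n0 sh0 g0"
    using f(1)[of 0] by (simp_all add: P_def f_eq)
  have step: "minimal_pres cubic_vars vec_act (K i) (n (Suc i)) (sh (Suc i)) (G i)"
      "K (Suc i) = relations cubic_vars vec_act (n (Suc i)) (sh (Suc i)) (G i)" for i
    using G[of i] by (simp_all add: Q_def f_eq)
  have GM: "graded_module cubic_vars vec_act (K i)" for i using good[of i] by (simp add: good_step_def)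
  \<comment> \<open>The columns of the i-th matrix are the chosen generators of the kernel of the
    preceding map, hence the index i - 1. The length is the number of variables, as in Hilbert's
    syzygy theorem.\<close>
  define F :: "(nat \<Rightarrow>\<^sub>0 nat, 'k, (nat, 'k) mvpoly) graded_free_complex" where
    "F = \<lparr>res_length = card cubic_vars, rk = n, shift = sh, mat = (\<lambda>i a e. G (i - 1) e a), aug = g0\<rparr>"
  have F_simps: "res_length F = card cubic_vars" "rk F = n" "shift F = sh" "aug F = g0" "mat F i a
    e = G (i - 1) e a" for i a e
    by (simp_all add: F_def)
  have G_K: "G i e \<in> K i (sh (Suc i) e)" if "e < n (Suc i)" for i e
    using step(1)[of i] that by (simp add: minimal_pres_def generates_def)
  have G_free_deg: "G i e \<in> free_deg cubic_vars (n i) (sh i) (sh (Suc i) e)" if "e < n (Suc i)" for i e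
    using G_K[OF that] good[of i] by (auto simp: good_step_def)
  have diff: "differential F (Suc i) u = gen_map vec_act (n (Suc i)) (G i) u" for i u
  proof -
    have "columns F (Suc i) e = G i e" if "e < n (Suc i)" for e
      using G_free_deg[OF that] by (auto simp: columns_def F_simps free_deg_def fun_eq_iff)
    then show ?thesis unfolding differential_eq_gen_map gen_map_def F_simps by simp
  qed
  have image: "differential F (Suc i) ` free_mod cubic_vars (n (Suc i)) = total_module (K i)" for i
    using graded_module.gen_map_image_free_mod[OF GM, of i "n (Suc i)" "sh (Suc i)" "G i"] step(1)[of i]
    by (simp add: minimal_pres_def diff[abs_def])
  \<comment> \<open>A generator in a step beyond the number of variables would need Koszul homology
    of R at an exterior degree where there are no chains.\<close>
  have rk0: "n i = 0" if i: "i > card cubic_vars" for i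
  proof (cases i)
    case (Suc l)
    have "\<not> e < n i" for e
    proof
      assume e: "e < n i"
      have "koszul_exact (\<lambda>v. veronese_action (pvar v)) cubic_vars (cubic_module :: int \<Rightarrow> (nat,
        'k) mvpoly set) (Suc l + 0) (sh i e - int (Suc l))"
        using i Suc by (intro veronese_action_exact) auto
      then have "koszul_exact (\<lambda>v. vec_act (pvar v)) cubic_vars (K l) 0 (sh i e)"
        using good[of l] unfolding good_step_def syz_exact_def by fast
      then show False
        using graded_module.no_generator[OF GM step(1)[of l], of "sh i e" e] e Suc by simp
    qed
    from this[of 0] show ?thesis by simp
  qed (use i in simp)
  have g0: "\<forall>e<n0. g0 e \<in> cubic_module (sh0 e)" using pres0 by (simp add: minimal_pres_def generates_def)
  have Gg: "\<forall>e<n (Suc i). G i e \<in> K i (sh (Suc i) e)" for i using G_K by simp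
  have "graded_free_resolution cubic_vars veronese_action cubic_module F"
    unfolding graded_free_resolution_def
  proof (intro conjI allI impI)
    show "rk F i = 0" if "res_length F < i" for i using rk0[of i] that by (simp add: F_simps)
    show "aug F e \<in> cubic_module (shift F 0 e)" if "e < rk F 0" for e using g0 that by (simp add:
      F_simps f0)
    show "mat F i a e \<in> forms cubic_vars (shift F i e - shift F (i - 1) a)"
      if "1 \<le> i" "a < rk F (i - 1)" "e < rk F i" for i a e
      using G_free_deg[of e "i - 1"] that by (simp add: F_simps free_deg_def)
    show "augmentation veronese_action F ` free_mod cubic_vars (rk F 0) = total_module cubic_module"
      unfolding augmentation_eq_gen_map F_simps f0
      by (rule R.gen_map_image_free_mod[of n0 sh0]) (use pres0 in \<open>simp add: minimal_pres_def\<close>)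
    show "{u \<in> free_mod cubic_vars (rk F 0). augmentation veronese_action F u = 0} = differential
      F 1 ` free_mod cubic_vars (rk F 1)"
      using R.total_module_relations[OF g0] image[of 0] unfolding augmentation_eq_gen_map by (simp
        add: F_simps f0)
    show "{u \<in> free_mod cubic_vars (rk F i). differential F i u = (\<lambda>_. 0)} = differential F (i +
      1) ` free_mod cubic_vars (rk F (i + 1))"
      if "1 \<le> i" for i
    proof -
      obtain l where i: "i = Suc l" using \<open>1 \<le> i\<close> by (cases i) auto
      show ?thesis
        using graded_module.total_module_relations[OF GM Gg, of l] image[of i] step(2)[of l]
        by (simp add: i diff F_simps zero_fun_def)
    qed
  qed
  moreover have "differential F i u a \<in> irrelevant_ideal cubic_vars"
    if "1 \<le> i" "u \<in> free_mod cubic_vars (rk F i)" "a < rk F (i - 1)" for i u a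
  proof -
    obtain l where i: "i = Suc l" using \<open>1 \<le> i\<close> by (cases i) auto
    have "differential F i u \<in> total_module (K l)" using image[of l] that(2) by (auto simp: i F_simps)
    then obtain I y where y: "\<And>k. k \<in> I \<Longrightarrow> y k \<in> K l k" "differential F i u = (\<Sum>k\<in>I. y k)"
      unfolding total_module_def by blast
    have yf: "y k \<in> free_deg cubic_vars (n l) (sh l) k" "lookup (y k a) 0 = 0" if "k \<in> I" for k
      using y(1)[OF that] good[of l] by (auto simp: good_step_def)
    have "differential F i u \<in> free_mod cubic_vars (n l)"
      unfolding y(2) by (rule subgroup_add_sum[OF subgroup_add_free_mod]) (use yf
        free_deg_free_mod in blast)
    then have "differential F i u a \<in> polys cubic_vars" using that(3) by (simp add: free_mod_def
      F_simps i)
    moreover have "lookup (differential F i u a) 0 = 0"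
      by (simp add: y(2) sum_fun_apply lookup_sum yf(2))
    ultimately show ?thesis by (simp add: irrelevant_ideal_def)
  qed
  ultimately have "veronese_resolution 3 3 F" by (simp add: minimal_graded_free_resolution_def)
  then show ?thesis by blast
qed

theorem lemma3p3:
  shows "veronese_property_N TYPE('k::{alg_closed_field, field_char_0}) 3 3 6"
  unfolding veronese_property_N_def
  using exists_veronese_resolution veronese_betti by blast

end
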